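(* For the Random Algorithm and any $\beta>0$, the geometric distribution with parameter $\beta/(1+\beta)$ is the equilibrium (invariant) distribution of the McKean–Vlasov process defined in the context. If $Y_\beta$ is a random variable with such a distribution, then, for the convergence in distribution, $$\lim_{\beta\to+\infty}\frac{Y_\beta}{\beta}=E_1,$$ where $E_1$ is an exponentially distributed random variable with parameter $1$.
   Context: $\mathbb{N}=\{0,1,2,\ldots\}$. For the Random Algorithm (each ball is placed uniformly at random in a neighboring urn) the associated functional is $\Psi\equiv1$. The McKean–Vlasov process associated to a functional $\Psi$ on $M_1(\mathbb{N})\times\mathbb{N}$ (with $M_1(\mathbb{N})$ the probability distributions on $\mathbb{N}$) and $\beta>0$ is the càdlàg $\mathbb{N}$-valued process $(L(t))$ satisfying $dL(t)=\overline{\mathcal{P}}(dt\times[0,\beta\Psi(\pi(t),L(t-))])-L(t-)\,\mathcal{P}(dt)$, where $\pi(t)$ is the distribution of $L(t)$ and $\overline{\mathcal{P}}$, $\mathcal{P}$ are independent homogeneous Poisson point processes with rate 1 on $\mathbb{R}_+^2$ and $\mathbb{R}_+$ respectively. A distribution $\pi$ on $\mathbb{N}$ is invariant if, whenever $L(0)$ has distribution $\pi$, the processes $(L(t+T))_{t\ge0}$ and $(L(t))_{t\ge0}$ have the same distribution for every $T>0$. The geometric distribution with parameter $\delta\in(0,1)$ is $n\mapsto(1-\delta)\delta^n$ on $\mathbb{N}$. *)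

theory Defs
  imports "HOL-Probability.Probability"
begin

section \<open>Poisson point processes\<close>

text \<open>\<^const>\<open>poisson_pmf\<close> is specified for positive rates only.\<close>

definition poisson_law :: "real \<Rightarrow> nat pmf" where
  "poisson_law r = (if r = 0 then return_pmf 0 else poisson_pmf r)"

text \<open>
  A point process is represented by the random set of its points. This loses nothing for the
  diffuse intensities used below, since a Poisson process with a diffuse intensity almost surely
  has no multiple points. The intensity \<open>\<mu>\<close> also fixes the state space, \<^term>\<open>space \<mu>\<close>.
  Finiteness of the counts is a separate requirement because \<^const>\<open>card\<close> is \<open>0\<close> on infinite sets.
\<close>

definition poisson_point_process :: "'w measure \<Rightarrow> 'e measure \<Rightarrow> ('w \<Rightarrow> 'e set) \<Rightarrow> bool" where
  "poisson_point_process M \<mu> Z \<longleftrightarrow>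
     prob_space M \<and>
     (\<forall>\<omega>\<in>space M. Z \<omega> \<subseteq> space \<mu>) \<and>
     (\<forall>A\<in>sets \<mu>. emeasure \<mu> A < \<infinity> \<longrightarrow>
        (AE \<omega> in M. finite (Z \<omega> \<inter> A)) \<and>
        (\<lambda>\<omega>. card (Z \<omega> \<inter> A)) \<in> measurable M (count_space UNIV) \<and>
        distr M (count_space UNIV) (\<lambda>\<omega>. card (Z \<omega> \<inter> A)) =
          measure_pmf (poisson_law (measure \<mu> A))) \<and>
     (\<forall>(A :: nat \<Rightarrow> 'e set) n.
        (\<forall>i<n. A i \<in> sets \<mu> \<and> emeasure \<mu> (A i) < \<infinity>) \<and> disjoint_family_on A {..<n} \<longrightarrow>
        prob_space.indep_vars M (\<lambda>_. count_space UNIV) (\<lambda>i \<omega>. card (Z \<omega> \<inter> A i)) {..<n})"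

definition point_process_events ::
    "'w measure \<Rightarrow> 'e measure \<Rightarrow> ('w \<Rightarrow> 'e set) \<Rightarrow> 'w set set" where
  "point_process_events M \<mu> Z =
     sigma_sets (space M)
       {(\<lambda>\<omega>. card (Z \<omega> \<inter> A)) -` {k} \<inter> space M | A k. A \<in> sets \<mu> \<and> emeasure \<mu> A < \<infinity>}"

definition initial_events :: "'w measure \<Rightarrow> ('w \<Rightarrow> nat) \<Rightarrow> 'w set set" where
  "initial_events M X = {X -` B \<inter> space M | B. True}"

text \<open>The intensities of the rate 1 homogeneous processes on the quarter plane and the half line.\<close>

definition quarter_plane :: "(real \<times> real) measure" where
  "quarter_plane = restrict_space lborel ({0..} \<times> {0..})"

definition half_line :: "real measure" where
  "half_line = restrict_space lborel {0..}"


section \<open>The McKean--Vlasov process\<close>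

definition cadlag :: "(real \<Rightarrow> 'a::topological_space) \<Rightarrow> bool" where
  "cadlag f \<longleftrightarrow>
     (\<forall>t\<ge>0. (f \<longlongrightarrow> f t) (at_right t)) \<and> (\<forall>t>0. \<exists>l. (f \<longlongrightarrow> l) (at_left t))"

definition left_limit :: "(real \<Rightarrow> 'a::t2_space) \<Rightarrow> real \<Rightarrow> 'a" where
  "left_limit f t = Lim (at_left t) f"

text \<open>
  The points of the driving process on the quarter plane that are counted by
  \<open>\<integral>\<^sub>(\<^sub>0\<^sub>,\<^sub>t\<^sub>]\<close> of \<open>Pbar(ds \<times> [0, \<beta> \<Psi>(p(s), x(s-))])\<close>, for a path \<open>x\<close> and a flow of laws \<open>p\<close>.
\<close>

definition arrivals ::
    "(nat pmf \<Rightarrow> nat \<Rightarrow> real) \<Rightarrow> real \<Rightarrow> (real \<Rightarrow> nat pmf) \<Rightarrow> (real \<times> real) set \<Rightarrow> (real \<Rightarrow> nat) \<Rightarrow>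
      real \<Rightarrow> (real \<times> real) set" where
  "arrivals \<Psi> \<beta> p S x t =
     {(s, u) \<in> S. 0 < s \<and> s \<le> t \<and> 0 \<le> u \<and> u \<le> \<beta> * \<Psi> (p s) (left_limit x s)}"

text \<open>
  The stochastic differential equation in integrated form. The two integrals are a cardinality and
  a sum, with values that are meaningful only on finite sets. As usual for such an equation, the
  initial value is independent of the pair of driving processes.
\<close>

definition mckean_vlasov_process ::
    "(nat pmf \<Rightarrow> nat \<Rightarrow> real) \<Rightarrow> real \<Rightarrow> 'w measure \<Rightarrow> ('w \<Rightarrow> (real \<times> real) set) \<Rightarrow> ('w \<Rightarrow> real set) \<Rightarrow>
      (real \<Rightarrow> 'w \<Rightarrow> nat) \<Rightarrow> bool" where
  "mckean_vlasov_process \<Psi> \<beta> M Pbar P L \<longleftrightarrow>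
     prob_space M \<and>
     poisson_point_process M quarter_plane Pbar \<and>
     poisson_point_process M half_line P \<and>
     prob_space.indep_set M
       (point_process_events M quarter_plane Pbar) (point_process_events M half_line P) \<and>
     prob_space.indep_set M
       (initial_events M (L 0))
       (sigma_sets (space M)
         (point_process_events M quarter_plane Pbar \<union> point_process_events M half_line P)) \<and>
     (\<forall>t\<ge>0. L t \<in> measurable M (count_space UNIV)) \<and>
     (\<exists>p :: real \<Rightarrow> nat pmf.
        (\<forall>t\<ge>0. distr M (count_space UNIV) (L t) = measure_pmf (p t)) \<and>
        (AE \<omega> in M.
           cadlag (\<lambda>t. L t \<omega>) \<and>
           (\<forall>t\<ge>0.
              finite (arrivals \<Psi> \<beta> p (Pbar \<omega>) (\<lambda>s. L s \<omega>) t) \<and>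
              finite (P \<omega> \<inter> {0<..t}) \<and>
              int (L t \<omega>) =
                int (L 0 \<omega>)
                + int (card (arrivals \<Psi> \<beta> p (Pbar \<omega>) (\<lambda>s. L s \<omega>) t))
                - (\<Sum>s\<in>P \<omega> \<inter> {0<..t}. int (left_limit (\<lambda>r. L r \<omega>) s)))))"

text \<open>
  The law of a process as a probability measure on the paths, with the \<open>\<sigma>\<close>-algebra generated by
  the evaluation maps; on cadlag paths this is the Borel \<open>\<sigma>\<close>-algebra of the Skorokhod topology.
\<close>

definition path_law :: "'w measure \<Rightarrow> (real \<Rightarrow> 'w \<Rightarrow> nat) \<Rightarrow> (real \<Rightarrow> nat) measure" where
  "path_law M X = distr M (PiM {0..} (\<lambda>_. count_space UNIV)) (\<lambda>\<omega>. \<lambda>t\<in>{0..}. X t \<omega>)"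

text \<open>
  HOL cannot quantify over all probability spaces inside a formula, so the type of the sample space
  is a parameter.
\<close>

definition invariant_distribution ::
    "'w itself \<Rightarrow> (nat pmf \<Rightarrow> nat \<Rightarrow> real) \<Rightarrow> real \<Rightarrow> nat pmf \<Rightarrow> bool" where
  "invariant_distribution W \<Psi> \<beta> \<pi> \<longleftrightarrow>
     (\<forall>(M :: 'w measure) Pbar P L.
        mckean_vlasov_process \<Psi> \<beta> M Pbar P L \<and>
        distr M (count_space UNIV) (L 0) = measure_pmf \<pi> \<longrightarrow>
        (\<forall>T>0. path_law M (\<lambda>t. L (t + T)) = path_law M L))"

definition random_algorithm :: "nat pmf \<Rightarrow> nat \<Rightarrow> real" where
  "random_algorithm = (\<lambda>_ _. 1)"


section \<open>Geometric distribution and convergence in distribution\<close>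

text \<open>The parameter of \<^const>\<open>geometric_pmf\<close> is the success probability \<open>1 - \<delta>\<close>.\<close>

definition geometric_law :: "real \<Rightarrow> nat pmf" where
  "geometric_law \<delta> = geometric_pmf (1 - \<delta>)"

lemma pmf_geometric_law:
  assumes "0 < \<delta>" "\<delta> < 1"
  shows "pmf (geometric_law \<delta>) n = (1 - \<delta>) * \<delta> ^ n"
  using assms by (simp add: geometric_law_def)

text \<open>\<^const>\<open>weak_conv_m\<close> covers sequences only; this is the same notion along a filter.\<close>

definition weak_conv_along :: "('i \<Rightarrow> real measure) \<Rightarrow> real measure \<Rightarrow> 'i filter \<Rightarrow> bool" where
  "weak_conv_along \<mu> \<nu> F \<longleftrightarrow>
     (\<forall>x. isCont (cdf \<nu>) x \<longrightarrow> ((\<lambda>i. cdf (\<mu> i) x) \<longlongrightarrow> cdf \<nu> x) F)"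

lemma weak_conv_along_sequentially:
  "weak_conv_along \<mu> \<nu> sequentially \<longleftrightarrow> weak_conv_m \<mu> \<nu>"
  by (simp add: weak_conv_along_def weak_conv_m_def weak_conv_def)

end

theory Submission
  imports Defs "HOL-Real_Asymp.Real_Asymp"
begin

text \<open>
  For the Random Algorithm the process only sees the points of the first Poisson process below
  height \<open>\<beta>\<close>: the queue grows by one at rate \<open>\<beta>\<close> and is emptied at rate \<open>1\<close>, and the
  equation does not couple the process to its own law. Three arguments are combined.

  \<^emph>\<open>Law of the process.\<close> On a cell \<open>(s, t]\<close> without reset the queue grows by the number of
  arrivals; on a cell with a reset and without arrival it ends empty. The remaining cells have
  probability \<open>O((t - s)\<^sup>2)\<close>, so that with \<open>m\<close> cells of length \<open>t/m\<close> the process agrees, up to an event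
  of probability \<open>O(1/m)\<close>, with a Markov chain driven by independent cells. This gives at once the
  Markov property and the one-dimensional laws (\<open>past_evolution\<close>). One step of the chain contracts
  the distance of two laws by \<open>exp (- t/m)\<close>, and it has a geometric distribution, of a parameter tending
  to \<open>\<beta> / (1 + \<beta>)\<close>, as an exact fixed point. In the limit the distance to the geometric
  distribution decays like \<open>exp (- t)\<close> (\<open>distance_to_geometric\<close>). Hence that distribution is
  preserved, with the Markov property it is invariant, and an invariant distribution \<open>\<pi>\<close> of a process
  that starts from \<open>\<pi>\<close> has to coincide with it.

  \<^emph>\<open>Existence.\<close> Uniqueness of the invariant distribution would be void for an initial law from
  which no process starts, so a solution is built on the sequences of reals for every initial law. The
  Poisson processes consist of a Poisson number of independent uniform points in each unit cell;
  their counts are identified by probability generating functions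
  (\<open>poisson_point_process_points\<close>). The solution counts the arrivals that no later reset has
  removed (\<open>reset_path_equation\<close>).

  \<^emph>\<open>Scaling.\<close> The distribution function of \<open>Y\<^sub>\<beta>/\<beta>\<close> at \<open>x \<ge> 0\<close> is
  \<open>1 - (\<beta> / (1 + \<beta>)) ^ (\<lfloor>\<beta> x\<rfloor> + 1)\<close>, which tends to \<open>1 - exp (- x)\<close>.
\<close>

section \<open>A Markov chain with resets and its geometric fixed point\<close>

text \<open>
  One step of the chain that jumps to \<open>0\<close> with probability \<open>1 - p\<close>, and otherwise moves up by one
  with probability \<open>1 - x\<close>. It acts on functions \<open>u l = P (E \<inter> {X = l})\<close> for an event \<open>E\<close>
  of probability \<open>c\<close>; the mass that is sent to \<open>0\<close> depends on \<open>u\<close> only through \<open>c\<close>, which is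
  therefore kept as a parameter instead of the infinite sum of \<open>u\<close>.
\<close>

definition reset_step :: "real \<Rightarrow> real \<Rightarrow> real \<Rightarrow> (nat \<Rightarrow> real) \<Rightarrow> nat \<Rightarrow> real" where
  "reset_step p x c u l =
     p * (x * u l + (case l of 0 \<Rightarrow> 0 | Suc k \<Rightarrow> (1 - x) * u k)) + (if l = 0 then (1 - p) * c else 0)"

text \<open>
  The reset term is the same for \<open>u\<close> and \<open>v\<close> and cancels; what is left is \<open>p\<close> times a convex
  combination of two earlier differences. A bound up to \<open>l\<close> is enough because the chain moves up only
  from \<open>l - 1\<close>; this locality later allows pointwise instead of uniform convergence.
\<close>

lemma reset_step_contraction:
  assumes "0 \<le> p" "0 \<le> x" "x \<le> 1" and le: "\<And>k. k \<le> l \<Longrightarrow> \<bar>u k - v k\<bar> \<le> K"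
  shows "\<bar>reset_step p x c u l - reset_step p x c v l\<bar> \<le> p * K"
proof -
  have K: "0 \<le> K" using le[of 0] by linarith
  have eq: "reset_step p x c u l - reset_step p x c v l =
      p * (x * (u l - v l) + (case l of 0 \<Rightarrow> 0 | Suc k \<Rightarrow> (1 - x) * (u k - v k)))"
    by (simp add: reset_step_def algebra_simps split: nat.split)
  have "\<bar>x * (u l - v l) + (case l of 0 \<Rightarrow> 0 | Suc k \<Rightarrow> (1 - x) * (u k - v k))\<bar> \<le> x * K + (1 - x) * K"
  proof (rule order_trans[OF abs_triangle_ineq add_mono])
    show "\<bar>x * (u l - v l)\<bar> \<le> x * K"
      using assms by (simp add: abs_mult mult_left_mono)
    show "\<bar>case l of 0 \<Rightarrow> 0 | Suc k \<Rightarrow> (1 - x) * (u k - v k)\<bar> \<le> (1 - x) * K"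
      using assms K by (auto simp: abs_mult intro: mult_left_mono split: nat.split)
  qed
  also have "\<dots> = K" by (simp add: algebra_simps)
  finally show ?thesis
    unfolding eq using assms(1) by (simp add: abs_mult mult_left_mono)
qed

lemma reset_step_iterate_contraction:
  assumes "0 \<le> p" "0 \<le> x" "x \<le> 1" and le: "\<And>k. k \<le> l \<Longrightarrow> \<bar>u k - v k\<bar> \<le> K"
  shows "\<bar>(reset_step p x c ^^ m) u l - (reset_step p x c ^^ m) v l\<bar> \<le> p ^ m * K"
  using le
proof (induction m arbitrary: l)
  case 0
  then show ?case by simp
next
  case (Suc m)
  have "\<bar>(reset_step p x c ^^ m) u k - (reset_step p x c ^^ m) v k\<bar> \<le> p ^ m * K" if "k \<le> l" for k
    using Suc that by (meson order_trans)
  from reset_step_contraction[OF assms(1-3) this, where c = c] show ?case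
    by (simp add: mult.assoc)
qed

definition geometric_mass :: "real \<Rightarrow> nat \<Rightarrow> real" where
  "geometric_mass \<delta> l = (1 - \<delta>) * \<delta> ^ l"

text \<open>
  The fixed point equation is a first order recursion with ratio \<open>d = p (1 - x) / (1 - p x)\<close>,
  and its initial value \<open>(1 - p) / (1 - p x)\<close> is exactly \<open>1 - d\<close>.
\<close>

lemma reset_step_geometric:
  assumes "p * x < 1" "d = p * (1 - x) / (1 - p * x)"
  shows "reset_step p x 1 (geometric_mass d) = geometric_mass d"
proof
  fix l
  have d: "p * x * d + p * (1 - x) = d" "p * x * (1 - d) + (1 - p) = 1 - d"
    using assms by (simp_all add: divide_simps) (simp_all add: algebra_simps)
  show "reset_step p x 1 (geometric_mass d) l = geometric_mass d l"
  proof (cases l)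
    case 0
    then show ?thesis using d(2) by (simp add: reset_step_def geometric_mass_def algebra_simps)
  next
    case (Suc k)
    have "reset_step p x 1 (geometric_mass d) l = (1 - d) * d ^ k * (p * x * d + p * (1 - x))"
      unfolding reset_step_def geometric_mass_def Suc by (simp add: algebra_simps)
    then show ?thesis
      unfolding d(1) geometric_mass_def Suc by simp
  qed
qed

lemma geometric_parameter_limit:
  assumes "0 < \<beta>" "0 < t"
  shows "(\<lambda>m. exp (- (t / real m)) * (1 - exp (- (\<beta> * (t / real m)))) /
           (1 - exp (- (t / real m)) * exp (- (\<beta> * (t / real m))))) \<longlonglongrightarrow> \<beta> / (1 + \<beta>)"
proof -
  have "((\<lambda>h. exp (- h) * (1 - exp (- (\<beta> * h))) / (1 - exp (- h) * exp (- (\<beta> * h))))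
          \<longlongrightarrow> \<beta> * inverse (1 + \<beta>)) (at_right 0)"
    using assms(1) by real_asymp
  moreover have "filterlim (\<lambda>m. t / real m) (at_right 0) sequentially"
    using assms(2) by real_asymp
  ultimately show ?thesis unfolding divide_inverse[of \<beta>] by (rule filterlim_compose)
qed

text \<open>
  After \<open>m\<close> steps of length \<open>t/m\<close> the contraction factor is \<open>exp (- t/m) ^ m = exp (- t)\<close>,
  for every \<open>m\<close>. Only the fixed point of the chain depends on \<open>m\<close>, and it converges to the geometric
  distribution of parameter \<open>\<beta> / (1 + \<beta>)\<close>.
\<close>

lemma reset_chain_limit_bound:
  assumes "0 < \<beta>" "0 < t" and le: "\<And>l. \<bar>u l - geometric_mass (\<beta> / (1 + \<beta>)) l\<bar> \<le> K"
    and lim: "(\<lambda>m. (reset_step (exp (- (t / real m))) (exp (- (\<beta> * (t / real m)))) 1 ^^ m) u l)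
                \<longlonglongrightarrow> y"
  shows "\<bar>y - geometric_mass (\<beta> / (1 + \<beta>)) l\<bar> \<le> exp (- t) * K"
proof -
  define g where "g = geometric_mass (\<beta> / (1 + \<beta>))"
  define p where "p = (\<lambda>m. exp (- (t / real m)))"
  define x where "x = (\<lambda>m. exp (- (\<beta> * (t / real m))))"
  define d where "d = (\<lambda>m. p m * (1 - x m) / (1 - p m * x m))"
  \<comment> \<open>a bound for the distance of u to the fixed point of the m-th chain on the levels up to l\<close>
  define K' where "K' = (\<lambda>m. K + (\<Sum>k\<le>l. \<bar>g k - geometric_mass (d m) k\<bar>))"
  have d: "d \<longlonglongrightarrow> \<beta> / (1 + \<beta>)"
    unfolding d_def p_def x_def by (rule geometric_parameter_limit[OF assms(1,2)])
  have gd: "(\<lambda>m. geometric_mass (d m) k) \<longlonglongrightarrow> g k" for k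
    unfolding g_def geometric_mass_def by (intro tendsto_intros d)
  have "K' \<longlonglongrightarrow> K + (\<Sum>k\<le>l. \<bar>g k - g k\<bar>)"
    unfolding K'_def by (intro tendsto_intros gd)
  then have K': "(\<lambda>m. exp (- t) * K' m) \<longlonglongrightarrow> exp (- t) * K"
    by (intro tendsto_intros) simp
  have bound: "\<bar>(reset_step (p m) (x m) 1 ^^ m) u l - geometric_mass (d m) l\<bar> \<le> exp (- t) * K' m"
    if "0 < m" for m
  proof -
    have pos: "0 < t / real m" "0 < \<beta> * (t / real m)"
      using assms that by simp_all
    have "p m * x m = exp (- (t / real m + \<beta> * (t / real m)))"
      by (simp add: p_def x_def mult_exp_exp)
    moreover have "- (t / real m + \<beta> * (t / real m)) < 0"
      using pos by linarith
    ultimately have px: "p m * x m < 1"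
      by (simp only: exp_less_one_iff)
    have range: "0 \<le> p m" "0 \<le> x m" "x m \<le> 1" and pm: "p m ^ m = exp (- t)"
      using that pos by (auto simp: p_def x_def simp flip: exp_of_nat_mult)
    have "(reset_step (p m) (x m) 1 ^^ i) (geometric_mass (d m)) = geometric_mass (d m)" for i
      by (induction i) (simp_all add: reset_step_geometric[OF px d_def[THEN fun_cong]])
    moreover have "\<bar>u k - geometric_mass (d m) k\<bar> \<le> K' m" if "k \<le> l" for k
    proof -
      have "\<bar>u k - geometric_mass (d m) k\<bar> \<le> \<bar>u k - g k\<bar> + \<bar>g k - geometric_mass (d m) k\<bar>"
        by linarith
      also have "\<dots> \<le> K' m"
        unfolding K'_def using le[of k] that
        by (intro add_mono member_le_sum[of _ _ "\<lambda>k. \<bar>g k - geometric_mass (d m) k\<bar>"]) (auto simp: g_def)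
      finally show ?thesis .
    qed
    ultimately show ?thesis
      using reset_step_iterate_contraction[OF range, where u = u and v = "geometric_mass (d m)" and c = 1 and l = l and m = m] pm
      by simp
  qed
  have "(\<lambda>m. \<bar>(reset_step (p m) (x m) 1 ^^ m) u l - geometric_mass (d m) l\<bar>) \<longlonglongrightarrow> \<bar>y - g l\<bar>"
    using lim by (intro tendsto_intros gd) (simp add: p_def x_def)
  then have "\<bar>y - g l\<bar> \<le> exp (- t) * K"
    by (rule LIMSEQ_le[OF _ K']) (use bound in \<open>auto intro!: exI[of _ 1]\<close>)
  then show ?thesis by (simp add: g_def)
qed

section \<open>Processes observed on cells\<close>

lemma pmf_poisson_law: "0 \<le> r \<Longrightarrow> pmf (poisson_law r) k = r ^ k / fact k * exp (- r)"
  by (cases "r = 0"; cases k) (auto simp: poisson_law_def)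

lemma poisson_law_0: "0 \<le> r \<Longrightarrow> measure (poisson_law r) {0} = exp (- r)"
  by (simp add: pmf_poisson_law measure_pmf_single)

lemma poisson_law_not_0: "0 \<le> r \<Longrightarrow> measure (poisson_law r) (- {0}) = 1 - exp (- r)"
  using measure_pmf.prob_compl[of "{0}" "poisson_law r"] by (simp add: poisson_law_0 Compl_eq_Diff_UNIV)

lemma poisson_law_ge_2:
  assumes "0 \<le> r"
  shows "measure (poisson_law r) {2..} \<le> r\<^sup>2"
proof -
  have "measure (poisson_law r) ({2..}) = 1 - measure (poisson_law r) {0, 1}"
  proof -
    have "{2..} = UNIV - {0, 1::nat}" by auto
    then show ?thesis using measure_pmf.prob_compl[of "{0,1}" "poisson_law r"] by simp
  qed
  also have "measure (poisson_law r) {0, 1} = (1 + r) * exp (- r)"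
    using assms by (subst measure_measure_pmf_finite) (simp_all add: pmf_poisson_law algebra_simps)
  also have "1 - (1 + r) * exp (- r) \<le> r\<^sup>2"
  proof -
    have "(1 + r) * (1 - r) \<le> (1 + r) * exp (- r)"
      using assms exp_ge_add_one_self[of "-r"] by (intro mult_left_mono) auto
    then show ?thesis by (simp add: power2_eq_square algebra_simps)
  qed
  finally show ?thesis .
qed

text \<open>
  What the law of the process depends on: \<open>a s t\<close> and \<open>b s t\<close> count the arrivals and the resets in
  the cell \<open>(s, t]\<close>. Cells with both arrivals and resets are left out of \<open>dynamics\<close>, since there the
  order of the points matters.
\<close>

locale reset_process = prob_space M for M :: "'w measure" +
  fixes \<beta> :: real and a b :: "real \<Rightarrow> real \<Rightarrow> 'w \<Rightarrow> nat" and L :: "real \<Rightarrow> 'w \<Rightarrow> nat"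
  assumes rate: "0 < \<beta>"
    and measurable_a: "0 \<le> s \<Longrightarrow> s \<le> t \<Longrightarrow> a s t \<in> measurable M (count_space UNIV)"
    and measurable_b: "0 \<le> s \<Longrightarrow> s \<le> t \<Longrightarrow> b s t \<in> measurable M (count_space UNIV)"
    and measurable_L: "0 \<le> t \<Longrightarrow> L t \<in> measurable M (count_space UNIV)"
    and distr_a: "0 \<le> s \<Longrightarrow> s \<le> t \<Longrightarrow>
      distr M (count_space UNIV) (a s t) = measure_pmf (poisson_law (\<beta> * (t - s)))"
    and distr_b: "0 \<le> s \<Longrightarrow> s \<le> t \<Longrightarrow>
      distr M (count_space UNIV) (b s t) = measure_pmf (poisson_law (t - s))"
    and independent_cells: "incseq g \<Longrightarrow> g 0 = 0 \<Longrightarrow>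
      prob {\<omega>\<in>space M. L 0 \<omega> \<in> K \<and>
              (\<forall>j<m. a (g j) (g (Suc j)) \<omega> \<in> A j \<and> b (g j) (g (Suc j)) \<omega> \<in> B j)} =
      prob {\<omega>\<in>space M. L 0 \<omega> \<in> K} *
        (\<Prod>j<m. prob {\<omega>\<in>space M. a (g j) (g (Suc j)) \<omega> \<in> A j} *
                prob {\<omega>\<in>space M. b (g j) (g (Suc j)) \<omega> \<in> B j})"
    and dynamics: "AE \<omega> in M. \<forall>s t. 0 \<le> s \<and> s \<le> t \<longrightarrow>
      (b s t \<omega> = 0 \<longrightarrow> L t \<omega> = L s \<omega> + a s t \<omega>) \<and>
      (b s t \<omega> \<noteq> 0 \<and> a s t \<omega> = 0 \<longrightarrow> L t \<omega> = 0)"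
begin

text \<open>
  The constraints \<open>A j\<close>, \<open>B j\<close> are sets of counts, so that \<open>UNIV\<close> leaves a cell unconstrained and
  the same form covers all events about finitely many consecutive cells.
\<close>

definition cells :: "(nat \<Rightarrow> real) \<Rightarrow> nat \<Rightarrow> (nat \<Rightarrow> nat set) \<Rightarrow> (nat \<Rightarrow> nat set) \<Rightarrow> 'w set" where
  "cells g m A B = {\<omega>\<in>space M. \<forall>j<m. a (g j) (g (Suc j)) \<omega> \<in> A j \<and> b (g j) (g (Suc j)) \<omega> \<in> B j}"

definition cells_prob :: "(nat \<Rightarrow> real) \<Rightarrow> nat \<Rightarrow> (nat \<Rightarrow> nat set) \<Rightarrow> (nat \<Rightarrow> nat set) \<Rightarrow> real" where
  "cells_prob g m A B = (\<Prod>j<m. prob {\<omega>\<in>space M. a (g j) (g (Suc j)) \<omega> \<in> A j} *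
                               prob {\<omega>\<in>space M. b (g j) (g (Suc j)) \<omega> \<in> B j})"

text \<open>
  The events \<open>E\<close> that are independent of everything that happens in cells after time \<open>s\<close>. This product
  formula replaces a \<open>\<sigma>\<close>-algebra of the past: it is stable under the operations needed below
  (adding a cell, disjoint unions, limits), and no measurability of the paths with respect to the
  driving processes has to be shown.
\<close>

definition past :: "real \<Rightarrow> 'w set \<Rightarrow> bool" where
  "past s E \<longleftrightarrow> 0 \<le> s \<and> E \<in> events \<and>
     (\<forall>g m A B. incseq g \<longrightarrow> g 0 = s \<longrightarrow> prob (E \<inter> cells g m A B) = prob E * cells_prob g m A B)"

definition cell :: "real \<Rightarrow> real \<Rightarrow> nat set \<Rightarrow> nat set \<Rightarrow> 'w set" where
  "cell s t A B = {\<omega>\<in>space M. a s t \<omega> \<in> A \<and> b s t \<omega> \<in> B}"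

lemma sets_a[measurable]: "0 \<le> s \<Longrightarrow> s \<le> t \<Longrightarrow> {\<omega>\<in>space M. a s t \<omega> \<in> A} \<in> events"
  by (rule measurable_sets_Collect[OF measurable_a]) auto

lemma sets_b[measurable]: "0 \<le> s \<Longrightarrow> s \<le> t \<Longrightarrow> {\<omega>\<in>space M. b s t \<omega> \<in> A} \<in> events"
  by (rule measurable_sets_Collect[OF measurable_b]) auto

lemma sets_L[measurable]: "0 \<le> t \<Longrightarrow> {\<omega>\<in>space M. L t \<omega> = k} \<in> events"
  by (rule measurable_sets_Collect[OF measurable_L]) auto

lemma cell_eq: "cell s t A B = {\<omega>\<in>space M. a s t \<omega> \<in> A} \<inter> {\<omega>\<in>space M. b s t \<omega> \<in> B}"
  by (auto simp: cell_def)

lemma sets_cell: "0 \<le> s \<Longrightarrow> s \<le> t \<Longrightarrow> cell s t A B \<in> events"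
  unfolding cell_eq by (intro sets.Int sets_a sets_b)

lemma sets_cells: "incseq g \<Longrightarrow> 0 \<le> g 0 \<Longrightarrow> cells g m A B \<in> events"
proof -
  assume g: "incseq g" "0 \<le> g 0"
  have "cells g m A B = space M \<inter> (\<Inter>j<m. cell (g j) (g (Suc j)) (A j) (B j))"
    by (auto simp: cells_def cell_def)
  also have "\<dots> \<in> events"
  proof (induction m)
    case (Suc m)
    have "cell (g m) (g (Suc m)) (A m) (B m) \<in> events"
      using g incseqD[OF g(1), of 0 m] incseqD[OF g(1), of m "Suc m"] by (intro sets_cell) auto
    then show ?case using Suc by (simp add: lessThan_Suc Int_left_commute[of "space M"] sets.Int)
  qed simp
  finally show ?thesis .
qed

lemma past_events: "past s E \<Longrightarrow> E \<in> events"
  by (simp add: past_def)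

lemma past_cells:
  "past s E \<Longrightarrow> incseq g \<Longrightarrow> g 0 = s \<Longrightarrow> prob (E \<inter> cells g m A B) = prob E * cells_prob g m A B"
  by (simp add: past_def)

lemma past_initial: "past 0 {\<omega>\<in>space M. L 0 \<omega> \<in> K}"
proof -
  have "{\<omega>\<in>space M. L 0 \<omega> \<in> K} \<inter> cells g m A B = {\<omega>\<in>space M. L 0 \<omega> \<in> K \<and>
              (\<forall>j<m. a (g j) (g (Suc j)) \<omega> \<in> A j \<and> b (g j) (g (Suc j)) \<omega> \<in> B j)}" for g m A B
    by (auto simp: cells_def)
  moreover have "{\<omega>\<in>space M. L 0 \<omega> \<in> K} \<in> events"
    by (rule measurable_sets_Collect[OF measurable_L]) auto
  ultimately show ?thesis
    by (simp add: past_def cells_prob_def independent_cells)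
qed

text \<open>
  A cell that ends at \<open>t\<close>, put in front of a grid that starts at \<open>t\<close>, is a grid that starts at \<open>s\<close>.
\<close>

lemma past_cell:
  assumes "past s E" "s \<le> t"
  shows "past t (E \<inter> cell s t A B)"
    and "prob (E \<inter> cell s t A B) =
      prob E * (prob {\<omega>\<in>space M. a s t \<omega> \<in> A} * prob {\<omega>\<in>space M. b s t \<omega> \<in> B})"
proof -
  have s: "0 \<le> s" "E \<in> events" using assms by (simp_all add: past_def)
  have *: "prob (E \<inter> cell s t A B \<inter> cells g m A' B') =
      prob E * (prob {\<omega>\<in>space M. a s t \<omega> \<in> A} * prob {\<omega>\<in>space M. b s t \<omega> \<in> B}) * cells_prob g m A' B'"
    if g: "incseq g" "g 0 = t" for g m A' B'
  proof -
    define g' A'' B'' where "g' = case_nat s g" and "A'' = case_nat A A'" and "B'' = case_nat B B'"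
    have g': "incseq g'"
    proof (rule incseq_SucI)
      fix n show "g' n \<le> g' (Suc n)"
        using g assms(2) by (cases n) (auto simp: g'_def incseq_SucD)
    qed
    have "E \<inter> cell s t A B \<inter> cells g m A' B' = E \<inter> cells g' (Suc m) A'' B''"
      using g by (auto simp: cells_def cell_def g'_def A''_def B''_def less_Suc_eq_0_disj)
    then have "prob (E \<inter> cell s t A B \<inter> cells g m A' B') = prob E * cells_prob g' (Suc m) A'' B''"
      using past_cells[OF assms(1) g', of "Suc m"] by (simp add: g'_def)
    moreover have "cells_prob g' (Suc m) A'' B'' =
        prob {\<omega>\<in>space M. a s t \<omega> \<in> A} * prob {\<omega>\<in>space M. b s t \<omega> \<in> B} * cells_prob g m A' B'"
      unfolding cells_prob_def prod.lessThan_Suc_shift using g by (simp add: g'_def A''_def B''_def)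
    ultimately show ?thesis by simp
  qed
  \<comment> \<open>the empty family of later cells gives the probability of the new event itself\<close>
  have "incseq (\<lambda>n. t)" by (simp add: incseq_def)
  moreover have "E \<inter> cell s t A B \<inter> cells g 0 A' B' = E \<inter> cell s t A B" for g A' B'
    by (auto simp: cells_def cell_def)
  ultimately show **: "prob (E \<inter> cell s t A B) =
      prob E * (prob {\<omega>\<in>space M. a s t \<omega> \<in> A} * prob {\<omega>\<in>space M. b s t \<omega> \<in> B})"
    using *[of "\<lambda>n. t" 0] by (simp add: cells_prob_def)
  show "past t (E \<inter> cell s t A B)"
    unfolding past_def ** using * s assms(2) sets_cell[OF s(1) assms(2)] by auto
qed

lemma past_mono: "past s E \<Longrightarrow> s \<le> t \<Longrightarrow> past t E"
  using past_cell(1)[of s E t UNIV UNIV] sets.sets_into_space[OF past_events[of s E]]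
  by (simp add: cell_def Int_absorb2)

lemma past_space: "0 \<le> s \<Longrightarrow> past s (space M)"
  using past_mono[OF past_initial[of UNIV]] by simp

lemma past_empty: "0 \<le> s \<Longrightarrow> past s {}"
  by (simp add: past_def)

lemma past_Un:
  assumes "past s E" "past s F" "E \<inter> F = {}"
  shows "past s (E \<union> F)"
proof -
  have "prob ((E \<union> F) \<inter> cells g m A B) = prob (E \<union> F) * cells_prob g m A B"
    if g: "incseq g" "g 0 = s" for g m A B
  proof -
    have [simp]: "E \<in> events" "F \<in> events" "cells g m A B \<in> events"
      using assms g sets_cells[of g] by (auto simp: past_def)
    have "prob ((E \<union> F) \<inter> cells g m A B) = prob (E \<inter> cells g m A B) + prob (F \<inter> cells g m A B)"
      unfolding Int_Un_distrib2 using assms(3) by (intro finite_measure_Union) auto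
    then show ?thesis
      using assms g by (simp add: past_cells finite_measure_Union algebra_simps)
  qed
  then show ?thesis using assms by (auto simp: past_def)
qed

lemma prob_a: "0 \<le> s \<Longrightarrow> s \<le> t \<Longrightarrow> prob {\<omega>\<in>space M. a s t \<omega> \<in> A} = measure (poisson_law (\<beta> * (t - s))) A"
  by (simp flip: distr_a add: measure_distr measurable_a vimage_def Int_def conj_commute)

lemma prob_b: "0 \<le> s \<Longrightarrow> s \<le> t \<Longrightarrow> prob {\<omega>\<in>space M. b s t \<omega> \<in> A} = measure (poisson_law (t - s)) A"
  by (simp flip: distr_b add: measure_distr measurable_b vimage_def Int_def conj_commute)

text \<open>
  The step of the chain counts at most one arrival. This keeps its kernel \<^const>\<open>reset_step\<close> free
  of sums, at the price of an error of order \<open>(t - s)\<^sup>2\<close>.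
\<close>

definition cell_update :: "real \<Rightarrow> real \<Rightarrow> 'w \<Rightarrow> nat \<Rightarrow> nat" where
  "cell_update s t \<omega> k = (if b s t \<omega> \<noteq> 0 then 0 else if a s t \<omega> = 0 then k else Suc k)"

text \<open>
  The new state is determined by the old one and by one cell, so its level sets are disjoint unions of
  at most two events covered by \<open>past_cell\<close>.
\<close>

lemma past_cell_update:
  assumes E: "past s E" and st: "s \<le> t" and X: "\<And>k. past s (E \<inter> {\<omega>. X \<omega> = k})"
  shows "past t (E \<inter> {\<omega>. cell_update s t \<omega> (X \<omega>) = l})"
    and "prob (E \<inter> {\<omega>. cell_update s t \<omega> (X \<omega>) = l}) =
      reset_step (exp (- (t - s))) (exp (- (\<beta> * (t - s)))) (prob E) (\<lambda>k. prob (E \<inter> {\<omega>. X \<omega> = k})) l"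
proof -
  have s: "0 \<le> s" and ET: "E \<subseteq> space M"
    using E sets.sets_into_space[OF past_events[OF E]] by (auto simp: past_def)
  note simps = prob_a[OF s st] prob_b[OF s st] poisson_law_0 poisson_law_not_0 rate st less_imp_le
  let ?E = "\<lambda>k. E \<inter> {\<omega>. X \<omega> = k}"
  define F where "F k A B = ?E k \<inter> cell s t A B" for k A B
  have F: "past t (F k A B)" "prob (F k A B) = prob (?E k) *
      (prob {\<omega>\<in>space M. a s t \<omega> \<in> A} * prob {\<omega>\<in>space M. b s t \<omega> \<in> B})" for k A B
    unfolding F_def using past_cell[OF X st] by auto
  define R where "R = E \<inter> cell s t UNIV (- {0})"
  have R: "past t R" "prob R = prob E * (1 - exp (- (t - s)))"
    unfolding R_def using past_cell[OF E st, of UNIV "- {0}"] s st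
    unfolding prob_a[OF s st] prob_b[OF s st] by (simp_all add: simps)
  have *: "past t (E \<inter> {\<omega>. cell_update s t \<omega> (X \<omega>) = l}) \<and>
    prob (E \<inter> {\<omega>. cell_update s t \<omega> (X \<omega>) = l}) =
      reset_step (exp (- (t - s))) (exp (- (\<beta> * (t - s)))) (prob E) (\<lambda>k. prob (E \<inter> {\<omega>. X \<omega> = k})) l"
  proof (cases l)
    case 0
    have eq: "E \<inter> {\<omega>. cell_update s t \<omega> (X \<omega>) = l} = F 0 {0} {0} \<union> R"
      using ET 0 by (auto simp: F_def R_def cell_def cell_update_def)
    have disj: "F 0 {0} {0} \<inter> R = {}"
      by (auto simp: F_def R_def cell_def)
    show ?thesis
      unfolding eq using past_Un[OF F(1) R(1) disj]
      by (subst finite_measure_Union[OF past_events[OF F(1)] past_events[OF R(1)] disj],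
          unfold F(2) R(2) prob_a[OF s st] prob_b[OF s st])
         (simp_all add: 0 reset_step_def simps mult_ac)
  next
    case (Suc k)
    have eq: "E \<inter> {\<omega>. cell_update s t \<omega> (X \<omega>) = l} = F (Suc k) {0} {0} \<union> F k (- {0}) {0}"
      using ET Suc by (auto simp: F_def cell_def cell_update_def split: if_splits)
    have disj: "F (Suc k) {0} {0} \<inter> F k (- {0}) {0} = {}"
      by (auto simp: F_def cell_def)
    show ?thesis
      unfolding eq using past_Un[OF F(1) F(1) disj]
      by (subst finite_measure_Union[OF past_events[OF F(1)] past_events[OF F(1)] disj],
          unfold F(2) prob_a[OF s st] prob_b[OF s st])
         (simp_all add: Suc reset_step_def simps algebra_simps)
  qed
  from * show "past t (E \<inter> {\<omega>. cell_update s t \<omega> (X \<omega>) = l})" by blast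
  from * show "prob (E \<inter> {\<omega>. cell_update s t \<omega> (X \<omega>) = l}) =
      reset_step (exp (- (t - s))) (exp (- (\<beta> * (t - s)))) (prob E) (\<lambda>k. prob (E \<inter> {\<omega>. X \<omega> = k})) l"
    by blast
qed

text \<open>
  The chain starts from the true state at time \<open>s\<close> and is driven by the true cells of length \<open>h\<close>.
\<close>

primrec chain :: "real \<Rightarrow> real \<Rightarrow> nat \<Rightarrow> 'w \<Rightarrow> nat" where
  "chain s h 0 \<omega> = L s \<omega>"
| "chain s h (Suc i) \<omega> = cell_update (s + real i * h) (s + real (Suc i) * h) \<omega> (chain s h i \<omega>)"

lemma past_chain:
  assumes E: "past s E" "\<And>k. past s (E \<inter> {\<omega>. L s \<omega> = k})" and h: "0 \<le> h"
  shows "past (s + real i * h) (E \<inter> {\<omega>. chain s h i \<omega> = l}) \<and>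
    prob (E \<inter> {\<omega>. chain s h i \<omega> = l}) =
      (reset_step (exp (- h)) (exp (- (\<beta> * h))) (prob E) ^^ i) (\<lambda>k. prob (E \<inter> {\<omega>. L s \<omega> = k})) l"
proof (induction i arbitrary: l)
  case 0
  then show ?case using E by simp
next
  case (Suc i)
  have E': "past (s + real i * h) E" and le: "s + real i * h \<le> s + real (Suc i) * h"
    using E(1) h by (auto intro: past_mono mult_right_mono)
  have h': "s + real (Suc i) * h - (s + real i * h) = h" by (simp add: algebra_simps)
  show ?case
    using past_cell_update[OF E' le, of "chain s h i" l] Suc unfolding h'
    by simp
qed

text \<open>
  Outside these events, \<^const>\<open>cell_update\<close> describes the dynamics exactly.
\<close>

definition collision :: "real \<Rightarrow> real \<Rightarrow> 'w set" where
  "collision s t = {\<omega>\<in>space M. 2 \<le> a s t \<omega> \<or> a s t \<omega> \<noteq> 0 \<and> b s t \<omega> \<noteq> 0}"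

lemma collision_eq: "collision s t = cell s t {2..} UNIV \<union> cell s t (- {0}) (- {0})"
  by (auto simp: collision_def cell_def)

lemma prob_collision_le:
  assumes st: "0 \<le> s" "s \<le> t"
  shows "prob (collision s t) \<le> (\<beta>\<^sup>2 + \<beta>) * (t - s)\<^sup>2"
proof -
  have "prob (collision s t) \<le> prob (cell s t {2..} UNIV) + prob (cell s t (- {0}) (- {0}))"
    unfolding collision_eq by (intro measure_Un_le sets_cell st)
  also have "prob (cell s t {2..} UNIV) = prob {\<omega>\<in>space M. a s t \<omega> \<in> {2..}}"
    by (simp add: cell_def)
  also have "\<dots> \<le> (\<beta> * (t - s))\<^sup>2"
    unfolding prob_a[OF st] using rate st by (intro poisson_law_ge_2) simp
  also have "prob (cell s t (- {0}) (- {0})) =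
      (1 - exp (- (\<beta> * (t - s)))) * (1 - exp (- (t - s)))"
    using past_cell(2)[OF past_space[OF st(1)] st(2), of "- {0}" "- {0}"] st rate
    unfolding prob_a[OF st] prob_b[OF st] by (simp add: poisson_law_not_0 prob_space Int_absorb1 cell_def)
  also have "\<dots> \<le> (\<beta> * (t - s)) * (t - s)"
  proof -
    have "1 - exp (- x) \<le> x" for x :: real
      using exp_ge_add_one_self[of "- x"] by linarith
    from this[of "t - s"] this[of "\<beta> * (t - s)"] show ?thesis
      using st rate by (intro mult_mono) auto
  qed
  finally show ?thesis
    by (simp add: power2_eq_square algebra_simps)
qed

lemma chain_eq_L:
  assumes "\<forall>s t. 0 \<le> s \<and> s \<le> t \<longrightarrow>
      (b s t \<omega> = 0 \<longrightarrow> L t \<omega> = L s \<omega> + a s t \<omega>) \<and>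
      (b s t \<omega> \<noteq> 0 \<and> a s t \<omega> = 0 \<longrightarrow> L t \<omega> = 0)"
    and "0 \<le> s" "0 \<le> h" "\<omega> \<in> space M"
    and "\<forall>i<n. \<omega> \<notin> collision (s + real i * h) (s + real (Suc i) * h)"
  shows "chain s h n \<omega> = L (s + real n * h) \<omega>"
  using assms(5)
proof (induction n)
  case 0
  then show ?case by simp
next
  case (Suc n)
  let ?s = "s + real n * h" and ?t = "s + real (Suc n) * h"
  have st: "0 \<le> ?s" "?s \<le> ?t"
    using assms by (auto intro: mult_right_mono)
  have *: "b ?s ?t \<omega> = 0 \<longrightarrow> L ?t \<omega> = L ?s \<omega> + a ?s ?t \<omega>"
    "b ?s ?t \<omega> \<noteq> 0 \<and> a ?s ?t \<omega> = 0 \<longrightarrow> L ?t \<omega> = 0"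
    using assms(1) st by blast+
  have "\<omega> \<notin> collision ?s ?t" using Suc.prems by blast
  then have c: "a ?s ?t \<omega> < 2" "a ?s ?t \<omega> = 0 \<or> b ?s ?t \<omega> = 0"
    using assms(4) by (auto simp: collision_def)
  have "chain s h (Suc n) \<omega> = cell_update ?s ?t \<omega> (L ?s \<omega>)"
    using Suc by simp
  also have "\<dots> = L ?t \<omega>"
    unfolding cell_update_def using * c by (cases "a ?s ?t \<omega> = 0") auto
  finally show ?case .
qed

lemma prob_approx:
  assumes EF: "E \<in> events" "F \<in> events" "C \<in> events" "prob C \<le> \<epsilon>"
    and "AE \<omega> in M. \<omega> \<notin> C \<longrightarrow> (\<omega> \<in> E \<longleftrightarrow> \<omega> \<in> F)"
  shows "\<bar>prob E - prob F\<bar> \<le> \<epsilon>"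
proof -
  have "prob E \<le> prob (F \<union> C)" "prob F \<le> prob (E \<union> C)"
    using assms by (auto intro!: finite_measure_mono_AE elim!: eventually_mono)
  moreover have "prob (F \<union> C) \<le> prob F + prob C" "prob (E \<union> C) \<le> prob E + prob C"
    using assms by (auto intro!: measure_Un_le)
  ultimately show ?thesis using assms(4) by linarith
qed

text \<open>
  The two events can only differ when one of the \<open>m\<close> cells has a collision, and the probabilities of
  these sum up to \<open>m\<close> times a multiple of \<open>((t - s) / m)\<^sup>2\<close>.
\<close>

lemma chain_approximates:
  assumes E: "past s E" "\<And>k. past s (E \<inter> {\<omega>. L s \<omega> = k})" and st: "s \<le> t" and m: "0 < m"
    and G: "G \<in> events"
  shows "\<bar>prob (E \<inter> {\<omega>. chain s ((t - s) / real m) m \<omega> = l} \<inter> G) - prob (E \<inter> {\<omega>. L t \<omega> = l} \<inter> G)\<bar>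
    \<le> (\<beta>\<^sup>2 + \<beta>) * (t - s)\<^sup>2 / real m"
proof (rule prob_approx)
  define h where "h = (t - s) / real m"
  have s: "0 \<le> s" and h: "0 \<le> h" and t: "s + real m * h = t"
    using E(1) st m by (auto simp: past_def h_def)
  have ET: "E \<in> events" "E \<subseteq> space M"
    using past_events[OF E(1)] sets.sets_into_space by blast+
  have cell: "0 \<le> s + real i * h" "s + real i * h \<le> s + real (Suc i) * h" for i
    using s h by (auto intro: mult_right_mono)
  have sc: "collision (s + real i * h) (s + real (Suc i) * h) \<in> events" for i
    unfolding collision_eq by (intro sets.Un sets_cell cell)
  let ?C = "\<Union>i<m. collision (s + real i * h) (s + real (Suc i) * h)"
  show "E \<inter> {\<omega>. chain s ((t - s) / real m) m \<omega> = l} \<inter> G \<in> events"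
    using past_events[OF past_chain[OF E h, THEN conjunct1]] G unfolding h_def by (rule sets.Int)
  have "E \<inter> {\<omega>. L t \<omega> = l} = E \<inter> {\<omega>\<in>space M. L t \<omega> = l}"
    using ET(2) by auto
  also have "\<dots> \<in> events"
    using ET s st by (intro sets.Int sets_L) auto
  finally show "E \<inter> {\<omega>. L t \<omega> = l} \<inter> G \<in> events"
    using G by (rule sets.Int)
  show "?C \<in> events"
    using sc by auto
  have "prob ?C \<le> (\<Sum>i<m. prob (collision (s + real i * h) (s + real (Suc i) * h)))"
    using sc by (intro finite_measure_subadditive_finite) auto
  also have "\<dots> \<le> (\<Sum>i<m. (\<beta>\<^sup>2 + \<beta>) * (s + real (Suc i) * h - (s + real i * h))\<^sup>2)"
    by (intro sum_mono prob_collision_le cell)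
  also have "\<dots> = (\<beta>\<^sup>2 + \<beta>) * (t - s)\<^sup>2 / real m"
  proof -
    have "s + real (Suc i) * h - (s + real i * h) = h" for i
      by (simp add: algebra_simps)
    moreover have "real m * h\<^sup>2 = (t - s)\<^sup>2 / real m"
      using m by (simp add: h_def power2_eq_square)
    ultimately show ?thesis by (simp add: mult.left_commute[of "real m"])
  qed
  finally show "prob ?C \<le> (\<beta>\<^sup>2 + \<beta>) * (t - s)\<^sup>2 / real m" .
  show "AE \<omega> in M. \<omega> \<notin> ?C \<longrightarrow> (\<omega> \<in> E \<inter> {\<omega>. chain s ((t - s) / real m) m \<omega> = l} \<inter> G \<longleftrightarrow>
      \<omega> \<in> E \<inter> {\<omega>. L t \<omega> = l} \<inter> G)"
    using dynamics AE_space
  proof eventually_elim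
    case (elim \<omega>)
    then show ?case
      using chain_eq_L[OF elim(1) s h elim(2), of m] unfolding t h_def[symmetric] by auto
  qed
qed

text \<open>
  By \<open>past_chain\<close> the chain with \<open>m\<close> cells is Markov with kernel \<^const>\<open>reset_step\<close>, and both facts
  pass to the limit: the approximation is uniform in the event \<open>G\<close>, which may be a future cell event.
\<close>

lemma past_evolution:
  assumes E: "past s E" "\<And>k. past s (E \<inter> {\<omega>. L s \<omega> = k})" and st: "s \<le> t"
  shows "past t (E \<inter> {\<omega>. L t \<omega> = l})"
    and "(\<lambda>m. (reset_step (exp (- ((t - s) / real m))) (exp (- (\<beta> * ((t - s) / real m)))) (prob E) ^^ m)
            (\<lambda>k. prob (E \<inter> {\<omega>. L s \<omega> = k})) l) \<longlonglongrightarrow> prob (E \<inter> {\<omega>. L t \<omega> = l})"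
proof -
  let ?C = "\<lambda>m. E \<inter> {\<omega>. chain s ((t - s) / real m) m \<omega> = l}"
  let ?D = "E \<inter> {\<omega>. L t \<omega> = l}"
  have ET: "E \<in> events" "E \<subseteq> space M" "0 \<le> s"
    using past_events[OF E(1)] sets.sets_into_space E(1) by (auto simp: past_def)
  have lim: "(\<lambda>m. prob (?C m \<inter> G))
      \<longlonglongrightarrow> prob (?D \<inter> G)" if G: "G \<in> events" for G
  proof (rule LIM_zero_cancel, rule tendsto_0_le)
    show "(\<lambda>m. (\<beta>\<^sup>2 + \<beta>) * (t - s)\<^sup>2 / real m) \<longlonglongrightarrow> 0"
      by real_asymp
    show "\<forall>\<^sub>F m in sequentially. norm (prob (?C m \<inter> G) -
        prob (?D \<inter> G)) \<le> norm ((\<beta>\<^sup>2 + \<beta>) * (t - s)\<^sup>2 / real m) * 1"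
      using eventually_gt_at_top[of 0]
    proof eventually_elim
      case (elim m)
      have "(\<beta>\<^sup>2 + \<beta>) * (t - s)\<^sup>2 / real m \<ge> 0" using rate by simp
      then show ?case
        using chain_approximates[OF E st elim G, of l] by (simp only: real_norm_def abs_of_nonneg mult_1_right)
    qed
  qed
  have lim1: "(\<lambda>m. prob (?C m))
      \<longlonglongrightarrow> prob (?D)"
  proof -
    have "E \<inter> X \<inter> space M = E \<inter> X" for X using ET by auto
    then show ?thesis using lim[OF sets.top] by simp
  qed
  have chain: "past t (?C m)"
    "prob (?C m) =
      (reset_step (exp (- ((t - s) / real m))) (exp (- (\<beta> * ((t - s) / real m)))) (prob E) ^^ m)
            (\<lambda>k. prob (E \<inter> {\<omega>. L s \<omega> = k})) l" if "0 < m" for m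
    using past_chain[OF E, of "(t - s) / real m" m l] that st by auto
  show "(\<lambda>m. (reset_step (exp (- ((t - s) / real m))) (exp (- (\<beta> * ((t - s) / real m)))) (prob E) ^^ m)
            (\<lambda>k. prob (E \<inter> {\<omega>. L s \<omega> = k})) l) \<longlonglongrightarrow> prob (?D)"
    by (rule Lim_transform_eventually[OF lim1])
       (use chain(2) in \<open>auto intro: eventually_mono[OF eventually_gt_at_top[of 0]]\<close>)
  have "?D = E \<inter> {\<omega>\<in>space M. L t \<omega> = l}"
    using ET(2) by auto
  also have "\<dots> \<in> events"
    using ET st by (intro sets.Int sets_L) auto
  finally have ev: "?D \<in> events" .
  have "prob (?D \<inter> cells g n A B) = prob (?D) * cells_prob g n A B"
    if g: "incseq g" "g 0 = t" for g n A B
  proof (rule LIMSEQ_unique)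
    show "(\<lambda>m. prob (?C m \<inter> cells g n A B))
      \<longlonglongrightarrow> prob (?D \<inter> cells g n A B)"
      using ET st g by (intro lim sets_cells) auto
    show "(\<lambda>m. prob (?C m \<inter> cells g n A B))
      \<longlonglongrightarrow> prob (?D) * cells_prob g n A B"
      by (rule Lim_transform_eventually[OF tendsto_mult_right[OF lim1]])
         (auto simp: past_cells[OF chain(1) g] intro: eventually_mono[OF eventually_gt_at_top[of 0]])
  qed
  then show "past t (?D)"
    using ET st ev by (simp add: past_def)
qed

text \<open>
  The finite-dimensional events of the process observed from time \<open>T\<close> on.
\<close>

definition trajectory :: "real \<Rightarrow> real set \<Rightarrow> (real \<Rightarrow> nat) \<Rightarrow> 'w set" where
  "trajectory T J f = {\<omega>\<in>space M. \<forall>i\<in>J. L (i + T) \<omega> = f i}"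

text \<open>
  By induction on the times, adding the largest one last: the event \<open>E\<close> for the step from \<open>b\<close> to \<open>s\<close>
  fixes the state at time \<open>b\<close>, so that \<open>E \<inter> {L = k}\<close> is \<open>E\<close> or empty.
\<close>

lemma past_trajectory:
  assumes "finite J" "0 \<le> T" "J \<subseteq> {0..s}" "0 \<le> s"
  shows "past (s + T) (trajectory T J f)" "past (s + T) (trajectory T J f \<inter> {\<omega>. L (s + T) \<omega> = k})"
proof -
  have "past (s + T) (trajectory T J f) \<and> (\<forall>k. past (s + T) (trajectory T J f \<inter> {\<omega>. L (s + T) \<omega> = k}))"
    using assms(1,3,4)
  proof (induction J arbitrary: s rule: finite_linorder_max_induct)
    case empty
    have "past 0 (space M \<inter> {\<omega>. L 0 \<omega> = k})" for k
      using past_initial[of "{k}"] by (simp add: Int_def)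
    from past_evolution(1)[OF past_space this, of "s + T"] show ?case
      using assms(2) empty by (simp add: trajectory_def past_space)
  next
    case (insert b J)
    have b: "0 \<le> b" "b \<le> s" "J \<subseteq> {0..b}"
      using insert.prems insert.hyps by (auto simp: subset_iff less_imp_le)
    have eq: "trajectory T (insert b J) f = trajectory T J f \<inter> {\<omega>. L (b + T) \<omega> = f b}"
      by (auto simp: trajectory_def)
    have 1: "past (b + T) (trajectory T (insert b J) f)"
      unfolding eq using insert.IH b by blast
    have "trajectory T (insert b J) f \<inter> {\<omega>. L (b + T) \<omega> = k} = (if k = f b then trajectory T (insert b J) f else {})" for k
      by (auto simp: eq)
    then have 2: "past (b + T) (trajectory T (insert b J) f \<inter> {\<omega>. L (b + T) \<omega> = k})" for k
      using 1 past_empty[of "b + T"] b assms(2) by simp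
    show ?case
      using past_evolution(1)[OF 1 2] past_mono[OF 1] b by auto
  qed
  then show "past (s + T) (trajectory T J f)" "past (s + T) (trajectory T J f \<inter> {\<omega>. L (s + T) \<omega> = k})"
    by blast+
qed

text \<open>
  The limit in \<open>past_evolution\<close> involves only the length \<open>s - b\<close> of the step and the probabilities at
  its start. Hence the same induction shows that equal one-dimensional laws give equal finite-dimensional
  ones.
\<close>

lemma trajectory_shift_invariant:
  assumes "finite J" "0 \<le> T" "J \<subseteq> {0..s}" "0 \<le> s"
    and stationary: "\<And>s k. 0 \<le> s \<Longrightarrow> prob {\<omega>\<in>space M. L (s + T) \<omega> = k} = prob {\<omega>\<in>space M. L s \<omega> = k}"
  shows "prob (trajectory T J f) = prob (trajectory 0 J f)"
proof -
  have "prob (trajectory T J f) = prob (trajectory 0 J f) \<and>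
     (\<forall>k. prob (trajectory T J f \<inter> {\<omega>. L (s + T) \<omega> = k}) = prob (trajectory 0 J f \<inter> {\<omega>. L s \<omega> = k}))"
    using assms(1,3,4)
  proof (induction J arbitrary: s rule: finite_linorder_max_induct)
    case empty
    then show ?case using stationary by (simp add: trajectory_def Int_def)
  next
    case (insert b J)
    have b: "0 \<le> b" "b \<le> s" "J \<subseteq> {0..b}"
      using insert.prems insert.hyps by (auto simp: subset_iff less_imp_le)
    have eq: "trajectory T (insert b J) f = trajectory T J f \<inter> {\<omega>. L (b + T) \<omega> = f b}" for T
      by (auto simp: trajectory_def)
    have 1: "prob (trajectory T (insert b J) f) = prob (trajectory 0 (insert b J) f)"
      unfolding eq using insert.IH[OF b(3,1)] by simp
    have same: "trajectory T (insert b J) f \<inter> {\<omega>. L (b + T) \<omega> = k} = (if k = f b then trajectory T (insert b J) f else {})" for k T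
      by (auto simp: eq)
    have 2: "prob (trajectory T (insert b J) f \<inter> {\<omega>. L (b + T) \<omega> = k}) =
        prob (trajectory 0 (insert b J) f \<inter> {\<omega>. L (b + 0) \<omega> = k})" for k
      unfolding same using 1 by simp
    have sub: "insert b J \<subseteq> {0..b}" using b by auto
    have fin: "finite (insert b J)" using insert.hyps by simp
    have lim: "(\<lambda>m. (reset_step (exp (- ((s - b) / real m))) (exp (- (\<beta> * ((s - b) / real m))))
          (prob (trajectory T' (insert b J) f)) ^^ m)
            (\<lambda>k. prob (trajectory T' (insert b J) f \<inter> {\<omega>. L (b + T') \<omega> = k})) k)
        \<longlonglongrightarrow> prob (trajectory T' (insert b J) f \<inter> {\<omega>. L (s + T') \<omega> = k})" if "0 \<le> T'" for T' k
      using past_evolution(2)[OF past_trajectory[OF fin that sub b(1), of f], of "s + T'" k] b by simp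
    show ?case
      using 1 LIMSEQ_unique[OF lim[OF assms(2)] lim[OF order_refl, unfolded 1[symmetric] 2[symmetric]]]
      by simp
  qed
  then show ?thesis by blast
qed

theorem distance_to_geometric:
  assumes "0 < t"
    and "\<And>l. \<bar>prob {\<omega>\<in>space M. L 0 \<omega> = l} - geometric_mass (\<beta> / (1 + \<beta>)) l\<bar> \<le> K"
  shows "\<bar>prob {\<omega>\<in>space M. L t \<omega> = l} - geometric_mass (\<beta> / (1 + \<beta>)) l\<bar> \<le> exp (- t) * K"
proof -
  have "past 0 (space M \<inter> {\<omega>. L 0 \<omega> = k})" for k
    using past_initial[of "{k}"] by (simp add: Int_def)
  from past_evolution(2)[OF past_space this, of t l] assms(1)
  have "(\<lambda>m. (reset_step (exp (- (t / real m))) (exp (- (\<beta> * (t / real m)))) 1 ^^ m)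
       (\<lambda>k. prob {\<omega>\<in>space M. L 0 \<omega> = k}) l) \<longlonglongrightarrow> prob {\<omega>\<in>space M. L t \<omega> = l}"
    by (simp add: prob_space Int_def)
  from reset_chain_limit_bound[OF rate assms(1) assms(2) this] show ?thesis .
qed

end

section \<open>From the stochastic equation to cells\<close>

lemma random_algorithm_arrivals:
  "arrivals random_algorithm \<beta> p S x t = S \<inter> ({0<..t} \<times> {0..\<beta>})"
  by (auto simp: arrivals_def random_algorithm_def)

lemma left_limit_eqI:
  fixes x :: "real \<Rightarrow> 'a::t2_space"
  assumes "r < s" "\<And>q. r < q \<Longrightarrow> q < s \<Longrightarrow> x q = c"
  shows "left_limit x s = c"
  unfolding left_limit_def
proof (rule tendsto_Lim)
  have "eventually (\<lambda>q. x q = c) (at_left s)"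
    using assms by (auto simp: eventually_at_left_field)
  then show "(x \<longlongrightarrow> c) (at_left s)"
    by (rule tendsto_eventually)
qed simp

text \<open>
  Let \<open>r\<close> be the last reset of a cell without arrivals and \<open>q\<close> the one before it (or the start of the
  cell). On \<open>(q, r)\<close> the path is constant, with value \<open>x (r-)\<close>, and the equation between such a time and \<open>r\<close>
  reads \<open>x r = x (r-) - x (r-)\<close>. After \<open>r\<close> nothing happens.
\<close>

lemma reset_equation_dynamics:
  fixes x :: "real \<Rightarrow> nat" and S :: "(real \<times> real) set" and R :: "real set"
  assumes eq: "\<And>t. 0 \<le> t \<Longrightarrow> finite (S \<inter> ({0<..t} \<times> {0..\<beta>})) \<and> finite (R \<inter> {0<..t}) \<and>
      int (x t) = int (x 0) + int (card (S \<inter> ({0<..t} \<times> {0..\<beta>}))) -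
        (\<Sum>s\<in>R \<inter> {0<..t}. int (left_limit x s))"
    and st: "0 \<le> s" "s \<le> t"
  shows "card (R \<inter> {s<..t}) = 0 \<Longrightarrow> x t = x s + card (S \<inter> ({s<..t} \<times> {0..\<beta>}))"
    and "card (R \<inter> {s<..t}) \<noteq> 0 \<Longrightarrow> card (S \<inter> ({s<..t} \<times> {0..\<beta>})) = 0 \<Longrightarrow> x t = 0"
proof -
  let ?A = "\<lambda>s t. S \<inter> ({s<..t} \<times> {0..\<beta>})" and ?R = "\<lambda>s t. R \<inter> {s<..t}"
  have finA: "finite (?A s t)" and finR: "finite (?R s t)" if "0 \<le> s" "s \<le> t" for s t
    using eq[of t] that by (auto elim!: rev_finite_subset)
  have step: "int (x t) = int (x s) + int (card (?A s t)) - (\<Sum>r\<in>?R s t. int (left_limit x r))"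
    if st: "0 \<le> s" "s \<le> t" for s t
  proof -
    have A: "?A 0 t = ?A 0 s \<union> ?A s t" "?A 0 s \<inter> ?A s t = {}"
      and R: "?R 0 t = ?R 0 s \<union> ?R s t" "?R 0 s \<inter> ?R s t = {}"
      using st by auto
    have "card (?A 0 t) = card (?A 0 s) + card (?A s t)"
      unfolding A(1) using st by (intro card_Un_disjoint finA A(2)) auto
    moreover have "(\<Sum>r\<in>?R 0 t. int (left_limit x r)) =
        (\<Sum>r\<in>?R 0 s. int (left_limit x r)) + (\<Sum>r\<in>?R s t. int (left_limit x r))"
      unfolding R(1) using st by (intro sum.union_disjoint finR R(2)) auto
    ultimately show ?thesis
      using eq[of s] eq[of t] st by simp
  qed
  show "x t = x s + card (?A s t)" if "card (?R s t) = 0"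
  proof -
    have "?R s t = {}" using that finR[OF st] by simp
    then show ?thesis using step[OF st] by simp
  qed
  show "x t = 0" if "card (?R s t) \<noteq> 0" "card (?A s t) = 0"
  proof -
    have A: "?A s t = {}" using that(2) finA[OF st] by simp
    have ne: "?R s t \<noteq> {}" using that by auto
    define r where "r = Max (?R s t)"
    have r: "r \<in> ?R s t" "\<And>q. q \<in> ?R s t \<Longrightarrow> q \<le> r"
      using Max_in[OF finR[OF st] ne] Max_ge[OF finR[OF st]] by (auto simp: r_def)
    \<comment> \<open>q is the reset preceding r, or the start of the cell; the path is constant between q and r\<close>
    define q where "q = Max (insert s (?R s t \<inter> {..<r}))"
    have fin: "finite (insert s (?R s t \<inter> {..<r}))" using finR[OF st] by simp
    have q: "s \<le> q" "q < r" and gap: "R \<inter> {q<..<r} = {}"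
    proof -
      have "q \<in> insert s (?R s t \<inter> {..<r})"
        unfolding q_def by (rule Max_in[OF fin]) simp
      then show "s \<le> q" "q < r" using r(1) by auto
      have "y \<notin> R" if "q < y" "y < r" for y
      proof
        assume "y \<in> R"
        then have "y \<in> insert s (?R s t \<inter> {..<r})" using that \<open>s \<le> q\<close> r(1) by auto
        then have "y \<le> q" unfolding q_def using fin by (intro Max_ge)
        then show False using that by simp
      qed
      then show "R \<inter> {q<..<r} = {}" by auto
    qed
    have "int (x y) = int (x r) + int (left_limit x r)" if y: "q < y" "y < r" for y
    proof -
      have "?A y r = {}" using A y q r(1) by (auto simp: set_eq_iff)
      moreover have "?R y r = {r}" using gap y r(1) by force
      ultimately show ?thesis using step[of y r] y q st by simp
    qed
    then have "left_limit x r = x r + left_limit x r"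
      using q(2) by (intro left_limit_eqI) (simp_all only: of_nat_eq_iff flip: of_nat_add)
    then have "x r = 0" by simp
    moreover have "?A r t = {}" using A r(1) by (auto simp: set_eq_iff)
    moreover have "?R r t = {}" using r by force
    ultimately show ?thesis using step[of r t] r(1) st by simp
  qed
qed

lemma closed_quadrant: "{0..} \<times> {0..} \<in> sets (borel :: (real \<times> real) measure)"
  by (intro borel_closed closed_Times) auto

lemma sets_quarter_plane: "A \<in> sets quarter_plane \<longleftrightarrow> A \<in> sets borel \<and> A \<subseteq> {0..} \<times> {0..}"
  unfolding quarter_plane_def using closed_quadrant by (subst sets_restrict_space_iff) (simp_all add: conj_commute)

lemma sets_half_line: "A \<in> sets half_line \<longleftrightarrow> A \<in> sets borel \<and> A \<subseteq> {0..}"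
  unfolding half_line_def by (subst sets_restrict_space_iff) (simp_all add: conj_commute)

lemma space_quarter_plane: "space quarter_plane = {0..} \<times> {0..}"
  by (simp add: quarter_plane_def space_restrict_space)

lemma space_half_line: "space half_line = {0..}"
  by (simp add: half_line_def space_restrict_space)

lemma emeasure_quarter_plane: "A \<in> sets quarter_plane \<Longrightarrow> emeasure quarter_plane A = emeasure lborel A"
  unfolding sets_quarter_plane unfolding quarter_plane_def
  using closed_quadrant by (intro emeasure_restrict_space) simp_all

lemma emeasure_half_line: "A \<in> sets half_line \<Longrightarrow> emeasure half_line A = emeasure lborel A"
  unfolding sets_half_line unfolding half_line_def by (intro emeasure_restrict_space) simp_all

lemma arrival_cell:
  assumes "0 \<le> s" "s \<le> t" "0 \<le> \<beta>"
  shows "{s<..t} \<times> {0..\<beta>} \<in> sets quarter_plane"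
    and "emeasure quarter_plane ({s<..t} \<times> {0..\<beta>}) = ennreal (\<beta> * (t - s))"
proof -
  have b: "{s<..t} \<times> {0..\<beta>} \<in> sets (borel \<Otimes>\<^sub>M borel)"
    by (intro pair_measureI) auto
  then show *: "{s<..t} \<times> {0..\<beta>} \<in> sets quarter_plane"
    using assms unfolding borel_prod by (auto simp: sets_quarter_plane)
  have "emeasure (lborel \<Otimes>\<^sub>M lborel) ({s<..t} \<times> {0..\<beta>}) = ennreal (\<beta> * (t - s))"
    using assms by (subst lborel.emeasure_pair_measure_Times) (auto simp: ennreal_mult mult.commute)
  then show "emeasure quarter_plane ({s<..t} \<times> {0..\<beta>}) = ennreal (\<beta> * (t - s))"
    by (simp add: emeasure_quarter_plane[OF *] lborel_prod)
qed

lemma reset_cell: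
  assumes "0 \<le> s" "s \<le> t"
  shows "{s<..t} \<in> sets half_line" "emeasure half_line {s<..t} = ennreal (t - s)"
proof -
  show *: "{s<..t} \<in> sets half_line" using assms by (auto simp: sets_half_line)
  show "emeasure half_line {s<..t} = ennreal (t - s)"
    using assms by (simp add: emeasure_half_line[OF *])
qed

lemma (in prob_space) poisson_count:
  assumes "poisson_point_process M \<mu> Z" "A \<in> sets \<mu>" "emeasure \<mu> A = ennreal r" "0 \<le> r"
  shows "(\<lambda>\<omega>. card (Z \<omega> \<inter> A)) \<in> measurable M (count_space UNIV)"
    and "distr M (count_space UNIV) (\<lambda>\<omega>. card (Z \<omega> \<inter> A)) = measure_pmf (poisson_law r)"
proof -
  have "emeasure \<mu> A < \<infinity>" "measure \<mu> A = r" using assms by (simp_all add: measure_def)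
  then show "(\<lambda>\<omega>. card (Z \<omega> \<inter> A)) \<in> measurable M (count_space UNIV)"
    "distr M (count_space UNIV) (\<lambda>\<omega>. card (Z \<omega> \<inter> A)) = measure_pmf (poisson_law r)"
    using assms(1)[unfolded poisson_point_process_def, THEN conjunct2, THEN conjunct2, THEN conjunct1]
      assms(2) by simp_all
qed

lemma (in prob_space) poisson_cells_independent:
  fixes A :: "nat \<Rightarrow> 'e set"
  assumes Z: "poisson_point_process M \<mu> Z"
    and A: "\<And>i. i < m \<Longrightarrow> A i \<in> sets \<mu> \<and> emeasure \<mu> (A i) < \<infinity>" "disjoint_family_on A {..<m}"
  shows "prob {\<omega>\<in>space M. \<forall>i<m. card (Z \<omega> \<inter> A i) \<in> B i} =
      (\<Prod>i<m. prob {\<omega>\<in>space M. card (Z \<omega> \<inter> A i) \<in> B i})"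
    and "{\<omega>\<in>space M. \<forall>i<m. card (Z \<omega> \<inter> A i) \<in> B i} \<in> point_process_events M \<mu> Z"
proof -
  have "indep_vars (\<lambda>_. count_space UNIV) (\<lambda>i \<omega>. card (Z \<omega> \<inter> A i)) {..<m}"
    using Z[unfolded poisson_point_process_def, THEN conjunct2, THEN conjunct2, THEN conjunct2,
        THEN spec[of _ A], THEN spec[of _ m]] A
    by simp
  then show "prob {\<omega>\<in>space M. \<forall>i<m. card (Z \<omega> \<inter> A i) \<in> B i} =
      (\<Prod>i<m. prob {\<omega>\<in>space M. card (Z \<omega> \<inter> A i) \<in> B i})"
  proof (cases "m = 0")
    case False
    assume ind: "indep_vars (\<lambda>_. count_space UNIV) (\<lambda>i \<omega>. card (Z \<omega> \<inter> A i)) {..<m}"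
    have ne: "{..<m} \<noteq> {}" using False by auto
    from indep_varsD[OF ind ne _ order_refl, of B]
    have "prob (\<Inter>i<m. (\<lambda>\<omega>. card (Z \<omega> \<inter> A i)) -` B i \<inter> space M) =
        (\<Prod>i<m. prob ((\<lambda>\<omega>. card (Z \<omega> \<inter> A i)) -` B i \<inter> space M))"
      by simp
    also have "(\<Inter>i<m. (\<lambda>\<omega>. card (Z \<omega> \<inter> A i)) -` B i \<inter> space M) =
        {\<omega>\<in>space M. \<forall>i<m. card (Z \<omega> \<inter> A i) \<in> B i}"
      using False by auto
    finally show ?thesis by (simp add: vimage_def Int_def conj_commute)
  qed (simp add: prob_space)
  define N where "N = sigma (space M)
    {(\<lambda>\<omega>. card (Z \<omega> \<inter> A)) -` {k} \<inter> space M | A k. A \<in> sets \<mu> \<and> emeasure \<mu> A < \<infinity>}"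
  have N: "space N = space M" "sets N = point_process_events M \<mu> Z"
    unfolding N_def point_process_events_def by (subst space_measure_of sets_measure_of, blast, rule refl)+
  have [measurable]: "(\<lambda>\<omega>. card (Z \<omega> \<inter> A i)) \<in> measurable N (count_space UNIV)" if "i < m" for i
  proof (subst measurable_count_space_eq2_countable, intro conjI ballI)
    fix k
    have "(\<lambda>\<omega>. card (Z \<omega> \<inter> A i)) -` {k} \<inter> space M \<in> sets N"
      unfolding N point_process_events_def using A(1)[OF that] by (intro sigma_sets.Basic) blast
    then show "(\<lambda>\<omega>. card (Z \<omega> \<inter> A i)) -` {k} \<inter> space N \<in> sets N" by (simp add: N)
  qed auto
  have "{\<omega>\<in>space N. \<forall>i\<in>{..<m}. card (Z \<omega> \<inter> A i) \<in> B i} \<in> sets N"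
  proof (rule sets.sets_Collect_finite_All)
    fix i assume "i \<in> {..<m}"
    then show "{\<omega>\<in>space N. card (Z \<omega> \<inter> A i) \<in> B i} \<in> sets N"
      by (intro measurable_sets_Collect[of _ N "count_space UNIV"]) auto
  qed simp
  then show "{\<omega>\<in>space M. \<forall>i<m. card (Z \<omega> \<inter> A i) \<in> B i} \<in> point_process_events M \<mu> Z"
    by (simp add: N Ball_def)
qed

text \<open>
  As the functional is constant, almost every path satisfies the hypotheses of \<open>reset_equation_dynamics\<close>,
  whatever the flow of laws is.
\<close>

lemma mckean_vlasov_dynamics:
  assumes "mckean_vlasov_process random_algorithm \<beta> M Pbar P L"
  shows "AE \<omega> in M. \<forall>s t. 0 \<le> s \<and> s \<le> t \<longrightarrow>
      (card (P \<omega> \<inter> {s<..t}) = 0 \<longrightarrow> L t \<omega> = L s \<omega> + card (Pbar \<omega> \<inter> ({s<..t} \<times> {0..\<beta>}))) \<and>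
      (card (P \<omega> \<inter> {s<..t}) \<noteq> 0 \<and> card (Pbar \<omega> \<inter> ({s<..t} \<times> {0..\<beta>})) = 0 \<longrightarrow> L t \<omega> = 0)"
proof -
  obtain p where "AE \<omega> in M.
       cadlag (\<lambda>t. L t \<omega>) \<and>
       (\<forall>t\<ge>0.
          finite (arrivals random_algorithm \<beta> p (Pbar \<omega>) (\<lambda>s. L s \<omega>) t) \<and>
          finite (P \<omega> \<inter> {0<..t}) \<and>
          int (L t \<omega>) =
            int (L 0 \<omega>)
            + int (card (arrivals random_algorithm \<beta> p (Pbar \<omega>) (\<lambda>s. L s \<omega>) t))
            - (\<Sum>s\<in>P \<omega> \<inter> {0<..t}. int (left_limit (\<lambda>r. L r \<omega>) s)))"
    (is "AE \<omega> in M. ?sde \<omega>")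
    using assms unfolding mckean_vlasov_process_def by (elim conjE exE) (rule that)
  then show ?thesis
  proof (rule AE_mp, intro AE_I2 impI)
    fix \<omega>
    assume *: "?sde \<omega>"
    note dyn = reset_equation_dynamics[where x = "\<lambda>t. L t \<omega>" and S = "Pbar \<omega>" and R = "P \<omega>"
        and \<beta> = \<beta>, OF *[THEN conjunct2, rule_format, unfolded random_algorithm_arrivals]]
    show "\<forall>s t. 0 \<le> s \<and> s \<le> t \<longrightarrow>
      (card (P \<omega> \<inter> {s<..t}) = 0 \<longrightarrow> L t \<omega> = L s \<omega> + card (Pbar \<omega> \<inter> ({s<..t} \<times> {0..\<beta>}))) \<and>
      (card (P \<omega> \<inter> {s<..t}) \<noteq> 0 \<and> card (Pbar \<omega> \<inter> ({s<..t} \<times> {0..\<beta>})) = 0 \<longrightarrow> L t \<omega> = 0)"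
      by (intro allI impI conjI; elim conjE) (rule dyn; assumption)+
  qed
qed

lemma mckean_vlasov_reset_process:
  assumes "mckean_vlasov_process random_algorithm \<beta> M Pbar P L" "0 < \<beta>"
  shows "reset_process M \<beta> (\<lambda>s t \<omega>. card (Pbar \<omega> \<inter> ({s<..t} \<times> {0..\<beta>})))
      (\<lambda>s t \<omega>. card (P \<omega> \<inter> {s<..t})) L"
proof -
  note defs = assms(1)[unfolded mckean_vlasov_process_def]
  interpret prob_space M by (rule defs[THEN conjunct1])
  note Pbar = defs[THEN conjunct2, THEN conjunct1]
    and P = defs[THEN conjunct2, THEN conjunct2, THEN conjunct1]
    and PP = defs[THEN conjunct2, THEN conjunct2, THEN conjunct2, THEN conjunct1]
    and LPP = defs[THEN conjunct2, THEN conjunct2, THEN conjunct2, THEN conjunct2, THEN conjunct1]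
    and L = defs[THEN conjunct2, THEN conjunct2, THEN conjunct2, THEN conjunct2, THEN conjunct2,
        THEN conjunct1, rule_format]
  define a where "a s t \<omega> = card (Pbar \<omega> \<inter> ({s<..t} \<times> {0..\<beta>}))" for s t \<omega>
  define b where "b s t \<omega> = card (P \<omega> \<inter> {s<..t})" for s t \<omega>
  have a: "{s<..t} \<times> {0..\<beta>} \<in> sets quarter_plane"
    "emeasure quarter_plane ({s<..t} \<times> {0..\<beta>}) = ennreal (\<beta> * (t - s))" "0 \<le> \<beta> * (t - s)"
    if "0 \<le> s" "s \<le> t" for s t
    using arrival_cell[OF that] assms(2) that by auto
  have b: "{s<..t} \<in> sets half_line" "emeasure half_line {s<..t} = ennreal (t - s)" "0 \<le> t - s"
    if "0 \<le> s" "s \<le> t" for s t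
    using reset_cell[OF that] that by auto
  have cells: "prob {\<omega>\<in>space M. L 0 \<omega> \<in> K \<and> (\<forall>j<m. a (g j) (g (Suc j)) \<omega> \<in> A j \<and>
        b (g j) (g (Suc j)) \<omega> \<in> B j)} = prob {\<omega>\<in>space M. L 0 \<omega> \<in> K} *
        (\<Prod>j<m. prob {\<omega>\<in>space M. a (g j) (g (Suc j)) \<omega> \<in> A j} *
          prob {\<omega>\<in>space M. b (g j) (g (Suc j)) \<omega> \<in> B j})"
    if g: "incseq g" "g 0 = 0" for g :: "nat \<Rightarrow> real" and m K A B
  proof -
    have g': "0 \<le> g j" "g j \<le> g (Suc j)" for j
      using g incseqD[OF g(1), of 0 j] by (auto simp: incseq_SucD)
    have sep: "g (Suc i) \<le> g j \<or> g (Suc j) \<le> g i" if "i \<noteq> j" for i j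
    proof -
      from that have "Suc i \<le> j \<or> Suc j \<le> i" by auto
      then show ?thesis using incseqD[OF g(1)] by blast
    qed
    let ?EL = "{\<omega>\<in>space M. L 0 \<omega> \<in> K}"
    let ?EA = "{\<omega>\<in>space M. \<forall>j<m. a (g j) (g (Suc j)) \<omega> \<in> A j}"
    let ?EB = "{\<omega>\<in>space M. \<forall>j<m. b (g j) (g (Suc j)) \<omega> \<in> B j}"
    have dA: "disjoint_family_on (\<lambda>j. {g j<..g (Suc j)} \<times> {0..\<beta>}) {..<m}"
      and dB: "disjoint_family_on (\<lambda>j. {g j<..g (Suc j)}) {..<m}"
    proof -
      have "{g i<..g (Suc i)} \<inter> {g j<..g (Suc j)} = {}" if "i \<noteq> j" for i j
        using sep[OF that] by auto
      then show "disjoint_family_on (\<lambda>j. {g j<..g (Suc j)} \<times> {0..\<beta>}) {..<m}"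
        "disjoint_family_on (\<lambda>j. {g j<..g (Suc j)}) {..<m}"
        by (simp_all add: disjoint_family_on_def Times_Int_Times)
    qed
    have sA: "{g j<..g (Suc j)} \<times> {0..\<beta>} \<in> sets quarter_plane \<and>
        emeasure quarter_plane ({g j<..g (Suc j)} \<times> {0..\<beta>}) < \<infinity>" for j
      using a[OF g'] by simp
    have sB: "{g j<..g (Suc j)} \<in> sets half_line \<and> emeasure half_line {g j<..g (Suc j)} < \<infinity>" for j
      using b[OF g'] by simp
    have A: "prob ?EA = (\<Prod>j<m. prob {\<omega>\<in>space M. a (g j) (g (Suc j)) \<omega> \<in> A j})"
      "?EA \<in> point_process_events M quarter_plane Pbar"
      unfolding a_def by (rule poisson_cells_independent[OF Pbar sA dA])+
    have B: "prob ?EB = (\<Prod>j<m. prob {\<omega>\<in>space M. b (g j) (g (Suc j)) \<omega> \<in> B j})"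
      "?EB \<in> point_process_events M half_line P"
      unfolding b_def by (rule poisson_cells_independent[OF P sB dB])+
    have "?EL = L 0 -` K \<inter> space M" by auto
    then have EL: "?EL \<in> initial_events M (L 0)"
      unfolding initial_events_def mem_Collect_eq by (intro exI[of _ K] conjI TrueI)
    have EAB: "?EA \<inter> ?EB \<in> sigma_sets (space M)
         (point_process_events M quarter_plane Pbar \<union> point_process_events M half_line P)"
    proof -
      let ?G = "point_process_events M quarter_plane Pbar \<union> point_process_events M half_line P"
      have "?G \<subseteq> events"
        by (rule Un_least[OF PP[unfolded indep_sets2_eq, THEN conjunct1]
              PP[unfolded indep_sets2_eq, THEN conjunct2, THEN conjunct1]])
      then have "?G \<subseteq> Pow (space M)"
        using sets.space_closed by (rule order_trans)
      then interpret G: sigma_algebra "space M" "sigma_sets (space M) ?G"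
        by (rule sigma_algebra_sigma_sets)
      show ?thesis
        by (rule G.Int[OF sigma_sets.Basic[OF UnI1[OF A(2)]] sigma_sets.Basic[OF UnI2[OF B(2)]]])
    qed
    have "prob {\<omega>\<in>space M. L 0 \<omega> \<in> K \<and> (\<forall>j<m. a (g j) (g (Suc j)) \<omega> \<in> A j \<and>
        b (g j) (g (Suc j)) \<omega> \<in> B j)} = prob (?EL \<inter> (?EA \<inter> ?EB))"
      by (rule arg_cong[where f = prob]) auto
    also have "\<dots> = prob ?EL * prob (?EA \<inter> ?EB)"
      by (rule LPP[unfolded indep_sets2_eq, THEN conjunct2, THEN conjunct2, THEN bspec, THEN bspec, OF EL EAB])
    also have "prob (?EA \<inter> ?EB) = prob ?EA * prob ?EB"
      by (rule PP[unfolded indep_sets2_eq, THEN conjunct2, THEN conjunct2, THEN bspec, THEN bspec, OF A(2) B(2)])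
    finally show ?thesis
      unfolding A(1) B(1) by (simp add: prod.distrib)
  qed
  show ?thesis
  proof (rule reset_process.intro[OF prob_space_axioms reset_process_axioms.intro])
    show "0 < \<beta>" by (rule assms(2))
  next
    fix s t :: real assume st: "0 \<le> s" "s \<le> t"
    show "(\<lambda>\<omega>. card (Pbar \<omega> \<inter> ({s<..t} \<times> {0..\<beta>}))) \<in> measurable M (count_space UNIV)"
      by (rule poisson_count(1)[OF Pbar a[OF st]])
    show "distr M (count_space UNIV) (\<lambda>\<omega>. card (Pbar \<omega> \<inter> ({s<..t} \<times> {0..\<beta>}))) =
        measure_pmf (poisson_law (\<beta> * (t - s)))"
      by (rule poisson_count(2)[OF Pbar a[OF st]])
    show "(\<lambda>\<omega>. card (P \<omega> \<inter> {s<..t})) \<in> measurable M (count_space UNIV)"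
      by (rule poisson_count(1)[OF P b[OF st]])
    show "distr M (count_space UNIV) (\<lambda>\<omega>. card (P \<omega> \<inter> {s<..t})) = measure_pmf (poisson_law (t - s))"
      by (rule poisson_count(2)[OF P b[OF st]])
  qed (fact L cells[unfolded a_def b_def] mckean_vlasov_dynamics[OF assms(1)])+
qed

section \<open>Invariance and uniqueness of the geometric distribution\<close>

text \<open>
  Cylinder sets generate the \<open>\<sigma>\<close>-algebra of the path space, and because the state space is countable a
  cylinder is a countable disjoint union of the events that fix finitely many values.
\<close>

lemma path_law_eqI:
  fixes X Y :: "real \<Rightarrow> 'w \<Rightarrow> nat"
  assumes M: "prob_space M"
    and X: "\<And>t. 0 \<le> t \<Longrightarrow> X t \<in> measurable M (count_space UNIV)"
    and Y: "\<And>t. 0 \<le> t \<Longrightarrow> Y t \<in> measurable M (count_space UNIV)"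
    and eq: "\<And>J f. finite J \<Longrightarrow> J \<subseteq> {0..} \<Longrightarrow>
      measure M {\<omega>\<in>space M. \<forall>i\<in>J. X i \<omega> = f i} = measure M {\<omega>\<in>space M. \<forall>i\<in>J. Y i \<omega> = f i}"
  shows "path_law M X = path_law M Y"
proof -
  interpret prob_space M by fact
  let ?N = "\<lambda>_::real. count_space (UNIV :: nat set)"
  have sets_cyl: "{\<omega>\<in>space M. \<forall>i\<in>J. Z i \<omega> \<in> A i} \<in> events"
    if "finite J" "J \<subseteq> {0..}" "\<forall>t\<ge>0. Z t \<in> measurable M (count_space UNIV)"
    for J A and Z :: "real \<Rightarrow> 'w \<Rightarrow> nat"
  proof (rule sets.sets_Collect_finite_All)
    fix i assume "i \<in> J"
    then have "Z i \<in> measurable M (count_space UNIV)" using that by auto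
    then show "{\<omega>\<in>space M. Z i \<omega> \<in> A i} \<in> events"
      by (rule measurable_sets_Collect) auto
  qed fact
  have cylinder: "emeasure M {\<omega>\<in>space M. \<forall>i\<in>J. Z i \<omega> \<in> A i} =
      (\<integral>\<^sup>+f. emeasure M {\<omega>\<in>space M. \<forall>i\<in>J. Z i \<omega> = f i} \<partial>count_space (Pi\<^sub>E J A))"
    if J: "finite J" "J \<subseteq> {0..}" and Z: "\<forall>t\<ge>0. Z t \<in> measurable M (count_space UNIV)"
    for J A and Z :: "real \<Rightarrow> 'w \<Rightarrow> nat"
  proof -
    have "{\<omega>\<in>space M. \<forall>i\<in>J. Z i \<omega> \<in> A i} = (\<Union>f\<in>Pi\<^sub>E J A. {\<omega>\<in>space M. \<forall>i\<in>J. Z i \<omega> = f i})"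
    proof (intro set_eqI iffI)
      fix \<omega> assume \<omega>: "\<omega> \<in> {\<omega>\<in>space M. \<forall>i\<in>J. Z i \<omega> \<in> A i}"
      then have "(\<lambda>i\<in>J. Z i \<omega>) \<in> Pi\<^sub>E J A" by auto
      then show "\<omega> \<in> (\<Union>f\<in>Pi\<^sub>E J A. {\<omega>\<in>space M. \<forall>i\<in>J. Z i \<omega> = f i})"
        using \<omega> by (auto intro!: bexI[of _ "\<lambda>i\<in>J. Z i \<omega>"])
    qed (auto simp: PiE_iff)
    also have "emeasure M \<dots> =
        (\<integral>\<^sup>+f. emeasure M {\<omega>\<in>space M. \<forall>i\<in>J. Z i \<omega> = f i} \<partial>count_space (Pi\<^sub>E J A))"
    proof (rule emeasure_UN_countable)
      show "{\<omega>\<in>space M. \<forall>i\<in>J. Z i \<omega> = f i} \<in> events" for f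
      proof -
        have "{\<omega>\<in>space M. \<forall>i\<in>J. Z i \<omega> \<in> {f i}} \<in> events"
          by (rule sets_cyl[OF J Z])
        then show ?thesis by simp
      qed
      show "countable (Pi\<^sub>E J A)"
        using J by (intro countable_PiE) auto
      show "disjoint_family_on (\<lambda>f. {\<omega>\<in>space M. \<forall>i\<in>J. Z i \<omega> = f i}) (Pi\<^sub>E J A)"
        unfolding disjoint_family_on_def
      proof (intro ballI impI equals0I)
        fix f g \<omega>
        assume fg: "f \<in> Pi\<^sub>E J A" "g \<in> Pi\<^sub>E J A" "f \<noteq> g"
          and "\<omega> \<in> {\<omega>\<in>space M. \<forall>i\<in>J. Z i \<omega> = f i} \<inter> {\<omega>\<in>space M. \<forall>i\<in>J. Z i \<omega> = g i}"
        then have "f i = g i" if "i \<in> J" for i using that by auto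
        with fg show False using PiE_ext[OF fg(1,2)] by blast
      qed
    qed
    finally show ?thesis .
  qed
  have path: "(\<lambda>\<omega>. \<lambda>t\<in>{0..}. Z t \<omega>) \<in> measurable M (PiM {0..} ?N)"
    if "\<forall>t\<ge>0. Z t \<in> measurable M (count_space UNIV)" for Z :: "real \<Rightarrow> 'w \<Rightarrow> nat"
    using that by (intro measurable_restrict) auto
  have law: "emeasure (path_law M Z) (prod_emb {0..} ?N J (Pi\<^sub>E J A)) =
      emeasure M {\<omega>\<in>space M. \<forall>i\<in>J. Z i \<omega> \<in> A i}"
    if J: "finite J" "J \<subseteq> {0..}" and Z: "\<forall>t\<ge>0. Z t \<in> measurable M (count_space UNIV)"
    for J A and Z :: "real \<Rightarrow> 'w \<Rightarrow> nat"
    unfolding path_law_def using J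
    by (subst emeasure_distr[OF path[OF Z] sets_PiM_I])
       (auto intro!: arg_cong[where f = "emeasure M"] simp: prod_emb_def PiE_iff subset_iff)
  have XY: "\<forall>t\<ge>0. X t \<in> measurable M (count_space UNIV)" "\<forall>t\<ge>0. Y t \<in> measurable M (count_space UNIV)"
    using X Y by auto
  show ?thesis
  proof (rule measure_eqI_PiM_infinite)
    show "sets (path_law M X) = sets (PiM {0..} ?N)" "sets (path_law M Y) = sets (PiM {0..} ?N)"
      by (simp_all add: path_law_def)
    show "finite_measure (path_law M X)"
      unfolding path_law_def by (intro prob_space.finite_measure prob_space_distr path XY)
    fix A :: "real \<Rightarrow> nat set" and J :: "real set"
    assume J: "finite J" "J \<subseteq> {0..}"
    show "emeasure (path_law M X) (prod_emb {0..} ?N J (Pi\<^sub>E J A)) =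
        emeasure (path_law M Y) (prod_emb {0..} ?N J (Pi\<^sub>E J A))"
      unfolding law[OF J XY(1)] law[OF J XY(2)] cylinder[OF J XY(1)] cylinder[OF J XY(2)]
      by (simp add: emeasure_eq_measure eq[OF J])
  qed
qed

lemma geometric_mass_law:
  assumes "0 < \<beta>"
  shows "pmf (geometric_law (\<beta> / (1 + \<beta>))) l = geometric_mass (\<beta> / (1 + \<beta>)) l"
  using assms by (simp add: pmf_geometric_law geometric_mass_def)

lemma prob_eq_pmf:
  assumes "X \<in> measurable M (count_space UNIV)" "distr M (count_space UNIV) X = measure_pmf \<pi>"
  shows "measure M {\<omega>\<in>space M. X \<omega> = l} = pmf \<pi> l"
proof -
  have "pmf \<pi> l = measure (distr M (count_space UNIV) X) {l}"
    unfolding assms(2) by (simp add: measure_pmf_single)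
  also have "\<dots> = measure M (X -` {l} \<inter> space M)"
    using assms(1) by (intro measure_distr) auto
  also have "X -` {l} \<inter> space M = {\<omega>\<in>space M. X \<omega> = l}"
    by auto
  finally show ?thesis by simp
qed

text \<open>
  Starting at distance \<open>0\<close> from the geometric distribution the process stays there, so its
  one-dimensional laws are constant and \<open>trajectory_shift_invariant\<close> applies.
\<close>

theorem geometric_law_invariant:
  assumes "0 < \<beta>"
  shows "invariant_distribution TYPE('w) random_algorithm \<beta> (geometric_law (\<beta> / (1 + \<beta>)))"
  unfolding invariant_distribution_def
proof (intro allI impI)
  fix M :: "'w measure" and Pbar P L and T :: real
  assume *: "mckean_vlasov_process random_algorithm \<beta> M Pbar P L \<and>
      distr M (count_space UNIV) (L 0) = measure_pmf (geometric_law (\<beta> / (1 + \<beta>)))" and T: "0 < T"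
  interpret reset_process M \<beta> "\<lambda>s t \<omega>. card (Pbar \<omega> \<inter> ({s<..t} \<times> {0..\<beta>}))"
      "\<lambda>s t \<omega>. card (P \<omega> \<inter> {s<..t})" L
    by (rule mckean_vlasov_reset_process[OF *[THEN conjunct1] assms])
  have initial: "prob {\<omega>\<in>space M. L 0 \<omega> = l} = geometric_mass (\<beta> / (1 + \<beta>)) l" for l
    using prob_eq_pmf[OF measurable_L[OF order_refl] *[THEN conjunct2]] by (simp add: geometric_mass_law assms)
  have stationary: "prob {\<omega>\<in>space M. L t \<omega> = l} = geometric_mass (\<beta> / (1 + \<beta>)) l" if "0 \<le> t" for t l
    using distance_to_geometric[of t 0 l] initial that by (cases "t = 0") auto
  show "path_law M (\<lambda>t. L (t + T)) = path_law M L"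
  proof (rule path_law_eqI[OF prob_space_axioms])
    fix J :: "real set" and f
    assume J: "finite J" "J \<subseteq> {0..}"
    have "J \<subseteq> {0..Max (insert 0 J)}" "0 \<le> Max (insert 0 J)"
      using J by (auto intro: Max_ge)
    from trajectory_shift_invariant[OF J(1) _ this, of T f] T
    show "prob {\<omega>\<in>space M. \<forall>i\<in>J. L (i + T) \<omega> = f i} = prob {\<omega>\<in>space M. \<forall>i\<in>J. L i \<omega> = f i}"
      by (simp add: trajectory_def stationary)
  qed (use T measurable_L in auto)
qed

text \<open>
  Invariance equates the laws at times \<open>0\<close> and \<open>1\<close>, while \<open>distance_to_geometric\<close> shrinks every bound
  for the distance by \<open>exp (- 1)\<close>; so the distance is \<open>0\<close>. The existence of a process with initial law
  \<open>\<pi>\<close> is a hypothesis here, because without such a process \<open>\<pi>\<close> would be invariant for trivial reasons.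
\<close>

lemma invariant_imp_geometric:
  assumes "0 < \<beta>" and inv: "invariant_distribution TYPE('w) random_algorithm \<beta> \<pi>"
    and proc: "mckean_vlasov_process random_algorithm \<beta> (M :: 'w measure) Pbar P L"
      "distr M (count_space UNIV) (L 0) = measure_pmf \<pi>"
  shows "\<pi> = geometric_law (\<beta> / (1 + \<beta>))"
proof -
  interpret reset_process M \<beta> "\<lambda>s t \<omega>. card (Pbar \<omega> \<inter> ({s<..t} \<times> {0..\<beta>}))"
      "\<lambda>s t \<omega>. card (P \<omega> \<inter> {s<..t})" L
    by (rule mckean_vlasov_reset_process[OF proc(1) assms(1)])
  let ?g = "geometric_mass (\<beta> / (1 + \<beta>))"
  have initial: "prob {\<omega>\<in>space M. L 0 \<omega> = l} = pmf \<pi> l" for l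
    by (rule prob_eq_pmf[OF measurable_L[OF order_refl] proc(2)])
  have stationary: "prob {\<omega>\<in>space M. L 1 \<omega> = l} = pmf \<pi> l" for l
  proof -
    have "path_law M (\<lambda>t. L (t + 1)) = path_law M L"
      using inv proc unfolding invariant_distribution_def by (metis zero_less_one)
    then have "distr (path_law M (\<lambda>t. L (t + 1))) (count_space UNIV) (\<lambda>x. x 0) =
        distr (path_law M L) (count_space UNIV) (\<lambda>x. x 0)" by simp
    moreover have "distr (path_law M X) (count_space UNIV) (\<lambda>x. x 0) = distr M (count_space UNIV) (X 0)"
      if "\<And>t. 0 \<le> t \<Longrightarrow> X t \<in> measurable M (count_space UNIV)" for X :: "real \<Rightarrow> 'w \<Rightarrow> nat"
      unfolding path_law_def using that
      by (subst distr_distr) (auto simp: comp_def intro!: measurable_restrict)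
    ultimately have "distr M (count_space UNIV) (L 1) = distr M (count_space UNIV) (L 0)"
      using measurable_L by simp
    then show ?thesis
      using prob_eq_pmf[OF measurable_L[of 1]] proc(2) by simp
  qed
  have contract: "\<bar>pmf \<pi> l - ?g l\<bar> \<le> exp (- 1) * K" if "\<And>l. \<bar>pmf \<pi> l - ?g l\<bar> \<le> K" for K l
    using distance_to_geometric[of 1 K l] that by (simp add: initial stationary)
  have "\<bar>pmf \<pi> l - ?g l\<bar> \<le> exp (- 1) ^ n" for n l
  proof (induction n arbitrary: l)
    case 0
    have "0 \<le> ?g l" "?g l \<le> 1"
      using pmf_nonneg pmf_le_1 unfolding geometric_mass_law[OF assms(1), symmetric] by auto
    then show ?case using pmf_nonneg[of \<pi> l] pmf_le_1[of \<pi> l] unfolding power_0 by linarith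
  next
    case (Suc n)
    then show ?case using contract by simp
  qed
  then have "\<bar>pmf \<pi> l - ?g l\<bar> \<le> 0" for l
    by (intro LIMSEQ_le_const[OF LIMSEQ_realpow_zero[of "exp (- 1)"]]) (auto intro: exI)
  then show ?thesis
    using assms(1) by (intro pmf_eqI) (simp add: geometric_mass_law)
qed

section \<open>The exponential limit\<close>

theorem geometric_scaling_limit:
  fixes \<Omega> :: "real \<Rightarrow> 'y measure" and Y :: "real \<Rightarrow> 'y \<Rightarrow> nat" and N :: "'e measure"
  assumes Y: "\<And>\<beta>. 0 < \<beta> \<Longrightarrow> Y \<beta> \<in> measurable (\<Omega> \<beta>) (count_space UNIV)"
      "\<And>\<beta>. 0 < \<beta> \<Longrightarrow> distr (\<Omega> \<beta>) (count_space UNIV) (Y \<beta>) =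
             measure_pmf (geometric_law (\<beta> / (1 + \<beta>)))"
    and N: "prob_space N" "distributed N lborel E (exponential_density 1)"
  shows "weak_conv_along (\<lambda>\<beta>. distr (\<Omega> \<beta>) borel (\<lambda>\<omega>. real (Y \<beta> \<omega>) / \<beta>)) (distr N borel E) at_top"
  unfolding weak_conv_along_def
proof (intro allI impI)
  fix x :: real
  interpret N: prob_space N by fact
  have E[measurable]: "E \<in> borel_measurable N"
    using distributed_measurable[OF N(2)] by simp
  have cdf_Y: "cdf (distr (\<Omega> \<beta>) borel (\<lambda>\<omega>. real (Y \<beta> \<omega>) / \<beta>)) x =
      measure (geometric_law (\<beta> / (1 + \<beta>))) {k. real k \<le> \<beta> * x}" if "0 < \<beta>" for \<beta>
  proof -
    have [measurable]: "Y \<beta> \<in> measurable (\<Omega> \<beta>) (count_space UNIV)" using Y that by simp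
    have "cdf (distr (\<Omega> \<beta>) borel (\<lambda>\<omega>. real (Y \<beta> \<omega>) / \<beta>)) x =
        measure (\<Omega> \<beta>) ((\<lambda>\<omega>. real (Y \<beta> \<omega>) / \<beta>) -` {..x} \<inter> space (\<Omega> \<beta>))"
      unfolding cdf_def by (intro measure_distr) auto
    also have "(\<lambda>\<omega>. real (Y \<beta> \<omega>) / \<beta>) -` {..x} \<inter> space (\<Omega> \<beta>) =
        Y \<beta> -` {k. real k \<le> \<beta> * x} \<inter> space (\<Omega> \<beta>)"
      using that by (auto simp: field_simps)
    also have "measure (\<Omega> \<beta>) \<dots> = measure (distr (\<Omega> \<beta>) (count_space UNIV) (Y \<beta>)) {k. real k \<le> \<beta> * x}"
      by (intro measure_distr[symmetric]) auto
    finally show ?thesis using Y(2)[OF that] by simp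
  qed
  show "((\<lambda>\<beta>. cdf (distr (\<Omega> \<beta>) borel (\<lambda>\<omega>. real (Y \<beta> \<omega>) / \<beta>)) x) \<longlongrightarrow> cdf (distr N borel E) x) at_top"
  proof (cases "x < 0")
    case True
    have "cdf (distr N borel E) x = 0"
    proof -
      have "N.prob {\<omega>\<in>space N. E \<omega> \<le> x} \<le> N.prob {\<omega>\<in>space N. E \<omega> \<le> 0}"
        using True by (intro N.finite_measure_mono) auto
      also have "\<dots> = 0"
        using N.exponential_distributedD_le[OF N(2), of 0] by simp
      finally have "N.prob {\<omega>\<in>space N. E \<omega> \<le> x} = 0" using measure_nonneg by (rule antisym)
      then show ?thesis by (simp add: cdf_def measure_distr vimage_def Int_def conj_commute)
    qed
    moreover have "measure (geometric_law (\<beta> / (1 + \<beta>))) {k. real k \<le> \<beta> * x} = 0" if "0 < \<beta>" for \<beta>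
    proof -
      have "\<beta> * x < 0" using True that by (simp add: mult_pos_neg)
      then have "{k. real k \<le> \<beta> * x} = {}" by auto
      then show ?thesis by simp
    qed
    ultimately show ?thesis
      by (intro tendsto_eventually eventually_mono[OF eventually_gt_at_top[of 0]]) (simp add: cdf_Y)
  next
    case False
    have geo: "measure (geometric_law (\<beta> / (1 + \<beta>))) {k. real k \<le> \<beta> * x} =
        1 - (\<beta> / (1 + \<beta>)) ^ nat (\<lfloor>\<beta> * x\<rfloor> + 1)" if "0 < \<beta>" for \<beta>
    proof -
      have "0 \<le> \<beta> * x" using that False by simp
      then have "{k. real k \<le> \<beta> * x} = {..<nat (\<lfloor>\<beta> * x\<rfloor> + 1)}"
        by (auto simp: le_floor_iff zless_nat_eq_int_zless)
      moreover have "measure (geometric_law (\<beta> / (1 + \<beta>))) {..<n} = 1 - (\<beta> / (1 + \<beta>)) ^ n" for n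
      proof (induction n)
        case (Suc n)
        have "measure (geometric_law (\<beta> / (1 + \<beta>))) {..<Suc n} =
            measure (geometric_law (\<beta> / (1 + \<beta>))) {..<n} + pmf (geometric_law (\<beta> / (1 + \<beta>))) n"
          by (simp add: measure_measure_pmf_finite)
        then show ?case
          using Suc that by (simp add: pmf_geometric_law algebra_simps)
      qed simp
      ultimately show ?thesis by simp
    qed
    have "((\<lambda>\<beta>. 1 - (\<beta> / (1 + \<beta>)) ^ nat (\<lfloor>\<beta> * x\<rfloor> + 1)) \<longlongrightarrow> 1 - exp (- x)) at_top"
    \<comment> \<open>the integer exponent lies between beta x and beta x + 1, and both real powers have the same limit\<close>
    proof (rule tendsto_sandwich)
      show "((\<lambda>\<beta>. 1 - (\<beta> / (1 + \<beta>)) powr (\<beta> * x)) \<longlongrightarrow> 1 - exp (- x)) at_top"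
        "((\<lambda>\<beta>. 1 - (\<beta> / (1 + \<beta>)) powr (\<beta> * x + 1)) \<longlongrightarrow> 1 - exp (- x)) at_top"
        by (real_asymp simp: exp_minus)+
      have pow: "(\<beta> / (1 + \<beta>)) ^ nat (\<lfloor>\<beta> * x\<rfloor> + 1) = (\<beta> / (1 + \<beta>)) powr (\<lfloor>\<beta> * x\<rfloor> + 1)" if "0 < \<beta>" for \<beta>
      proof -
        have "0 \<le> \<lfloor>\<beta> * x\<rfloor>" using that False by simp
        then show ?thesis using that by (simp add: powr_realpow[symmetric])
      qed
      show "\<forall>\<^sub>F \<beta> in at_top. 1 - (\<beta> / (1 + \<beta>)) powr (\<beta> * x) \<le> 1 - (\<beta> / (1 + \<beta>)) ^ nat (\<lfloor>\<beta> * x\<rfloor> + 1)"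
        using eventually_gt_at_top[of 0]
      proof eventually_elim
        case (elim \<beta>)
        have "\<beta> * x \<le> \<lfloor>\<beta> * x\<rfloor> + 1" by linarith
        then show ?case
          using elim by (simp add: pow) (intro powr_mono'; simp)
      qed
      show "\<forall>\<^sub>F \<beta> in at_top. 1 - (\<beta> / (1 + \<beta>)) ^ nat (\<lfloor>\<beta> * x\<rfloor> + 1) \<le> 1 - (\<beta> / (1 + \<beta>)) powr (\<beta> * x + 1)"
        using eventually_gt_at_top[of 0]
      proof eventually_elim
        case (elim \<beta>)
        have "\<lfloor>\<beta> * x\<rfloor> + 1 \<le> \<beta> * x + 1" by linarith
        then show ?case
          using elim by (simp add: pow) (intro powr_mono'; simp)
      qed
    qed
    moreover have "cdf (distr N borel E) x = 1 - exp (- x)"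
      using N.exponential_distributedD_le[OF N(2), of x] False
      by (simp add: cdf_def measure_distr vimage_def Int_def conj_commute)
    ultimately show ?thesis
      by (simp, elim Lim_transform_eventually)
         (auto intro!: eventually_mono[OF eventually_gt_at_top[of 0]] simp: cdf_Y geo)
  qed
qed

section \<open>Joint laws from generating functions\<close>

text \<open>
  If all coefficients of the difference below \<open>n\<close> vanish, division by \<open>z ^ n\<close> leaves a power series that
  is zero on \<open>(0, 1)\<close> and continuous at \<open>0\<close>, where its value is the \<open>n\<close>-th coefficient.
\<close>

lemma power_series_coeffs_unique:
  fixes a b :: "nat \<Rightarrow> real"
  assumes a: "\<And>z. 0 \<le> z \<Longrightarrow> z < 1 \<Longrightarrow> (\<lambda>k. a k * z ^ k) sums s z"
    and b: "\<And>z. 0 \<le> z \<Longrightarrow> z < 1 \<Longrightarrow> (\<lambda>k. b k * z ^ k) sums s z"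
  shows "a n = b n"
proof -
  define c where "c k = a k - b k" for k
  have c: "(\<lambda>k. c k * z ^ k) sums 0" if "0 \<le> z" "z < 1" for z
    using sums_diff[OF a b, OF that that] by (simp add: c_def left_diff_distrib)
  have "c n = 0"
  proof (induction n rule: less_induct)
    case (less n)
    define h where "h z = (\<Sum>k. c (k + n) * z ^ k)" for z :: real
    have h0: "h z = 0" if z: "0 < z" "z < 1" for z
    proof -
      have "(\<lambda>k. c (k + n) * z ^ (k + n)) sums (0 - (\<Sum>k<n. c k * z ^ k))"
        using z by (intro sums_split_initial_segment c) auto
      then have "(\<lambda>k. z ^ n * (c (k + n) * z ^ k)) sums 0"
        using less by (simp add: power_add mult_ac)
      then have "(\<lambda>k. c (k + n) * z ^ k) sums 0"
        using sums_mult_D[of "z ^ n" _ 0] z by auto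
      then show ?thesis unfolding h_def by (rule sums_unique[symmetric])
    qed
    have "summable (\<lambda>k. c k * (1/2) ^ k)"
      using c[of "1/2"] by (simp add: sums_iff)
    then have "summable (\<lambda>k. c (k + n) * (1/2) ^ (k + n))"
      by (rule summable_ignore_initial_segment)
    then have "summable (\<lambda>k. (1/2) ^ n * (c (k + n) * (1/2) ^ k))"
      by (simp add: power_add mult_ac)
    then have "summable (\<lambda>k. c (k + n) * (1/2) ^ k)"
      by (rule summable_mult_D) simp
    then have "isCont h 0"
      unfolding h_def by (rule isCont_powser) simp
    then have "(h \<longlongrightarrow> h 0) (at_right 0)"
      by (meson filterlim_at_split isCont_def)
    moreover have "(h \<longlongrightarrow> 0) (at_right 0)"
      using h0 by (intro tendsto_eventually) (auto simp: eventually_at_right_field intro!: exI[of _ 1])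
    ultimately have "h 0 = 0"
      by (intro tendsto_unique[OF trivial_limit_at_right_real])
    then show ?case
      using powser_zero[of "\<lambda>k. c (k + n)"] by (simp add: h_def)
  qed
  then show ?thesis by (simp add: c_def)
qed

text \<open>
  The weight \<open>W\<close> carries the variables that are not treated in the current step.
\<close>

lemma (in prob_space) pgf_coefficient:
  fixes W :: "'a \<Rightarrow> real" and X :: "'a \<Rightarrow> nat" and p :: "nat pmf"
  assumes [measurable]: "W \<in> borel_measurable M" "X \<in> measurable M (count_space UNIV)"
    and W: "\<And>\<omega>. 0 \<le> W \<omega>" "\<And>\<omega>. W \<omega> \<le> 1"
    and pgf: "\<And>z. 0 \<le> z \<Longrightarrow> z < 1 \<Longrightarrow>
      expectation (\<lambda>\<omega>. W \<omega> * z ^ X \<omega>) = C * (\<Sum>k. pmf p k * z ^ k)"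
  shows "expectation (\<lambda>\<omega>. W \<omega> * of_bool (X \<omega> = k)) = C * pmf p k"
proof (rule power_series_coeffs_unique)
  fix z :: real assume z: "0 \<le> z" "z < 1"
  have bdd: "0 \<le> W \<omega> * z ^ n" "W \<omega> * z ^ n \<le> z ^ n" for \<omega> n
    using W z by (auto intro: mult_left_le_one_le)
  have le1: "W \<omega> * z ^ n \<le> 1" for \<omega> n
    using bdd(2)[of \<omega> n] z by (meson order_trans power_le_one less_imp_le)
  have int: "integrable M (\<lambda>\<omega>. W \<omega> * z ^ X \<omega> * of_bool (P (X \<omega>)))" for P
    using bdd le1 by (intro integrable_const_bound[of _ 1]) (auto intro!: AE_I2)
  have int2: "integrable M (\<lambda>\<omega>. W \<omega> * of_bool (X \<omega> = k))" for k
    using W by (intro integrable_const_bound[of _ 1]) (auto intro!: AE_I2)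
  have part: "(\<Sum>k<n. expectation (\<lambda>\<omega>. W \<omega> * of_bool (X \<omega> = k)) * z ^ k) =
      expectation (\<lambda>\<omega>. W \<omega> * z ^ X \<omega> * of_bool (X \<omega> < n))" for n
  proof -
    have "(\<Sum>k<n. expectation (\<lambda>\<omega>. W \<omega> * of_bool (X \<omega> = k)) * z ^ k) =
        expectation (\<lambda>\<omega>. \<Sum>k<n. W \<omega> * of_bool (X \<omega> = k) * z ^ k)"
      using int2 by (subst Bochner_Integration.integral_sum) auto
    also have "(\<lambda>\<omega>. \<Sum>k<n. W \<omega> * of_bool (X \<omega> = k) * z ^ k) = (\<lambda>\<omega>. W \<omega> * z ^ X \<omega> * of_bool (X \<omega> < n))"
    proof
      fix \<omega>
      have "(\<Sum>k<n. W \<omega> * of_bool (X \<omega> = k) * z ^ k) = (\<Sum>k<n. if k = X \<omega> then W \<omega> * z ^ X \<omega> else 0)"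
        by (intro sum.cong) auto
      then show "(\<Sum>k<n. W \<omega> * of_bool (X \<omega> = k) * z ^ k) = W \<omega> * z ^ X \<omega> * of_bool (X \<omega> < n)"
        by simp
    qed
    finally show ?thesis .
  qed
  have "(\<lambda>n. expectation (\<lambda>\<omega>. W \<omega> * z ^ X \<omega> * of_bool (X \<omega> < n))) \<longlonglongrightarrow> expectation (\<lambda>\<omega>. W \<omega> * z ^ X \<omega>)"
  proof (rule integral_dominated_convergence[where w = "\<lambda>_. 1"])
    show "AE \<omega> in M. (\<lambda>n. W \<omega> * z ^ X \<omega> * of_bool (X \<omega> < n)) \<longlonglongrightarrow> W \<omega> * z ^ X \<omega>"
    proof (intro AE_I2 tendsto_eventually)
      fix \<omega> show "\<forall>\<^sub>F n in sequentially. W \<omega> * z ^ X \<omega> * of_bool (X \<omega> < n) = W \<omega> * z ^ X \<omega>"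
        using eventually_gt_at_top[of "X \<omega>"] by eventually_elim simp
    qed
  qed (use bdd le1 in auto)
  then have "(\<lambda>k. expectation (\<lambda>\<omega>. W \<omega> * of_bool (X \<omega> = k)) * z ^ k) sums expectation (\<lambda>\<omega>. W \<omega> * z ^ X \<omega>)"
    unfolding sums_def part .
  then show "(\<lambda>k. expectation (\<lambda>\<omega>. W \<omega> * of_bool (X \<omega> = k)) * z ^ k) sums (C * (\<Sum>k. pmf p k * z ^ k))"
    using pgf[OF z] by simp
  have "summable (\<lambda>k. pmf p k * z ^ k)"
  proof (rule summable_comparison_test')
    show "summable (\<lambda>k. z ^ k)" using z by (intro summable_geometric) simp
    show "norm (pmf p k * z ^ k) \<le> z ^ k" for k
      using z pmf_le_1[of p k] by (auto intro: mult_left_le_one_le)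
  qed
  then show "(\<lambda>k. C * pmf p k * z ^ k) sums (C * (\<Sum>k. pmf p k * z ^ k))"
    using sums_mult[OF summable_sums, of "\<lambda>k. pmf p k * z ^ k" C] by (simp add: mult.assoc)
qed

text \<open>
  The variables are treated one by one: the expectation is a power series in each single \<open>z j\<close>, so one
  factor \<open>z j ^ X j\<close> after the other can be replaced by the indicator of \<open>{X j = k j}\<close>.
\<close>

lemma (in prob_space) pgf_determines_joint_law:
  fixes X :: "'i \<Rightarrow> 'a \<Rightarrow> nat" and p :: "'i \<Rightarrow> nat pmf"
  assumes J: "finite J" and X: "\<And>j. j \<in> J \<Longrightarrow> X j \<in> measurable M (count_space UNIV)"
    and pgf: "\<And>z. (\<And>j. 0 \<le> z j \<and> z j < 1) \<Longrightarrow>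
      expectation (\<lambda>\<omega>. \<Prod>j\<in>J. z j ^ X j \<omega>) = (\<Prod>j\<in>J. \<Sum>k. pmf (p j) k * z j ^ k)"
  shows "prob {\<omega>\<in>space M. \<forall>j\<in>J. X j \<omega> = k j} = (\<Prod>j\<in>J. pmf (p j) (k j))"
proof -
  have peel: "expectation (\<lambda>\<omega>. (\<Prod>j\<in>J - R. z j ^ X j \<omega>) * (\<Prod>j\<in>R. of_bool (X j \<omega> = k j))) =
      (\<Prod>j\<in>J - R. \<Sum>k. pmf (p j) k * z j ^ k) * (\<Prod>j\<in>R. pmf (p j) (k j))"
    if "R \<subseteq> J" and z: "\<And>j. 0 \<le> z j \<and> z j < 1" for R z
    using finite_subset[OF that(1) J] that
  proof (induction R arbitrary: z rule: finite_induct)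
    case empty
    then show ?case using pgf[of z] by simp
  next
    case (insert r R)
    let ?W = "\<lambda>\<omega>. (\<Prod>j\<in>J - insert r R. z j ^ X j \<omega>) * (\<Prod>j\<in>R. of_bool (X j \<omega> = k j))"
    let ?C = "(\<Prod>j\<in>J - insert r R. \<Sum>k. pmf (p j) k * z j ^ k) * (\<Prod>j\<in>R. pmf (p j) (k j))"
    have JR: "J - R = insert r (J - insert r R)" "r \<notin> J - insert r R" "finite (J - insert r R)"
      using insert J by auto
    have [measurable]: "X j \<in> measurable M (count_space UNIV)" if "j \<in> J" for j
      using X that by simp
    have "expectation (\<lambda>\<omega>. ?W \<omega> * of_bool (X r \<omega> = k r)) = ?C * pmf (p r) (k r)"
    proof (rule pgf_coefficient)
      have "(\<lambda>\<omega>. \<Prod>j\<in>J - insert r R. z j ^ X j \<omega>) \<in> borel_measurable M"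
        by (intro borel_measurable_prod) measurable
      moreover have "(\<lambda>\<omega>. \<Prod>j\<in>R. of_bool (X j \<omega> = k j) :: real) \<in> borel_measurable M"
        using insert.prems by (intro borel_measurable_prod) (auto simp: of_bool_def)
      ultimately show "?W \<in> borel_measurable M" by measurable
      show "X r \<in> measurable M (count_space UNIV)" using insert.prems by simp
      show "0 \<le> ?W \<omega>" "?W \<omega> \<le> 1" for \<omega>
        using insert.prems(2)
        by (auto intro!: mult_nonneg_nonneg mult_le_one prod_nonneg prod_le_1 power_le_one simp: less_imp_le)
      fix x :: real assume x: "0 \<le> x" "x < 1"
      define z' where "z' = z(r := x)"
      have z': "0 \<le> z' j \<and> z' j < 1" for j using insert.prems(2)[of j] x by (auto simp: z'_def)
      have same: "(\<Prod>j\<in>J - insert r R. z' j ^ X j \<omega>) = (\<Prod>j\<in>J - insert r R. z j ^ X j \<omega>)"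
        "(\<Prod>j\<in>J - insert r R. \<Sum>k. pmf (p j) k * z' j ^ k) = (\<Prod>j\<in>J - insert r R. \<Sum>k. pmf (p j) k * z j ^ k)"
        for \<omega> by (intro prod.cong; simp add: z'_def)+
      have "expectation (\<lambda>\<omega>. (\<Prod>j\<in>J - R. z' j ^ X j \<omega>) * (\<Prod>j\<in>R. of_bool (X j \<omega> = k j))) =
          (\<Prod>j\<in>J - R. \<Sum>k. pmf (p j) k * z' j ^ k) * (\<Prod>j\<in>R. pmf (p j) (k j))"
        using insert.prems by (intro insert.IH z') auto
      then show "expectation (\<lambda>\<omega>. ?W \<omega> * x ^ X r \<omega>) = ?C * (\<Sum>k. pmf (p r) k * x ^ k)"
        unfolding JR(1) prod.insert[OF JR(3,2)] same by (simp add: z'_def mult_ac)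
    qed
    then show ?case
      using insert.hyps by (simp add: mult_ac)
  qed
  have "expectation (\<lambda>\<omega>. \<Prod>j\<in>J. of_bool (X j \<omega> = k j)) = (\<Prod>j\<in>J. pmf (p j) (k j))"
    using peel[of J "\<lambda>_. 0"] by simp
  moreover have "(\<Prod>j\<in>J. of_bool (X j \<omega> = k j)) = (of_bool (\<forall>j\<in>J. X j \<omega> = k j) :: real)" for \<omega>
    using J by (induction J rule: finite_induct) auto
  moreover have "expectation (\<lambda>\<omega>. of_bool (\<forall>j\<in>J. X j \<omega> = k j) :: real) =
      expectation (indicator {\<omega>\<in>space M. \<forall>j\<in>J. X j \<omega> = k j})"
    by (intro Bochner_Integration.integral_cong) (auto simp: indicator_def)
  moreover have "expectation (indicator {\<omega>\<in>space M. \<forall>j\<in>J. X j \<omega> = k j}) =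
      prob {\<omega>\<in>space M. \<forall>j\<in>J. X j \<omega> = k j}"
    by (simp add: Int_absorb2 subset_eq)
  ultimately show ?thesis by simp
qed

lemma (in prob_space) indep_vars_nat_valued:
  fixes X :: "'i \<Rightarrow> 'a \<Rightarrow> nat"
  assumes X: "\<And>i. i \<in> I \<Longrightarrow> X i \<in> measurable M (count_space UNIV)"
    and joint: "\<And>J k. finite J \<Longrightarrow> J \<subseteq> I \<Longrightarrow>
      prob {\<omega>\<in>space M. \<forall>j\<in>J. X j \<omega> = k j} = (\<Prod>j\<in>J. prob {\<omega>\<in>space M. X j \<omega> = k j})"
  shows "indep_vars (\<lambda>_. count_space UNIV) X I"
proof -
  let ?S = "\<lambda>i. insert {} (range (\<lambda>k. {\<omega>\<in>space M. X i \<omega> = k}))"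
  have ev: "{\<omega>\<in>space M. X i \<omega> = k} \<in> events" if "i \<in> I" for i k
    using X[OF that] by (rule measurable_sets_Collect) auto
  have "indep_sets ?S I"
  proof (rule indep_setsI)
    fix J A assume J: "J \<noteq> {}" "J \<subseteq> I" "finite J" and A: "\<forall>j\<in>J. A j \<in> ?S j"
    show "prob (\<Inter>j\<in>J. A j) = (\<Prod>j\<in>J. prob (A j))"
    proof (cases "\<exists>j\<in>J. A j = {}")
      case True
      then obtain j where j: "j \<in> J" "A j = {}" by blast
      then have "(\<Inter>j\<in>J. A j) = {}" by blast
      moreover have "(\<Prod>j\<in>J. prob (A j)) = 0"
        using j J(3) by (intro prod_zero bexI[of _ j]) simp_all
      ultimately show ?thesis by simp
    next
      case False
      then have "\<forall>j\<in>J. \<exists>k. A j = {\<omega>\<in>space M. X j \<omega> = k}" using A by blast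
      from bchoice[OF this] obtain k where k: "\<And>j. j \<in> J \<Longrightarrow> A j = {\<omega>\<in>space M. X j \<omega> = k j}" by blast
      have "(\<Inter>j\<in>J. A j) = {\<omega>\<in>space M. \<forall>j\<in>J. X j \<omega> = k j}"
        using J(1) k by auto
      then show ?thesis using joint[OF J(3,2), of k] k by (simp cong: prod.cong)
    qed
  qed (use ev in auto)
  then have "indep_sets (\<lambda>i. sigma_sets (space M) (?S i)) I"
  proof (rule indep_sets_sigma)
    fix i show "Int_stable (?S i)"
    proof (rule Int_stableI)
      fix A B assume "A \<in> ?S i" "B \<in> ?S i"
      then have "A \<inter> B = {} \<or> A \<inter> B = A" by (elim insertE imageE) auto
      then show "A \<inter> B \<in> ?S i" using \<open>A \<in> ?S i\<close> by auto
    qed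
  qed
  then have "indep_sets (\<lambda>i. {X i -` A \<inter> space M |A. A \<in> sets (count_space UNIV)}) I"
  proof (rule indep_sets_mono_sets)
    fix i assume i: "i \<in> I"
    have "X i -` A \<inter> space M \<in> sigma_sets (space M) (?S i)" for A
    proof -
      interpret S: sigma_algebra "space M" "sigma_sets (space M) (?S i)"
        by (intro sigma_algebra_sigma_sets) auto
      have "X i -` A \<inter> space M = (\<Union>k\<in>A. {\<omega>\<in>space M. X i \<omega> = k})" by auto
      also have "\<dots> \<in> sigma_sets (space M) (?S i)"
        by (intro S.countable_UN') (auto intro: sigma_sets.Basic)
      finally show ?thesis .
    qed
    then show "{X i -` A \<inter> space M |A. A \<in> sets (count_space UNIV)} \<subseteq> sigma_sets (space M) (?S i)"
      by auto
  qed
  then show ?thesis using X by (simp add: indep_vars_def2)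
qed

text \<open>
  The case \<open>r = 0\<close> is included: it is the law of the counts on null sets.
\<close>

lemma poisson_pgf:
  assumes "0 \<le> r"
  shows "(\<Sum>k. pmf (poisson_law r) k * z ^ k) = exp (- ((1 - z) * r))"
proof -
  have "(\<lambda>k. exp (- r) * ((r * z) ^ k /\<^sub>R fact k)) sums (exp (- r) * exp (r * z))"
    by (intro sums_mult exp_converges)
  moreover have "exp (- r) * ((r * z) ^ k /\<^sub>R fact k) = pmf (poisson_law r) k * z ^ k" for k
    using assms by (simp add: pmf_poisson_law power_mult_distrib field_simps)
  ultimately have "(\<lambda>k. pmf (poisson_law r) k * z ^ k) sums (exp (- r) * exp (r * z))"
    by simp
  then show ?thesis
    by (simp add: sums_iff mult_exp_exp algebra_simps)
qed

text \<open>
  Counting distinct values is not a sum of indicators when values may coincide. Instead, \<open>card = k\<close> for a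
  finite set is expressed by a list of \<open>k\<close> active indices with distinct values that exhaust all values;
  there are countably many lists. Infinite sets have cardinality \<open>0\<close>, whence the extra disjunct.
  Arbitrary \<open>act\<close> allows counting by random criteria, and arbitrary \<open>G\<close> allows sub-\<open>\<sigma>\<close>-algebras.
\<close>

lemma measurable_card_points:
  fixes V :: "'i::countable \<Rightarrow> 'w \<Rightarrow> 'e::{second_countable_topology, t2_space}"
  assumes V[measurable]: "\<And>e. V e \<in> borel_measurable G"
    and act[measurable]: "\<And>e. Measurable.pred G (act e)"
  shows "(\<lambda>\<omega>. card {V e \<omega> |e. act e \<omega>}) \<in> measurable G (count_space UNIV)"
proof -
  define lists where "lists k \<omega> \<longleftrightarrow> (\<exists>xs :: 'i list. length xs = k \<and> (\<forall>i<k. act (xs ! i) \<omega>) \<and>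
      (\<forall>i<k. \<forall>j<k. i \<noteq> j \<longrightarrow> V (xs ! i) \<omega> \<noteq> V (xs ! j) \<omega>) \<and>
      (\<forall>e. act e \<omega> \<longrightarrow> (\<exists>i<k. V e \<omega> = V (xs ! i) \<omega>)))" for k \<omega>
  have lists: "lists k \<omega> \<longleftrightarrow> finite {V e \<omega> |e. act e \<omega>} \<and> card {V e \<omega> |e. act e \<omega>} = k" for k \<omega>
  proof
    assume "lists k \<omega>"
    then obtain xs where xs: "length xs = k" "\<forall>i<k. act (xs ! i) \<omega>"
      "\<forall>i<k. \<forall>j<k. i \<noteq> j \<longrightarrow> V (xs ! i) \<omega> \<noteq> V (xs ! j) \<omega>"
      "\<forall>e. act e \<omega> \<longrightarrow> (\<exists>i<k. V e \<omega> = V (xs ! i) \<omega>)"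
      unfolding lists_def by blast
    have "{V e \<omega> |e. act e \<omega>} = (\<lambda>i. V (xs ! i) \<omega>) ` {..<k}"
      using xs by auto
    moreover have "inj_on (\<lambda>i. V (xs ! i) \<omega>) {..<k}"
      using xs(3) by (auto simp: inj_on_def)
    ultimately show "finite {V e \<omega> |e. act e \<omega>} \<and> card {V e \<omega> |e. act e \<omega>} = k"
      by (simp add: card_image)
  next
    assume fin: "finite {V e \<omega> |e. act e \<omega>} \<and> card {V e \<omega> |e. act e \<omega>} = k"
    obtain ys where ys: "set ys = {V e \<omega> |e. act e \<omega>}" "distinct ys"
      using finite_distinct_list[OF fin[THEN conjunct1]] by blast
    have len: "length ys = k"
      using distinct_card[OF ys(2)] fin ys(1) by simp
    have "\<forall>y\<in>set ys. \<exists>e. act e \<omega> \<and> y = V e \<omega>" unfolding ys(1) by blast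
    from bchoice[OF this] obtain f where f: "\<And>y. y \<in> set ys \<Longrightarrow> act (f y) \<omega> \<and> y = V (f y) \<omega>" by blast
    have V: "V (map f ys ! i) \<omega> = ys ! i" "act (map f ys ! i) \<omega>" if "i < k" for i
      using f[of "ys ! i"] that len by simp_all
    show "lists k \<omega>"
      unfolding lists_def
    proof (intro exI[of _ "map f ys"] conjI allI impI)
      show "length (map f ys) = k" using len by simp
      show "act (map f ys ! i) \<omega>" if "i < k" for i by (rule V(2)[OF that])
      show "V (map f ys ! i) \<omega> \<noteq> V (map f ys ! j) \<omega>" if "i < k" "j < k" "i \<noteq> j" for i j
        unfolding V(1)[OF that(1)] V(1)[OF that(2)] using nth_eq_iff_index_eq[OF ys(2)] that len by simp
      fix e assume "act e \<omega>"
      then have "V e \<omega> \<in> set ys" unfolding ys(1) by blast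
      then obtain i where "i < k" "ys ! i = V e \<omega>" unfolding in_set_conv_nth len by blast
      then show "\<exists>i<k. V e \<omega> = V (map f ys ! i) \<omega>"
        using V(1) by (intro exI[of _ i]) simp
    qed
  qed
  have eq: "Measurable.pred G (\<lambda>\<omega>. V e \<omega> = V e' \<omega>)" for e e'
    unfolding pred_def by (rule measurable_equality_set[OF V V])
  have const: "Measurable.pred G (\<lambda>\<omega>. c)" for c
    by simp
  have meas: "Measurable.pred G (lists k)" for k
    unfolding lists_def
    by (intro pred_intros_countable pred_intros_logic(2-5) eq act const)
  show ?thesis
  proof (subst measurable_count_space_eq2_countable, intro conjI ballI)
    fix k
    have "Measurable.pred G (\<lambda>\<omega>. lists k \<omega> \<or> (k = 0 \<and> (\<forall>l. \<not> lists l \<omega>)))"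
      by (intro pred_intros_countable pred_intros_logic(2-5) meas const)
    then have "{\<omega>\<in>space G. lists k \<omega> \<or> (k = 0 \<and> (\<forall>l. \<not> lists l \<omega>))} \<in> sets G"
      by (simp add: pred_def)
    moreover have "{\<omega>\<in>space G. lists k \<omega> \<or> (k = 0 \<and> (\<forall>l. \<not> lists l \<omega>))} =
        (\<lambda>\<omega>. card {V e \<omega> |e. act e \<omega>}) -` {k} \<inter> space G"
      unfolding lists by (auto simp: card_eq_0_iff intro: card_ge_0_finite)
    ultimately show "(\<lambda>\<omega>. card {V e \<omega> |e. act e \<omega>}) -` {k} \<inter> space G \<in> sets G"
      by simp
  qed auto
qed

section \<open>Poisson point processes from independent samples\<close>

text \<open>
  For every \<open>c\<close>, the variable \<open>Y (c, 0)\<close> encodes, through \<open>num\<close>, a Poisson number of points, and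
  \<open>Y (c, 1), Y (c, 2), \<dots>\<close> are candidates for these points, of law \<open>\<nu> c\<close>. Numbers and points share the
  type \<^typ>\<open>'e\<close> so that their independence is one instance of \<open>indep_vars\<close>. The processes for the
  single \<open>c\<close> are superposed, which makes \<open>\<Sum>\<^sub>c \<nu> c\<close> the intensity.
\<close>

locale poisson_sample = prob_space M for M :: "'w measure" +
  fixes Y :: "nat \<times> nat \<Rightarrow> 'w \<Rightarrow> 'e::{second_countable_topology, t2_space}"
    and num :: "'e \<Rightarrow> nat" and \<nu> :: "nat \<Rightarrow> 'e measure" and \<mu> :: "'e measure"
  assumes independent: "indep_vars (\<lambda>_. borel) Y UNIV"
    and measurable_num: "num \<in> measurable borel (count_space UNIV)"
    and number_law: "distr M (count_space UNIV) (\<lambda>\<omega>. num (Y (c, 0) \<omega>)) = measure_pmf (poisson_pmf 1)"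
    and point_law: "distr M borel (Y (c, Suc i)) = \<nu> c"
    and points_distinct: "(c, i) \<noteq> (c', i') \<Longrightarrow> AE \<omega> in M. Y (c, Suc i) \<omega> \<noteq> Y (c', Suc i') \<omega>"
    and intensity: "A \<in> sets \<mu> \<Longrightarrow> A \<in> sets borel"
      "A \<in> sets \<mu> \<Longrightarrow> emeasure \<mu> A = (\<Sum>c. emeasure (\<nu> c) A)"
begin

lemma measurable_Y[measurable]: "Y e \<in> borel_measurable M"
  using independent by (cases e) (simp add: indep_vars_def)

definition points :: "'w \<Rightarrow> 'e set" where
  "points \<omega> = {Y (c, Suc i) \<omega> |c i. i < num (Y (c, 0) \<omega>)} \<inter> space \<mu>"

definition count :: "'e set \<Rightarrow> nat \<Rightarrow> 'w \<Rightarrow> nat" where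
  "count A c \<omega> = card {i. i < num (Y (c, 0) \<omega>) \<and> Y (c, Suc i) \<omega> \<in> A}"

lemma measurable_number[measurable]: "(\<lambda>\<omega>. num (Y (c, 0) \<omega>)) \<in> measurable M (count_space UNIV)"
  by (rule measurable_compose[OF measurable_Y measurable_num])

lemma prob_space_\<nu>: "prob_space (\<nu> c)"
  unfolding point_law[of c 0, symmetric] by (rule prob_space_distr) measurable

lemma sets_\<nu>[simp]: "sets (\<nu> c) = sets borel"
  unfolding point_law[of c 0, symmetric] by simp

lemma space_\<nu>[simp]: "space (\<nu> c) = UNIV"
  unfolding point_law[of c 0, symmetric] by simp

text \<open>
  Conditioning on the number \<open>m\<close> of points leaves a product of \<open>m\<close> independent factors.
\<close>

lemma nn_integral_cell:
  fixes f :: "'e \<Rightarrow> ennreal"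
  assumes f: "f \<in> borel_measurable borel"
  shows "(\<integral>\<^sup>+\<omega>. (\<Prod>i<num (Y (c, 0) \<omega>). f (Y (c, Suc i) \<omega>)) \<partial>M) =
    (\<Sum>m. ennreal (pmf (poisson_pmf 1) m) * (\<integral>\<^sup>+x. f x \<partial>\<nu> c) ^ m)"
proof -
  have [measurable]: "f \<in> borel_measurable borel" by (rule f)
  have summand: "(\<integral>\<^sup>+\<omega>. indicator {m} (num (Y (c, 0) \<omega>)) * (\<Prod>i<m. f (Y (c, Suc i) \<omega>)) \<partial>M) =
      ennreal (pmf (poisson_pmf 1) m) * (\<integral>\<^sup>+x. f x \<partial>\<nu> c) ^ m" for m
  proof -
    \<comment> \<open>index 0 selects the number of points, the later indices weight the points\<close>
    define F where "F i = (case i of 0 \<Rightarrow> (\<lambda>x. indicator {m} (num x)) | Suc i \<Rightarrow> f)" for i :: nat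
    have [measurable]: "(\<lambda>x. indicator {m} (num x) :: ennreal) \<in> borel_measurable borel"
      by (rule measurable_compose[OF measurable_num]) simp
    have F: "F i \<in> borel_measurable borel" for i
      by (cases i) (simp_all add: F_def)
    have point: "(\<integral>\<^sup>+\<omega>. f (Y (c, Suc i) \<omega>) \<partial>M) = (\<integral>\<^sup>+x. f x \<partial>\<nu> c)" for i
      unfolding point_law[of c i, symmetric] by (intro nn_integral_distr[symmetric]) measurable
    have ind: "indep_vars (\<lambda>_. borel) (\<lambda>e \<omega>. F (snd e) (Y e \<omega>)) (Pair c ` {..m})"
      by (rule indep_vars_compose2[OF indep_vars_subset[OF independent]]) (simp_all add: F)
    have inj: "inj_on (Pair c) {..m}" by (simp add: inj_on_def)
    have "(\<integral>\<^sup>+\<omega>. indicator {m} (num (Y (c, 0) \<omega>)) * (\<Prod>i<m. f (Y (c, Suc i) \<omega>)) \<partial>M) =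
        (\<integral>\<^sup>+\<omega>. (\<Prod>i\<le>m. F i (Y (c, i) \<omega>)) \<partial>M)"
      by (intro nn_integral_cong) (simp add: F_def prod.atMost_shift)
    also have "\<dots> = (\<integral>\<^sup>+\<omega>. (\<Prod>e\<in>Pair c ` {..m}. F (snd e) (Y e \<omega>)) \<partial>M)"
      by (simp add: prod.reindex[OF inj])
    also have "\<dots> = (\<Prod>e\<in>Pair c ` {..m}. \<integral>\<^sup>+\<omega>. F (snd e) (Y e \<omega>) \<partial>M)"
      by (rule indep_vars_nn_integral[OF _ ind]) auto
    also have "\<dots> = (\<Prod>i\<le>m. \<integral>\<^sup>+\<omega>. F i (Y (c, i) \<omega>) \<partial>M)"
      by (simp add: prod.reindex[OF inj])
    also have "\<dots> = (\<integral>\<^sup>+\<omega>. indicator {m} (num (Y (c, 0) \<omega>)) \<partial>M) * (\<Prod>i<m. \<integral>\<^sup>+\<omega>. f (Y (c, Suc i) \<omega>) \<partial>M)"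
      by (simp add: F_def prod.atMost_shift)
    also have "(\<integral>\<^sup>+\<omega>. indicator {m} (num (Y (c, 0) \<omega>)) \<partial>M) =
        (\<integral>\<^sup>+k. indicator {m} k \<partial>distr M (count_space UNIV) (\<lambda>\<omega>. num (Y (c, 0) \<omega>)))"
      by (intro nn_integral_distr[symmetric]) auto
    also have "\<dots> = ennreal (pmf (poisson_pmf 1) m)"
      unfolding number_law by (simp add: emeasure_pmf_single)
    finally show ?thesis by (simp add: point)
  qed
  have "(\<Prod>i<num (Y (c, 0) \<omega>). f (Y (c, Suc i) \<omega>)) =
      (\<Sum>m. indicator {m} (num (Y (c, 0) \<omega>)) * (\<Prod>i<m. f (Y (c, Suc i) \<omega>)))" for \<omega>
    by (subst suminf_finite[of "{num (Y (c, 0) \<omega>)}"]) auto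
  then have "(\<integral>\<^sup>+\<omega>. (\<Prod>i<num (Y (c, 0) \<omega>). f (Y (c, Suc i) \<omega>)) \<partial>M) =
      (\<Sum>m. \<integral>\<^sup>+\<omega>. indicator {m} (num (Y (c, 0) \<omega>)) * (\<Prod>i<m. f (Y (c, Suc i) \<omega>)) \<partial>M)"
    by (simp, intro nn_integral_suminf borel_measurable_times_ennreal borel_measurable_prod_ennreal)
       (auto intro: measurable_compose[OF measurable_number])
  then show ?thesis unfolding summand .
qed

lemma indep_cells:
  fixes f :: "'e \<Rightarrow> ennreal"
  assumes f: "f \<in> borel_measurable borel"
  shows "indep_vars (\<lambda>_. borel) (\<lambda>c \<omega>. \<Prod>i<num (Y (c, 0) \<omega>). f (Y (c, Suc i) \<omega>)) UNIV"
proof -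
  have *: "indep_vars (\<lambda>c. PiM ({c} \<times> UNIV) (\<lambda>_. borel)) (\<lambda>c \<omega>. restrict (\<lambda>e. Y e \<omega>) ({c} \<times> UNIV)) UNIV"
    by (rule indep_vars_restrict[OF independent]) (auto simp: disjoint_family_on_def)
  have "indep_vars (\<lambda>_. borel) (\<lambda>c \<omega>. \<Prod>i<num (restrict (\<lambda>e. Y e \<omega>) ({c} \<times> UNIV) (c, 0)).
      f (restrict (\<lambda>e. Y e \<omega>) ({c} \<times> UNIV) (c, Suc i))) UNIV"
  proof (rule indep_vars_compose2[OF *, where Y = "\<lambda>c y. \<Prod>i<num (y (c, 0)). f (y (c, Suc i))"])
    fix c
    have comp: "(\<lambda>y. y (c, i)) \<in> measurable (PiM ({c} \<times> UNIV) (\<lambda>_. borel)) borel" for i :: nat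
      by (rule measurable_component_singleton) simp
    show "(\<lambda>y. \<Prod>i<num (y (c, 0)). f (y (c, Suc i))) \<in> borel_measurable (PiM ({c} \<times> UNIV) (\<lambda>_. borel))"
      by (rule measurable_compose_countable[where f = "\<lambda>n y. \<Prod>i<n. f (y (c, Suc i))"])
         (auto intro!: borel_measurable_prod_ennreal measurable_compose[OF comp f] measurable_compose[OF comp measurable_num])
  qed
  then show ?thesis by simp
qed

text \<open>
  On disjoint sets, \<open>\<Prod>\<^sub>j z j ^ count (A j)\<close> is the product over the points of one function \<open>f\<close>,
  with integral \<open>F = 1 - \<Sum>\<^sub>j (1 - z j) \<nu> (A j)\<close>. Its expectation is the generating function of the
  Poisson law of mean \<open>1\<close> at \<open>F\<close>, which is \<open>exp (F - 1)\<close>; it splits into factors for the single \<open>j\<close>,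
  and this is the reason for the independence of the counts.
\<close>

lemma count_pgf:
  assumes C: "finite C" and J: "finite J" and A: "\<And>j. j \<in> J \<Longrightarrow> A j \<in> sets borel" "disjoint_family_on A J"
    and z: "\<And>j. 0 \<le> z j \<and> z j < (1::real)"
  shows "expectation (\<lambda>\<omega>. \<Prod>c\<in>C. \<Prod>j\<in>J. z j ^ count (A j) c \<omega>) =
      (\<Prod>j\<in>J. exp (- ((1 - z j) * (\<Sum>c\<in>C. measure (\<nu> c) (A j)))))"
    and "(\<lambda>\<omega>. \<Prod>c\<in>C. \<Prod>j\<in>J. z j ^ count (A j) c \<omega>) \<in> borel_measurable M"
proof -
  let ?H = "\<lambda>c \<omega>. \<Prod>j\<in>J. z j ^ count (A j) c \<omega>"
  define f where "f x = (\<Prod>j\<in>J. if x \<in> A j then z j else 1)" for x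
  have fm[measurable]: "f \<in> borel_measurable borel"
    unfolding f_def using A(1) by (intro borel_measurable_prod measurable_If_set) auto
  have f01: "0 \<le> f x" "f x \<le> 1" for x
    unfolding f_def using z by (auto intro!: prod_nonneg prod_le_1 simp: less_imp_le)
  have f_eq: "f x = 1 - (\<Sum>j\<in>J. (1 - z j) * indicator (A j) x)" for x
  proof (cases "\<exists>j\<in>J. x \<in> A j")
    case True
    then obtain k where k: "k \<in> J" "x \<in> A k" by blast
    then have "x \<in> A j \<longleftrightarrow> j = k" if "j \<in> J" for j
      using A(2) that by (auto simp: disjoint_family_on_def)
    then have "f x = (\<Prod>j\<in>J. if j = k then z k else 1)"
      "(\<Sum>j\<in>J. (1 - z j) * indicator (A j) x) = (\<Sum>j\<in>J. if j = k then 1 - z k else 0)"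
      unfolding f_def by (auto intro!: prod.cong sum.cong)
    then show ?thesis using J k by (simp add: prod.delta)
  qed (simp add: f_def indicator_def)
  define F where "F c = 1 - (\<Sum>j\<in>J. (1 - z j) * measure (\<nu> c) (A j))" for c
  have int_f: "(\<integral>\<^sup>+x. ennreal (f x) \<partial>\<nu> c) = ennreal (F c)" "0 \<le> F c" for c
  proof -
    interpret \<nu>: prob_space "\<nu> c" by (rule prob_space_\<nu>)
    have "f \<in> borel_measurable (\<nu> c)"
      using fm by (simp cong: measurable_cong_sets)
    then have "integrable (\<nu> c) f"
      using f01 by (intro \<nu>.integrable_const_bound[of _ 1]) auto
    then have "(\<integral>\<^sup>+x. ennreal (f x) \<partial>\<nu> c) = ennreal (\<integral>x. f x \<partial>\<nu> c)"
      using f01 by (intro nn_integral_eq_integral) auto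
    moreover have "(\<integral>x. f x \<partial>\<nu> c) = F c"
    proof -
      have ind: "integrable (\<nu> c) (\<lambda>x. (1 - z j) * indicator (A j) x)" if "j \<in> J" for j
        using A(1)[OF that] by (intro integrable_mult_right) (simp add: less_top[symmetric])
      have "(\<integral>x. f x \<partial>\<nu> c) = (\<integral>x. 1 \<partial>\<nu> c) - (\<integral>x. (\<Sum>j\<in>J. (1 - z j) * indicator (A j) x) \<partial>\<nu> c)"
        unfolding f_eq using ind by (intro Bochner_Integration.integral_diff) auto
      also have "(\<integral>x. (\<Sum>j\<in>J. (1 - z j) * indicator (A j) x) \<partial>\<nu> c) =
          (\<Sum>j\<in>J. (1 - z j) * measure (\<nu> c) (A j))"
        using ind by (subst Bochner_Integration.integral_sum) auto
      finally show ?thesis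
        using \<nu>.prob_space by (simp add: F_def)
    qed
    moreover have "0 \<le> (\<integral>x. f x \<partial>\<nu> c)"
      using f01 by simp
    ultimately show "(\<integral>\<^sup>+x. ennreal (f x) \<partial>\<nu> c) = ennreal (F c)" "0 \<le> F c" by simp_all
  qed
  have cell: "ennreal (?H c \<omega>) = (\<Prod>i<num (Y (c, 0) \<omega>). ennreal (f (Y (c, Suc i) \<omega>)))" for c \<omega>
  proof -
    have "(\<Prod>i<num (Y (c, 0) \<omega>). f (Y (c, Suc i) \<omega>)) =
        (\<Prod>j\<in>J. \<Prod>i<num (Y (c, 0) \<omega>). if Y (c, Suc i) \<omega> \<in> A j then z j else 1)"
      unfolding f_def by (rule prod.swap)
    also have "\<dots> = (?H c \<omega>)"
      by (intro prod.cong refl) (simp add: prod.If_cases count_def Int_def lessThan_def)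
    finally show ?thesis using f01 by (simp add: prod_ennreal)
  qed
  have bd: "0 \<le> (?H c \<omega>)" "(?H c \<omega>) \<le> 1" for c \<omega>
    using z by (auto intro!: prod_nonneg prod_le_1 power_le_one simp: less_imp_le)
  have bd2: "0 \<le> (\<Prod>c\<in>C. ?H c \<omega>)"
    "(\<Prod>c\<in>C. ?H c \<omega>) \<le> 1" for \<omega>
    by (rule prod_nonneg, rule bd) (rule prod_le_1, intro conjI bd)
  have ef: "(\<lambda>x. ennreal (f x)) \<in> borel_measurable borel" by measurable
  note ind = indep_cells[OF ef]
  have mc: "(\<lambda>\<omega>. ?H c \<omega>) \<in> borel_measurable M" for c
  proof -
    have "(\<lambda>\<omega>. ennreal (?H c \<omega>)) \<in> borel_measurable M"
      unfolding cell using ind by (simp add: indep_vars_def)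
    from borel_measurable_enn2real[OF this] show ?thesis
      using bd by simp
  qed
  show meas: "(\<lambda>\<omega>. \<Prod>c\<in>C. ?H c \<omega>) \<in> borel_measurable M"
    by (intro borel_measurable_prod mc)
  have one: "(\<integral>\<^sup>+\<omega>. ennreal (?H c \<omega>) \<partial>M) = ennreal (exp (F c - 1))" for c
  proof -
    have "(\<integral>\<^sup>+\<omega>. ennreal (?H c \<omega>) \<partial>M) =
        (\<Sum>m. ennreal (pmf (poisson_pmf 1) m) * ennreal (F c) ^ m)"
      unfolding cell nn_integral_cell[OF ef] int_f(1) ..
    also have "\<dots> = (\<Sum>m. ennreal (pmf (poisson_law 1) m * F c ^ m))"
    proof -
      have "poisson_pmf 1 = poisson_law 1" by (simp add: poisson_law_def)
      then show ?thesis
        using int_f(2) by (simp only: ennreal_mult pmf_nonneg zero_le_power ennreal_power)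
    qed
    also have "\<dots> = ennreal (\<Sum>m. pmf (poisson_law 1) m * F c ^ m)"
    proof (rule suminf_ennreal2)
      have "summable (\<lambda>m. exp (- 1) * (F c ^ m /\<^sub>R fact m))"
        by (intro summable_mult summable_exp_generic)
      then show "summable (\<lambda>m. pmf (poisson_law 1) m * F c ^ m)"
        by (simp add: pmf_poisson_law field_simps)
    qed (use int_f(2) in auto)
    also have "\<dots> = ennreal (exp (F c - 1))"
      by (subst poisson_pgf) simp_all
    finally show ?thesis .
  qed
  have nn: "0 \<le> expectation (\<lambda>\<omega>. \<Prod>c\<in>C. ?H c \<omega>)"
    "0 \<le> (\<Prod>c\<in>C. exp (F c - 1))"
    by (rule Bochner_Integration.integral_nonneg, rule bd2) (simp add: prod_nonneg)
  have "ennreal (expectation (\<lambda>\<omega>. \<Prod>c\<in>C. ?H c \<omega>)) =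
      (\<integral>\<^sup>+\<omega>. ennreal (\<Prod>c\<in>C. ?H c \<omega>) \<partial>M)"
    using meas bd2 by (intro nn_integral_eq_integral[symmetric] integrable_const_bound[of _ 1] AE_I2)
      (simp_all only: real_norm_def abs_of_nonneg)
  also have "\<dots> = (\<integral>\<^sup>+\<omega>. (\<Prod>c\<in>C. ennreal (?H c \<omega>)) \<partial>M)"
    using bd by (simp add: prod_ennreal)
  also have "\<dots> = (\<Prod>c\<in>C. \<integral>\<^sup>+\<omega>. ennreal (?H c \<omega>) \<partial>M)"
    unfolding cell by (rule indep_vars_nn_integral[OF C indep_vars_subset[OF ind]]) auto
  also have "\<dots> = ennreal (\<Prod>c\<in>C. exp (F c - 1))"
    unfolding one by (rule prod_ennreal) simp
  finally have "expectation (\<lambda>\<omega>. \<Prod>c\<in>C. ?H c \<omega>) = (\<Prod>c\<in>C. exp (F c - 1))"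
    using nn by (simp only: ennreal_inj)
  also have "\<dots> = exp (\<Sum>c\<in>C. \<Sum>j\<in>J. - ((1 - z j) * measure (\<nu> c) (A j)))"
  proof -
    have "F c - 1 = (\<Sum>j\<in>J. - ((1 - z j) * measure (\<nu> c) (A j)))" for c
      by (simp add: F_def sum_negf)
    then show ?thesis
      using exp_sum[OF C, of "\<lambda>c. F c - 1"] by simp
  qed
  also have "(\<Sum>c\<in>C. \<Sum>j\<in>J. - ((1 - z j) * measure (\<nu> c) (A j))) =
      (\<Sum>j\<in>J. - ((1 - z j) * (\<Sum>c\<in>C. measure (\<nu> c) (A j))))"
    by (subst sum.swap) (simp add: sum_distrib_left sum_negf)
  also have "exp \<dots> = (\<Prod>j\<in>J. exp (- ((1 - z j) * (\<Sum>c\<in>C. measure (\<nu> c) (A j)))))"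
    using J by (rule exp_sum)
  finally show "expectation (\<lambda>\<omega>. \<Prod>c\<in>C. ?H c \<omega>) =
      (\<Prod>j\<in>J. exp (- ((1 - z j) * (\<Sum>c\<in>C. measure (\<nu> c) (A j)))))" .
qed

text \<open>
  The generating function at \<open>z = 0\<close> bounds the probability of a point of the \<open>c\<close>-th sample in \<open>A\<close> by
  \<open>\<nu> c A\<close>; these are summable, and the Borel--Cantelli lemma applies.
\<close>

lemma count_eventually_0:
  assumes A: "A \<in> sets \<mu>" "emeasure \<mu> A < \<infinity>"
  shows "AE \<omega> in M. \<forall>\<^sub>F c in sequentially. count A c \<omega> = 0"
    and "(\<lambda>c. measure (\<nu> c) A) sums measure \<mu> A"
proof -
  interpret \<nu>: prob_space "\<nu> c" for c by (rule prob_space_\<nu>)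
  have "(\<lambda>c. ennreal (measure (\<nu> c) A)) sums emeasure \<mu> A"
    unfolding \<nu>.emeasure_eq_measure[symmetric] intensity(2)[OF A(1)] by (rule summable_sums) simp
  also have "emeasure \<mu> A = ennreal (measure \<mu> A)"
    using A(2) by (intro emeasure_eq_ennreal_measure) auto
  finally show sums: "(\<lambda>c. measure (\<nu> c) A) sums measure \<mu> A"
    by (subst (asm) sums_ennreal) auto
  let ?g = "\<lambda>c \<omega>. \<Prod>c'\<in>{c}. \<Prod>j\<in>{()}. (0::real) ^ count A c' \<omega>"
  have g: "expectation (?g c) = exp (- measure (\<nu> c) A)" "?g c \<in> borel_measurable M" for c
    using count_pgf[of "{c}" "{()}" "\<lambda>_. A" "\<lambda>_. 0"] intensity(1)[OF A(1)]
    by (simp_all add: disjoint_family_on_def)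
  have gb: "?g c \<omega> = of_bool (count A c \<omega> = 0)" for c \<omega> by (simp add: power_0_left)
  have ev: "{\<omega>\<in>space M. count A c \<omega> \<noteq> 0} \<in> events" for c
  proof -
    have "{\<omega>\<in>space M. ?g c \<omega> \<noteq> 1} \<in> events"
      using g(2) by (rule measurable_sets_Collect[where P = "\<lambda>x. x \<noteq> 1"]) simp
    then show ?thesis unfolding gb by simp
  qed
  have prob: "prob {\<omega>\<in>space M. count A c \<omega> \<noteq> 0} \<le> measure (\<nu> c) A" for c
  proof -
    have "expectation (?g c) = expectation (\<lambda>\<omega>. 1 - indicator {\<omega>\<in>space M. count A c \<omega> \<noteq> 0} \<omega>)"
      unfolding gb by (intro Bochner_Integration.integral_cong) (auto simp: indicator_def)
    also have "\<dots> = 1 - prob {\<omega>\<in>space M. count A c \<omega> \<noteq> 0}"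
      using ev[of c] by (subst Bochner_Integration.integral_diff)
        (auto simp: prob_space Int_absorb2 subset_eq less_top[symmetric])
    finally show ?thesis
      unfolding g(1) using exp_ge_add_one_self[of "- measure (\<nu> c) A"] by linarith
  qed
  have "AE \<omega> in M. \<forall>\<^sub>F c in sequentially. \<omega> \<in> space M - {\<omega>\<in>space M. count A c \<omega> \<noteq> 0}"
  proof (rule borel_cantelli_AE1)
    show "summable (\<lambda>c. prob {\<omega>\<in>space M. count A c \<omega> \<noteq> 0})"
      by (rule summable_comparison_test'[OF sums_summable[OF sums], of 0]) (use prob in auto)
  qed (use ev in \<open>auto simp: less_top[symmetric]\<close>)
  then show "AE \<omega> in M. \<forall>\<^sub>F c in sequentially. count A c \<omega> = 0"
    by eventually_elim (auto elim: eventually_mono)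
qed

lemma points_Int:
  assumes "A \<subseteq> space \<mu>"
  shows "points \<omega> \<inter> A = {Y (fst e, Suc (snd e)) \<omega> |e.
      snd e < num (Y (fst e, 0) \<omega>) \<and> Y (fst e, Suc (snd e)) \<omega> \<in> A}"
  using assms by (auto simp: points_def)

text \<open>
  As the candidates are almost surely distinct, the set of points loses nothing compared to the sum of
  the counts of the samples, and almost surely only finitely many samples contribute.
\<close>

lemma points_count:
  assumes A: "A \<in> sets \<mu>" "emeasure \<mu> A < \<infinity>"
  shows "AE \<omega> in M. finite (points \<omega> \<inter> A) \<and>
    (\<forall>\<^sub>F n in sequentially. card (points \<omega> \<inter> A) = (\<Sum>c<n. count A c \<omega>))"
proof -
  have "AE \<omega> in M. \<forall>c i c' i'. (c, i) \<noteq> (c', i') \<longrightarrow> Y (c, Suc i) \<omega> \<noteq> Y (c', Suc i') \<omega>"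
    unfolding AE_all_countable using points_distinct by (intro allI AE_impI)
  then show ?thesis
    using count_eventually_0(1)[OF A]
  proof eventually_elim
    case (elim \<omega>)
    let ?I = "\<lambda>c. {i. i < num (Y (c, 0) \<omega>) \<and> Y (c, Suc i) \<omega> \<in> A}"
    have fin: "finite (?I c)" for c by simp
    from elim(2) obtain n0 where n0: "count A c \<omega> = 0" if "n0 \<le> c" for c
      by (auto simp: eventually_sequentially)
    then have empty: "?I c = {}" if "n0 \<le> c" for c
      using n0[OF that] fin[of c] unfolding count_def by (simp only: card_0_eq)
    have eq: "points \<omega> \<inter> A = (\<lambda>(c, i). Y (c, Suc i) \<omega>) ` (SIGMA c:{..<n}. ?I c)" if "n0 \<le> n" for n
    proof -
      have "c < n" if "i < num (Y (c, 0) \<omega>)" "Y (c, Suc i) \<omega> \<in> A" for c i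
        using empty[of c] that \<open>n0 \<le> n\<close> by (cases "n0 \<le> c") auto
      then show ?thesis
        using sets.sets_into_space[OF A(1)] by (subst points_Int) (auto simp: image_iff)
    qed
    have inj: "inj_on (\<lambda>(c, i). Y (c, Suc i) \<omega>) S" for S
      using elim(1) by (force simp: inj_on_def)
    have "card (points \<omega> \<inter> A) = (\<Sum>c<n. count A c \<omega>)" if "n0 \<le> n" for n
      unfolding eq[OF that] by (simp add: card_image[OF inj] count_def)
    moreover have "finite (points \<omega> \<inter> A)"
      unfolding eq[OF order_refl] by (intro finite_imageI finite_SigmaI fin) simp
    ultimately show ?case by (auto simp: eventually_sequentially)
  qed
qed

lemma measurable_card_points_Int:
  assumes Y: "\<And>e. Y e \<in> borel_measurable G" and A: "A \<in> sets \<mu>"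
  shows "(\<lambda>\<omega>. card (points \<omega> \<inter> A)) \<in> measurable G (count_space UNIV)"
  unfolding points_Int[OF sets.sets_into_space[OF A]]
proof (rule measurable_card_points)
  have [measurable]: "Y e \<in> borel_measurable G" for e by (rule Y)
  show "Y (fst e, Suc (snd e)) \<in> borel_measurable G" for e by (rule Y)
  fix e :: "nat \<times> nat"
  have [measurable]: "(\<lambda>\<omega>. num (Y (fst e, 0) \<omega>)) \<in> measurable G (count_space UNIV)"
    by (rule measurable_compose[OF Y measurable_num])
  have [measurable]: "A \<in> sets borel" by (rule intensity(1)[OF A])
  show "Measurable.pred G (\<lambda>\<omega>. snd e < num (Y (fst e, 0) \<omega>) \<and> Y (fst e, Suc (snd e)) \<omega> \<in> A)"
    by measurable
qed

lemma joint_count_law: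
  fixes A :: "'i \<Rightarrow> 'e set"
  assumes J: "finite J" and A: "\<And>j. j \<in> J \<Longrightarrow> A j \<in> sets \<mu> \<and> emeasure \<mu> (A j) < \<infinity>"
    and disj: "disjoint_family_on A J"
  shows "prob {\<omega>\<in>space M. \<forall>j\<in>J. card (points \<omega> \<inter> A j) = k j} =
    (\<Prod>j\<in>J. pmf (poisson_law (measure \<mu> (A j))) (k j))"
proof (rule pgf_determines_joint_law[OF J])
  show meas: "(\<lambda>\<omega>. card (points \<omega> \<inter> A j)) \<in> measurable M (count_space UNIV)" if "j \<in> J" for j
    using A[OF that] by (intro measurable_card_points_Int measurable_Y) auto
  fix z :: "'i \<Rightarrow> real" assume z: "\<And>j. 0 \<le> z j \<and> z j < 1"
  let ?G = "\<lambda>n \<omega>. \<Prod>c<n. \<Prod>j\<in>J. z j ^ count (A j) c \<omega>"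
  have pgf: "expectation (?G n) = (\<Prod>j\<in>J. exp (- ((1 - z j) * (\<Sum>c<n. measure (\<nu> c) (A j)))))"
    "?G n \<in> borel_measurable M" for n
    using count_pgf[of "{..<n}" J A z] J A intensity(1) disj z by auto
  have "AE \<omega> in M. \<forall>j\<in>J. \<forall>\<^sub>F n in sequentially. card (points \<omega> \<inter> A j) = (\<Sum>c<n. count (A j) c \<omega>)"
    using J
  proof (rule AE_finite_allI)
    fix j assume "j \<in> J"
    then show "AE \<omega> in M. \<forall>\<^sub>F n in sequentially. card (points \<omega> \<inter> A j) = (\<Sum>c<n. count (A j) c \<omega>)"
      using points_count[of "A j"] A by auto
  qed
  then have conv: "AE \<omega> in M. (\<lambda>n. ?G n \<omega>) \<longlonglongrightarrow> (\<Prod>j\<in>J. z j ^ card (points \<omega> \<inter> A j))"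
  proof eventually_elim
    case (elim \<omega>)
    then have "\<forall>\<^sub>F n in sequentially. \<forall>j\<in>J. card (points \<omega> \<inter> A j) = (\<Sum>c<n. count (A j) c \<omega>)"
      using J by (simp add: eventually_ball_finite_distrib)
    then show ?case
    proof (intro tendsto_eventually, eventually_elim)
      case (elim n)
      then show ?case
        by (subst prod.swap) (simp add: power_sum)
    qed
  qed
  have "(\<lambda>n. expectation (?G n)) \<longlonglongrightarrow> expectation (\<lambda>\<omega>. \<Prod>j\<in>J. z j ^ card (points \<omega> \<inter> A j))"
  proof (rule integral_dominated_convergence[where w = "\<lambda>_. 1"])
    show "(\<lambda>\<omega>. \<Prod>j\<in>J. z j ^ card (points \<omega> \<inter> A j)) \<in> borel_measurable M"
      using meas by (intro borel_measurable_prod) (auto intro: measurable_compose)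
    show "AE \<omega> in M. norm (?G n \<omega>) \<le> 1" for n
      using z by (auto simp: abs_prod power_abs intro!: prod_le_1 power_le_one prod_nonneg simp: less_imp_le)
  qed (use pgf conv in auto)
  moreover have "(\<lambda>n. expectation (?G n)) \<longlonglongrightarrow> (\<Prod>j\<in>J. exp (- ((1 - z j) * measure \<mu> (A j))))"
    unfolding pgf(1) using count_eventually_0(2) A
    by (intro tendsto_intros) (auto simp: sums_def)
  ultimately show "expectation (\<lambda>\<omega>. \<Prod>j\<in>J. z j ^ card (points \<omega> \<inter> A j)) =
      (\<Prod>j\<in>J. \<Sum>k. pmf (poisson_law (measure \<mu> (A j))) k * z j ^ k)"
    by (simp add: poisson_pgf LIMSEQ_unique)
qed

text \<open>
  The joint law of the counts on disjoint sets is a product of Poisson laws; this contains both the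
  Poisson laws of single counts and their independence.
\<close>

theorem poisson_point_process_points: "poisson_point_process M \<mu> points"
  unfolding poisson_point_process_def
proof (intro conjI ballI allI impI)
  show "prob_space M" by (rule prob_space_axioms)
  show "points \<omega> \<subseteq> space \<mu>" for \<omega> by (auto simp: points_def)
next
  fix A assume A: "A \<in> sets \<mu>" "emeasure \<mu> A < \<infinity>"
  show "AE \<omega> in M. finite (points \<omega> \<inter> A)"
    using points_count[OF A] by eventually_elim simp
  show meas: "(\<lambda>\<omega>. card (points \<omega> \<inter> A)) \<in> measurable M (count_space UNIV)"
    by (rule measurable_card_points_Int[OF measurable_Y A(1)])
  show "distr M (count_space UNIV) (\<lambda>\<omega>. card (points \<omega> \<inter> A)) = measure_pmf (poisson_law (measure \<mu> A))"
  proof (rule measure_eqI_countable[of _ UNIV])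
    fix k
    have "prob {\<omega>\<in>space M. card (points \<omega> \<inter> A) = k} = pmf (poisson_law (measure \<mu> A)) k"
      using joint_count_law[of "{()}" "\<lambda>_. A" "\<lambda>_. k"] A by (simp add: disjoint_family_on_def)
    then show "emeasure (distr M (count_space UNIV) (\<lambda>\<omega>. card (points \<omega> \<inter> A))) {k} =
        emeasure (measure_pmf (poisson_law (measure \<mu> A))) {k}"
      using meas by (subst emeasure_distr) (simp_all add: emeasure_eq_measure emeasure_pmf_single vimage_def Int_def conj_commute)
  qed auto
next
  fix A :: "nat \<Rightarrow> 'e set" and n
  assume A: "(\<forall>i<n. A i \<in> sets \<mu> \<and> emeasure \<mu> (A i) < \<infinity>) \<and> disjoint_family_on A {..<n}"
  show "indep_vars (\<lambda>_. count_space UNIV) (\<lambda>i \<omega>. card (points \<omega> \<inter> A i)) {..<n}"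
  proof (rule indep_vars_nat_valued)
    show "(\<lambda>\<omega>. card (points \<omega> \<inter> A i)) \<in> measurable M (count_space UNIV)" if "i \<in> {..<n}" for i
      using A that by (intro measurable_card_points_Int measurable_Y) auto
    fix J k assume J: "finite J" "J \<subseteq> {..<n}"
    have disj: "disjoint_family_on A J" and fin: "\<And>j. j \<in> J \<Longrightarrow> A j \<in> sets \<mu> \<and> emeasure \<mu> (A j) < \<infinity>"
      using A J disjoint_family_on_mono[OF J(2)] by auto
    have "prob {\<omega>\<in>space M. card (points \<omega> \<inter> A j) = k j} = pmf (poisson_law (measure \<mu> (A j))) (k j)" if "j \<in> J" for j
      using joint_count_law[of "{j}" A k] fin[OF that] by (simp add: disjoint_family_on_def)
    moreover have "prob {\<omega>\<in>space M. \<forall>j\<in>J. card (points \<omega> \<inter> A j) = k j} =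
        (\<Prod>j\<in>J. pmf (poisson_law (measure \<mu> (A j))) (k j))"
      by (rule joint_count_law) (use J fin disj in auto)
    ultimately show "prob {\<omega>\<in>space M. \<forall>j\<in>J. card (points \<omega> \<inter> A j) = k j} =
        (\<Prod>j\<in>J. prob {\<omega>\<in>space M. card (points \<omega> \<inter> A j) = k j})"
      by simp
  qed
qed

end

section \<open>The solution for given driving points\<close>

text \<open>
  The customers present at time \<open>t\<close>: those who arrived since the last reset, and the initial ones if there
  was none. An arrival at the very time of a reset is kept, as in the equation, where the reset removes
  \<open>x (t-)\<close> customers.
\<close>

definition reset_path :: "real \<Rightarrow> nat \<Rightarrow> (real \<times> real) set \<Rightarrow> real set \<Rightarrow> real \<Rightarrow> nat" where
  "reset_path \<beta> l S R t =
     card {(s, u) \<in> S. 0 < s \<and> s \<le> t \<and> 0 \<le> u \<and> u \<le> \<beta> \<and> R \<inter> {s<..t} = {}} +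
     (if R \<inter> {0<..t} = {} then l else 0)"

text \<open>
  The left limit of \<^const>\<open>reset_path\<close>.
\<close>

definition reset_path_before :: "real \<Rightarrow> nat \<Rightarrow> (real \<times> real) set \<Rightarrow> real set \<Rightarrow> real \<Rightarrow> nat" where
  "reset_path_before \<beta> l S R t =
     card {(s, u) \<in> S. 0 < s \<and> s < t \<and> 0 \<le> u \<and> u \<le> \<beta> \<and> R \<inter> {s<..<t} = {}} +
     (if R \<inter> {0<..<t} = {} then l else 0)"

lemma finite_gap_left:
  fixes F :: "real set"
  assumes "finite F" "0 < t"
  obtains a where "0 \<le> a" "a < t" "F \<inter> {a<..<t} = {}"
proof
  let ?G = "insert 0 {f \<in> F. 0 \<le> f \<and> f < t}"
  have fin: "finite ?G" using assms by simp
  have "Max ?G \<in> ?G" using fin by (intro Max_in) auto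
  then show "0 \<le> Max ?G" "Max ?G < t" using assms(2) by auto
  show "F \<inter> {Max ?G<..<t} = {}"
  proof (rule equals0I)
    fix x assume x: "x \<in> F \<inter> {Max ?G<..<t}"
    then have "x \<in> ?G" using \<open>0 \<le> Max ?G\<close> by auto
    then have "x \<le> Max ?G" using fin by (intro Max_ge)
    then show False using x by auto
  qed
qed

lemma finite_gap_right:
  fixes F :: "real set"
  assumes "finite F"
  obtains b where "t < b" "b \<le> t + 1" "F \<inter> {t<..<b} = {}"
proof
  let ?G = "insert (t + 1) {f \<in> F. t < f \<and> f \<le> t + 1}"
  have fin: "finite ?G" using assms by simp
  have "Min ?G \<in> ?G" using fin by (intro Min_in) auto
  then show "t < Min ?G" "Min ?G \<le> t + 1" by auto
  show "F \<inter> {t<..<Min ?G} = {}"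
  proof (rule equals0I)
    fix x assume x: "x \<in> F \<inter> {t<..<Min ?G}"
    then have "x \<in> ?G" using \<open>Min ?G \<le> t + 1\<close> by auto
    then have "Min ?G \<le> x" using fin by (intro Min_le)
    then show False using x by auto
  qed
qed

locale reset_points =
  fixes \<beta> :: real and l :: nat and S :: "(real \<times> real) set" and R :: "real set"
  assumes finite_arrivals: "finite (S \<inter> ({0<..t} \<times> {0..\<beta>}))"
    and finite_resets: "finite (R \<inter> {0<..t})"
begin

lemma reset_path_0: "reset_path \<beta> l S R 0 = l"
proof -
  have "{(s, u) \<in> S. 0 < s \<and> s \<le> 0 \<and> 0 \<le> u \<and> u \<le> \<beta> \<and> R \<inter> {s<..0} = {}} = {}" by auto
  then show ?thesis by (simp only: reset_path_def) simp
qed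

definition event_times :: "real \<Rightarrow> real set" where
  "event_times t = fst ` (S \<inter> ({0<..t} \<times> {0..\<beta>})) \<union> R \<inter> {0<..t}"

lemma finite_event_times: "finite (event_times t)"
  unfolding event_times_def using finite_arrivals finite_resets by blast

lemma reset_path_eq_before:
  assumes "0 < t"
  obtains a where "0 \<le> a" "a < t" "\<And>q. a < q \<Longrightarrow> q < t \<Longrightarrow> reset_path \<beta> l S R q = reset_path_before \<beta> l S R t"
proof -
  obtain a where a: "0 \<le> a" "a < t" "event_times t \<inter> {a<..<t} = {}"
    using finite_gap_left[OF finite_event_times assms] .
  have arr: "s \<le> a" if "(s, u) \<in> S" "0 < s" "s < t" "0 \<le> u" "u \<le> \<beta>" for s u
  proof (rule ccontr)
    assume "\<not> s \<le> a"
    moreover have "s \<in> event_times t"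
      unfolding event_times_def using that by (auto intro!: image_eqI[of _ _ "(s, u)"])
    ultimately show False using a(3) that by auto
  qed
  have res: "r \<le> a" if "r \<in> R" "0 < r" "r < t" for r
  proof (rule ccontr)
    assume "\<not> r \<le> a"
    moreover have "r \<in> event_times t" unfolding event_times_def using that by auto
    ultimately show False using a(3) that by auto
  qed
  have "reset_path \<beta> l S R q = reset_path_before \<beta> l S R t" if q: "a < q" "q < t" for q
  proof -
    have R: "R \<inter> {s<..q} = R \<inter> {s<..<t}" if "0 \<le> s" for s
    proof (intro equalityI subsetI)
      fix x assume x: "x \<in> R \<inter> {s<..<t}"
      then have "x \<le> a" using res[of x] that by auto
      then show "x \<in> R \<inter> {s<..q}" using x q by auto
    qed (use q in auto)
    have A: "s \<le> q \<longleftrightarrow> s < t" if "(s, u) \<in> S" "0 < s" "0 \<le> u" "u \<le> \<beta>" for s u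
    proof
      assume "s < t"
      then have "s \<le> a" by (rule arr[OF that(1,2) _ that(3,4)])
      then show "s \<le> q" using q by simp
    qed (use q in simp)
    have key: "((s, u) \<in> S \<and> 0 < s \<and> s \<le> q \<and> 0 \<le> u \<and> u \<le> \<beta> \<and> R \<inter> {s<..q} = {}) =
        ((s, u) \<in> S \<and> 0 < s \<and> s < t \<and> 0 \<le> u \<and> u \<le> \<beta> \<and> R \<inter> {s<..<t} = {})" for s u
    proof (cases "(s, u) \<in> S \<and> 0 < s \<and> 0 \<le> u \<and> u \<le> \<beta>")
      case True
      then have "s \<le> q \<longleftrightarrow> s < t" "R \<inter> {s<..q} = R \<inter> {s<..<t}"
        using A R by auto
      then show ?thesis by simp
    qed auto
    have "{(s, u) \<in> S. 0 < s \<and> s \<le> q \<and> 0 \<le> u \<and> u \<le> \<beta> \<and> R \<inter> {s<..q} = {}} =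
        {(s, u) \<in> S. 0 < s \<and> s < t \<and> 0 \<le> u \<and> u \<le> \<beta> \<and> R \<inter> {s<..<t} = {}}"
      by (simp only: key)
    then show ?thesis
      using R[of 0] by (simp add: reset_path_def reset_path_before_def)
  qed
  then show thesis by (rule that[OF a(1,2)])
qed

lemma left_limit_reset_path:
  "0 < t \<Longrightarrow> left_limit (reset_path \<beta> l S R) t = reset_path_before \<beta> l S R t"
  by (rule reset_path_eq_before) (auto intro: left_limit_eqI)

lemma reset_path_right_constant:
  assumes "0 \<le> t"
  obtains b where "t < b" "\<And>q. t \<le> q \<Longrightarrow> q < b \<Longrightarrow> reset_path \<beta> l S R q = reset_path \<beta> l S R t"
proof -
  obtain b where b: "t < b" "b \<le> t + 1" "event_times (t + 1) \<inter> {t<..<b} = {}"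
    using finite_gap_right[OF finite_event_times] .
  have arr: "s \<le> t" if "(s, u) \<in> S" "0 < s" "s < b" "0 \<le> u" "u \<le> \<beta>" for s u
  proof (rule ccontr)
    assume "\<not> s \<le> t"
    moreover have "s \<in> event_times (t + 1)"
      unfolding event_times_def using that b by (auto intro!: image_eqI[of _ _ "(s, u)"])
    ultimately show False using b(3) that by auto
  qed
  have res: "r \<le> t" if "r \<in> R" "0 < r" "r < b" for r
  proof (rule ccontr)
    assume "\<not> r \<le> t"
    moreover have "r \<in> event_times (t + 1)" unfolding event_times_def using that b by auto
    ultimately show False using b(3) that by auto
  qed
  have "reset_path \<beta> l S R q = reset_path \<beta> l S R t" if q: "t \<le> q" "q < b" for q
  proof -
    have R: "R \<inter> {s<..q} = R \<inter> {s<..t}" if "0 \<le> s" for s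
    proof (intro equalityI subsetI)
      fix x assume x: "x \<in> R \<inter> {s<..q}"
      then have "x \<le> t" using res[of x] that q by auto
      then show "x \<in> R \<inter> {s<..t}" using x by auto
    qed (use q in auto)
    have A: "s \<le> q \<longleftrightarrow> s \<le> t" if "(s, u) \<in> S" "0 < s" "0 \<le> u" "u \<le> \<beta>" for s u
    proof
      assume "s \<le> q"
      then have "s < b" using q by simp
      then show "s \<le> t" by (rule arr[OF that(1,2) _ that(3,4)])
    qed (use q in simp)
    have key: "((s, u) \<in> S \<and> 0 < s \<and> s \<le> q \<and> 0 \<le> u \<and> u \<le> \<beta> \<and> R \<inter> {s<..q} = {}) =
        ((s, u) \<in> S \<and> 0 < s \<and> s \<le> t \<and> 0 \<le> u \<and> u \<le> \<beta> \<and> R \<inter> {s<..t} = {})" for s u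
    proof (cases "(s, u) \<in> S \<and> 0 < s \<and> 0 \<le> u \<and> u \<le> \<beta>")
      case True
      then have "s \<le> q \<longleftrightarrow> s \<le> t" "R \<inter> {s<..q} = R \<inter> {s<..t}"
        using A R by auto
      then show ?thesis by simp
    qed auto
    have "{(s, u) \<in> S. 0 < s \<and> s \<le> q \<and> 0 \<le> u \<and> u \<le> \<beta> \<and> R \<inter> {s<..q} = {}} =
        {(s, u) \<in> S. 0 < s \<and> s \<le> t \<and> 0 \<le> u \<and> u \<le> \<beta> \<and> R \<inter> {s<..t} = {}}"
      by (simp only: key)
    then show ?thesis
      using R[of 0] by (simp add: reset_path_def)
  qed
  then show thesis by (rule that[OF b(1)])
qed

lemma cadlag_reset_path: "cadlag (reset_path \<beta> l S R)"
  unfolding cadlag_def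
proof (intro conjI allI impI)
  fix t :: real assume t: "0 \<le> t"
  show "(reset_path \<beta> l S R \<longlongrightarrow> reset_path \<beta> l S R t) (at_right t)"
  proof (rule reset_path_right_constant[OF t])
    fix b
    assume b: "t < b" and eq: "\<And>q. t \<le> q \<Longrightarrow> q < b \<Longrightarrow> reset_path \<beta> l S R q = reset_path \<beta> l S R t"
    have "\<forall>\<^sub>F q in at_right t. reset_path \<beta> l S R q = reset_path \<beta> l S R t"
      unfolding eventually_at_right_field using b
      by (intro exI[of _ b] conjI allI impI) (assumption, rule eq[OF less_imp_le])
    then show ?thesis by (rule tendsto_eventually)
  qed
next
  fix t :: real assume t: "0 < t"
  show "\<exists>y. (reset_path \<beta> l S R \<longlongrightarrow> y) (at_left t)"
  proof (rule reset_path_eq_before[OF t])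
    fix a
    assume a: "a < t" and eq: "\<And>q. a < q \<Longrightarrow> q < t \<Longrightarrow> reset_path \<beta> l S R q = reset_path_before \<beta> l S R t"
    have "\<forall>\<^sub>F q in at_left t. reset_path \<beta> l S R q = reset_path_before \<beta> l S R t"
      unfolding eventually_at_left_field using a
      by (intro exI[of _ a] conjI allI impI) (assumption, rule eq)
    then show ?thesis by (intro exI tendsto_eventually)
  qed
qed

lemma first_reset:
  assumes "0 \<le> s" "R \<inter> {s<..t} \<noteq> {}"
  obtains r where "r \<in> R" "s < r" "r \<le> t" "R \<inter> {s<..<r} = {}"
proof -
  have fin: "finite (R \<inter> {s<..t})"
    using finite_resets[of t] assms(1) by (auto elim!: rev_finite_subset)
  have "Min (R \<inter> {s<..t}) \<in> R \<inter> {s<..t}" by (rule Min_in[OF fin assms(2)])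
  moreover have "R \<inter> {s<..<Min (R \<inter> {s<..t})} = {}"
  proof (rule equals0I)
    fix x assume x: "x \<in> R \<inter> {s<..<Min (R \<inter> {s<..t})}"
    with calculation have "x \<in> R \<inter> {s<..t}" by auto
    then have "Min (R \<inter> {s<..t}) \<le> x" using fin by (intro Min_le)
    with x show False by auto
  qed
  ultimately show thesis by (intro that) auto
qed

text \<open>
  Every customer who is no longer present at time \<open>t\<close> is removed by exactly one reset, the first one after
  the arrival. So the removals sum up to the number of arrivals that are followed by a reset, plus the
  initial customers if there is a reset at all.
\<close>

lemma reset_path_equation:
  assumes "0 \<le> t"
  shows "int (reset_path \<beta> l S R t) = int l + int (card (S \<inter> ({0<..t} \<times> {0..\<beta>}))) -
    (\<Sum>r\<in>R \<inter> {0<..t}. int (left_limit (reset_path \<beta> l S R) r))"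
proof -
  let ?arr = "S \<inter> ({0<..t} \<times> {0..\<beta>})" and ?R = "R \<inter> {0<..t}"
  define alive where "alive = {(s, u) \<in> S. 0 < s \<and> s \<le> t \<and> 0 \<le> u \<and> u \<le> \<beta> \<and> R \<inter> {s<..t} = {}}"
  define dead where "dead = {(s, u) \<in> S. 0 < s \<and> s \<le> t \<and> 0 \<le> u \<and> u \<le> \<beta> \<and> R \<inter> {s<..t} \<noteq> {}}"
  define lost where "lost r = {(s, u) \<in> S. 0 < s \<and> s < r \<and> 0 \<le> u \<and> u \<le> \<beta> \<and> R \<inter> {s<..<r} = {}}" for r
  define w where "w r = (if R \<inter> {0<..<r} = {} then l else 0)" for r
  have arr: "?arr = alive \<union> dead" "alive \<inter> dead = {}"
    unfolding alive_def dead_def by auto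
  have fin: "finite alive" "finite dead"
    using finite_arrivals[of t] unfolding arr(1) by auto
  have dead: "dead = (\<Union>r\<in>?R. lost r)"
  proof (intro equalityI subsetI)
    fix e assume e: "e \<in> dead"
    obtain s u where su: "e = (s, u)" by (cases e)
    have *: "(s, u) \<in> S" "0 < s" "s \<le> t" "0 \<le> u" "u \<le> \<beta>" "R \<inter> {s<..t} \<noteq> {}"
      using e unfolding su dead_def by auto
    obtain r where "r \<in> R" "s < r" "r \<le> t" "R \<inter> {s<..<r} = {}"
      using first_reset[OF less_imp_le[OF *(2)] *(6)] .
    with * show "e \<in> (\<Union>r\<in>?R. lost r)"
      unfolding su lost_def by (intro UN_I[of r]) auto
  next
    fix e assume "e \<in> (\<Union>r\<in>?R. lost r)"
    then obtain r where r: "r \<in> ?R" "e \<in> lost r" by blast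
    obtain s u where su: "e = (s, u)" by (cases e)
    have "(s, u) \<in> S" "0 < s" "s < r" "0 \<le> u" "u \<le> \<beta>"
      using r(2) unfolding su lost_def by auto
    moreover have "r \<in> R \<inter> {s<..t}" using r(1) \<open>s < r\<close> by auto
    ultimately show "e \<in> dead" using r(1) unfolding su dead_def by auto
  qed
  have disj: "lost r \<inter> lost r' = {}" if "r \<in> ?R" "r' \<in> ?R" "r \<noteq> r'" for r r'
  proof (rule equals0I)
    fix e assume e: "e \<in> lost r \<inter> lost r'"
    obtain s u where su: "e = (s, u)" by (cases e)
    have "s < r" "s < r'" "R \<inter> {s<..<r} = {}" "R \<inter> {s<..<r'} = {}"
      using e unfolding su lost_def by auto
    then show False using that by (cases r r' rule: linorder_cases) auto
  qed
  have "card dead = (\<Sum>r\<in>?R. card (lost r))"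
    unfolding dead
  proof (rule card_UN_disjoint)
    show "\<forall>r\<in>?R. finite (lost r)"
    proof
      fix r assume "r \<in> ?R"
      then have "lost r \<subseteq> dead" unfolding dead by blast
      then show "finite (lost r)" using fin(2) by (rule finite_subset)
    qed
  qed (use finite_resets disj in auto)
  moreover have "(\<Sum>r\<in>?R. w r) = (if ?R = {} then 0 else l)"
  proof (cases "?R = {}")
    case False
    obtain r where r: "r \<in> R" "0 < r" "r \<le> t" "R \<inter> {0<..<r} = {}"
      using first_reset[OF order_refl False] .
    have "w q = (if q = r then l else 0)" if "q \<in> ?R" for q
      using r that by (cases q r rule: linorder_cases) (auto simp: w_def)
    then have "(\<Sum>q\<in>?R. w q) = (\<Sum>q\<in>?R. if q = r then l else 0)" by simp
    also have "\<dots> = l" using r finite_resets[of t] by (subst sum.delta) auto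
    finally show ?thesis using False by simp
  qed simp
  moreover have "left_limit (reset_path \<beta> l S R) r = card (lost r) + w r" if "r \<in> ?R" for r
    using that by (simp add: left_limit_reset_path reset_path_before_def lost_def w_def)
  ultimately have "(\<Sum>r\<in>?R. left_limit (reset_path \<beta> l S R) r) = card dead + (if ?R = {} then 0 else l)"
    by (simp add: sum.distrib)
  moreover have "card ?arr = card alive + card dead"
    unfolding arr(1) by (rule card_Un_disjoint[OF fin arr(2)])
  moreover have "reset_path \<beta> l S R t = card alive + (if ?R = {} then l else 0)"
    by (simp add: reset_path_def alive_def)
  ultimately show ?thesis by (simp flip: of_nat_sum)
qed

end

section \<open>Independent real coordinates\<close>

lemma (in poisson_sample) point_process_events_subset:
  assumes G: "space G = space M" "\<And>e. Y e \<in> borel_measurable G"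
  shows "point_process_events M \<mu> points \<subseteq> sets G"
proof -
  have "(\<lambda>\<omega>. card (points \<omega> \<inter> A)) -` {k} \<inter> space M \<in> sets G" if "A \<in> sets \<mu>" for A k
    using measurable_sets[OF measurable_card_points_Int[OF G(2) that], of "{k}"] by (simp add: G(1))
  then have "{(\<lambda>\<omega>. card (points \<omega> \<inter> A)) -` {k} \<inter> space M | A k. A \<in> sets \<mu> \<and> emeasure \<mu> A < \<infinity>} \<subseteq> sets G"
    by blast
  then show ?thesis
    unfolding point_process_events_def G(1)[symmetric] by (rule sets.sigma_sets_subset)
qed

text \<open>
  By Fubini, as the sections of the diagonal are singletons.
\<close>

lemma diagonal_null:
  fixes A B :: "real measure"
  assumes A: "prob_space A" "sets A = sets borel" and B: "prob_space B" "sets B = sets borel"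
    and null: "\<And>x. emeasure B {x} = 0"
  shows "emeasure (A \<Otimes>\<^sub>M B) {p. fst p = snd p} = 0"
proof -
  interpret A: prob_space A by fact
  interpret B: prob_space B by fact
  have "{p \<in> space (A \<Otimes>\<^sub>M B). fst p = snd p} \<in> sets (A \<Otimes>\<^sub>M B)"
    by (rule measurable_equality_set) (use A(2) B(2) in \<open>simp_all cong: measurable_cong_sets\<close>)
  moreover have "space (A \<Otimes>\<^sub>M B) = UNIV"
    using sets_eq_imp_space_eq[OF A(2)] sets_eq_imp_space_eq[OF B(2)] by (simp add: space_pair_measure)
  ultimately have "{p. fst p = snd p} \<in> sets (A \<Otimes>\<^sub>M B)" by simp
  then have "emeasure (A \<Otimes>\<^sub>M B) {p. fst p = snd p} = (\<integral>\<^sup>+x. emeasure B (Pair x -` {p. fst p = snd p}) \<partial>A)"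
    by (rule B.emeasure_pair_measure_alt)
  also have "\<dots> = (\<integral>\<^sup>+x. 0 \<partial>A)"
  proof (rule nn_integral_cong)
    fix x :: real
    have "Pair x -` {p. fst p = snd p} = {x}" by auto
    then show "emeasure B (Pair x -` {p. fst p = snd p}) = 0" by (simp add: null)
  qed
  finally show ?thesis by simp
qed

text \<open>
  The infinite product of laws on the real line. Random variables that use disjoint sets of coordinates
  are independent, whatever they are (\<open>blocks_independent\<close>).
\<close>

locale independent_coordinates =
  fixes D :: "nat \<Rightarrow> real measure"
  assumes prob_D: "prob_space (D n)" and sets_D: "sets (D n) = sets borel"
begin

definition M :: "(nat \<Rightarrow> real) measure" where "M = PiM UNIV D"

sublocale prob_space M
  unfolding M_def by (rule prob_space_PiM[OF prob_D])

lemma sets_M: "sets M = sets (PiM UNIV (\<lambda>_. borel))"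
  unfolding M_def by (rule sets_PiM_cong[OF refl sets_D])

lemma coordinate_measurable[measurable]: "(\<lambda>\<omega>. \<omega> n) \<in> borel_measurable M"
  using measurable_component_singleton[of n UNIV "\<lambda>_. borel"] by (simp cong: measurable_cong_sets add: sets_M)

lemma coordinate_law: "distr M borel (\<lambda>\<omega>. \<omega> n) = D n"
proof -
  interpret D: prob_space "D k" for k by (rule prob_D)
  interpret P: product_prob_space D UNIV ..
  have "distr M borel (\<lambda>\<omega>. \<omega> n) = distr (PiM UNIV D) (D n) (\<lambda>\<omega>. \<omega> n)"
    unfolding M_def by (rule distr_cong) (simp_all add: sets_D)
  also have "\<dots> = D n" by (rule P.PiM_component) simp
  finally show ?thesis .
qed

lemma coordinates_independent: "indep_vars (\<lambda>_. borel) (\<lambda>n \<omega>. \<omega> n) UNIV"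
proof (subst indep_vars_iff_distr_eq_PiM)
  have "distr M (PiM UNIV (\<lambda>_. borel)) (\<lambda>\<omega>. \<lambda>n\<in>UNIV. \<omega> n) = distr M (PiM UNIV (\<lambda>_. borel)) (\<lambda>\<omega>. \<omega>)"
    by (simp add: restrict_def)
  also have "\<dots> = M" by (rule distr_id2) (rule sets_M[symmetric])
  finally have "distr M (PiM UNIV (\<lambda>_. borel)) (\<lambda>\<omega>. \<lambda>n\<in>UNIV. \<omega> n) = M" .
  then show "distr M (PiM UNIV (\<lambda>_. borel)) (\<lambda>\<omega>. \<lambda>n\<in>UNIV. \<omega> n) = PiM UNIV (\<lambda>n. distr M borel (\<lambda>\<omega>. \<omega> n))"
    unfolding coordinate_law M_def[symmetric] by simp
qed auto

lemma coordinate_pair_independent: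
  assumes "m \<noteq> n"
  shows "indep_var borel (\<lambda>\<omega>. \<omega> m) borel (\<lambda>\<omega>. \<omega> n)"
  using indep_var_compose[OF indep_var_restrict[OF coordinates_independent, of "{m}" "{n}"]
      measurable_component_singleton[of m] measurable_component_singleton[of n]] assms
  by (simp add: comp_def)

lemma coordinates_distinct:
  assumes "m \<noteq> n" "\<And>x. emeasure (D n) {x} = 0"
  shows "AE \<omega> in M. \<omega> m \<noteq> \<omega> n"
proof -
  have "indep_var borel (\<lambda>\<omega>. \<omega> m) borel (\<lambda>\<omega>. \<omega> n)"
    by (rule coordinate_pair_independent[OF assms(1)])
  then have joint: "distr M (borel \<Otimes>\<^sub>M borel) (\<lambda>\<omega>. (\<omega> m, \<omega> n)) = D m \<Otimes>\<^sub>M D n"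
    by (simp add: indep_var_distribution_eq coordinate_law)
  have "AE p in D m \<Otimes>\<^sub>M D n. fst p \<noteq> snd p"
  proof (rule AE_I)
    show "emeasure (D m \<Otimes>\<^sub>M D n) {p. fst p = snd p} = 0"
      by (rule diagonal_null[OF prob_D sets_D prob_D sets_D assms(2)])
    have "{p \<in> space (D m \<Otimes>\<^sub>M D n). fst p = snd p} \<in> sets (D m \<Otimes>\<^sub>M D n)"
      by (rule measurable_equality_set) (simp_all add: sets_D cong: measurable_cong_sets)
    moreover have "space (D m \<Otimes>\<^sub>M D n) = UNIV"
      using sets_eq_imp_space_eq[OF sets_D] by (simp add: space_pair_measure)
    ultimately show "{p. fst p = snd p} \<in> sets (D m \<Otimes>\<^sub>M D n)" by simp
  qed auto
  then show ?thesis
    unfolding joint[symmetric] by (subst (asm) AE_distr_iff) auto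
qed

definition block :: "nat set \<Rightarrow> (nat \<Rightarrow> real) measure" where
  "block I = sigma (space M) (\<Union>n\<in>I. {(\<lambda>\<omega>. \<omega> n) -` A \<inter> space M |A. A \<in> sets borel})"

lemma space_block: "space (block I) = space M"
  unfolding block_def by (rule space_measure_of) auto

lemma sets_block: "sets (block I) = sigma_sets (space M) (\<Union>n\<in>I. {(\<lambda>\<omega>. \<omega> n) -` A \<inter> space M |A. A \<in> sets borel})"
  unfolding block_def by (rule sets_measure_of) auto

lemma measurable_block: "n \<in> I \<Longrightarrow> (\<lambda>\<omega>. \<omega> n) \<in> borel_measurable (block I)"
proof (rule measurableI)
  fix A :: "real set" assume "n \<in> I" "A \<in> sets borel"
  then show "(\<lambda>\<omega>. \<omega> n) -` A \<inter> space (block I) \<in> sets (block I)"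
    unfolding space_block sets_block by (intro sigma_sets.Basic) blast
qed simp

lemma sets_block_mono: "I \<subseteq> J \<Longrightarrow> sets (block I) \<subseteq> sets (block J)"
  unfolding sets_block by (rule sigma_sets_mono') blast

lemma blocks_independent:
  assumes disj: "I \<inter> J = {}" and A: "\<A> \<subseteq> sets (block I)" and B: "\<B> \<subseteq> sets (block J)"
  shows "indep_set \<A> \<B>"
proof -
  let ?E = "\<lambda>n. {(\<lambda>\<omega>. \<omega> n) -` A \<inter> space M |A. A \<in> sets borel}"
  have "indep_sets (\<lambda>b. sigma_sets (space M) (\<Union>n\<in>case_bool I J b. ?E n)) UNIV"
  proof (rule indep_sets_collect_sigma)
    have "indep_sets ?E UNIV" using coordinates_independent by (simp add: indep_vars_def2)
    then show "indep_sets ?E (\<Union>b\<in>UNIV. case_bool I J b)" by (rule indep_sets_mono_index[OF subset_UNIV])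
    show "Int_stable (?E n)" for n
    proof (rule Int_stableI)
      fix a b assume "a \<in> ?E n" "b \<in> ?E n"
      then obtain A B where "a = (\<lambda>\<omega>. \<omega> n) -` A \<inter> space M" "A \<in> sets borel"
        "b = (\<lambda>\<omega>. \<omega> n) -` B \<inter> space M" "B \<in> sets borel" by blast
      then show "a \<inter> b \<in> ?E n" by (intro CollectI exI[of _ "A \<inter> B"]) auto
    qed
    show "disjoint_family_on (case_bool I J) UNIV"
      using disj by (auto simp: disjoint_family_on_def split: bool.splits)
  qed
  then show ?thesis
    unfolding indep_set_def by (rule indep_sets_mono_sets) (use A B in \<open>auto simp: sets_block split: bool.splits\<close>)
qed

end

section \<open>A process with prescribed initial law\<close>

lemma emeasure_density_indicator:
  assumes "S \<in> sets M" "A \<in> sets M"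
  shows "emeasure (density M (indicator S)) A = emeasure M (A \<inter> S)"
proof -
  have "emeasure (density M (indicator S)) A = (\<integral>\<^sup>+x. indicator S x * indicator A x \<partial>M)"
    using assms by (intro emeasure_density) auto
  also have "\<dots> = (\<integral>\<^sup>+x. indicator (A \<inter> S) x \<partial>M)"
    by (intro nn_integral_cong) (auto simp: indicator_def)
  finally show ?thesis using assms by simp
qed

lemma disjoint_familyI_eq:
  assumes "\<And>i j x. x \<in> S i \<Longrightarrow> x \<in> S j \<Longrightarrow> i = j"
  shows "disjoint_family S"
  unfolding disjoint_family_on_def
proof (intro ballI impI equals0I)
  fix i j x assume "i \<noteq> j" "x \<in> S i \<inter> S j"
  then show False using assms[of x i j] by simp
qed

lemma emeasure_partition:
  fixes S :: "nat \<Rightarrow> 'a set"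
  assumes S: "\<And>c. S c \<in> sets M" "disjoint_family S" and A: "A \<in> sets M" "A \<subseteq> (\<Union>c. S c)"
  shows "emeasure M A = (\<Sum>c. emeasure (density M (indicator (S c))) A)"
proof -
  have "(\<Sum>c. emeasure (density M (indicator (S c))) A) = (\<Sum>c. emeasure M (A \<inter> S c))"
    by (simp add: emeasure_density_indicator S A)
  also have "\<dots> = emeasure M (\<Union>c. A \<inter> S c)"
    using S A by (intro suminf_emeasure) (auto simp: disjoint_family_on_def)
  also have "(\<Union>c. A \<inter> S c) = A" using A(2) by auto
  finally show ?thesis by simp
qed

definition unit_law :: "real \<Rightarrow> real measure" where
  "unit_law a = density lborel (indicator {a..<a + 1})"

lemma prob_space_unit_law: "prob_space (unit_law a)"
  by (rule prob_spaceI) (simp add: unit_law_def emeasure_density_indicator)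

lemma sets_unit_law: "sets (unit_law a) = sets borel"
  by (simp add: unit_law_def)

lemma unit_law_singleton: "emeasure (unit_law a) {x} = 0"
proof -
  have "emeasure (unit_law a) {x} = emeasure lborel ({x} \<inter> {a..<a + 1})"
    unfolding unit_law_def by (rule emeasure_density_indicator) auto
  also have "\<dots> \<le> emeasure lborel {x}" by (rule emeasure_mono) auto
  finally show ?thesis by simp
qed

lemma unit_law_pair:
  "unit_law a \<Otimes>\<^sub>M unit_law b = density lborel (indicator ({a..<a + 1} \<times> {b..<b + 1}))"
proof -
  have "unit_law a \<Otimes>\<^sub>M unit_law b =
      density (lborel \<Otimes>\<^sub>M lborel) (\<lambda>(x, y). indicator {a..<a + 1} x * indicator {b..<b + 1} y)"
    unfolding unit_law_def
  proof (rule pair_measure_density)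
    show "sigma_finite_measure (density lborel (indicator {b..<b + 1}) :: real measure)"
      using prob_space_unit_law[of b] unfolding unit_law_def
      by (simp add: prob_space_imp_sigma_finite)
  qed (auto intro: lborel.sigma_finite_measure_axioms)
  also have "(\<lambda>(x, y). indicator {a..<a + 1} x * indicator {b..<b + 1} y :: ennreal) =
      indicator ({a..<a + 1} \<times> {b..<b + 1})"
    by (auto simp: indicator_def fun_eq_iff)
  finally show ?thesis by (simp add: lborel_prod)
qed

lemma pmf_of_nat_measure:
  fixes N :: "nat measure"
  assumes "prob_space N" "sets N = UNIV"
  shows "\<exists>p. N = measure_pmf p"
proof -
  interpret prob_space N by fact
  have "AE x in N. measure N {x} \<noteq> 0"
    using AE_support_countable[OF assms(2)] by (auto intro: exI[of _ UNIV])
  then have "measure_pmf (Abs_pmf N) = N"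
    using assms by (intro Abs_pmf_inverse) simp
  then show ?thesis by metis
qed

text \<open>
  The coordinates are grouped by a role \<open>r\<close>: \<open>0\<close> and \<open>1\<close> for the two components of the points in the
  quarter plane, \<open>2\<close> for the points of the half line, and \<open>3\<close> for the initial state.
\<close>

definition site :: "nat \<Rightarrow> nat \<times> nat \<Rightarrow> nat" where
  "site r e = prod_encode (r, prod_encode e)"

lemma site_eq_iff[simp]: "site r e = site r' e' \<longleftrightarrow> r = r' \<and> e = e'"
  by (simp add: site_def)

text \<open>
  The quarter plane is partitioned into the unit squares with integer corners, numbered by pairing, and
  the half line into unit intervals.
\<close>

definition corner :: "nat \<Rightarrow> nat \<Rightarrow> real" where
  "corner r c = real (if r = 0 then fst (prod_decode c) else if r = 1 then snd (prod_decode c) else c)"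

text \<open>
  Numbers of points (index \<open>i = 0\<close>) and the initial state are stored as reals, to be read off by rounding
  down.
\<close>

definition model_law :: "nat pmf \<Rightarrow> nat \<Rightarrow> real measure" where
  "model_law \<pi> n = (case prod_decode n of (r, m) \<Rightarrow> case prod_decode m of (c, i) \<Rightarrow>
     if r = 3 then distr (measure_pmf \<pi>) borel real
     else if i = 0 then distr (measure_pmf (poisson_pmf 1)) borel real
     else unit_law (corner r c))"

lemma model_law_site:
  "model_law \<pi> (site 3 e) = distr (measure_pmf \<pi>) borel real"
  "r \<noteq> 3 \<Longrightarrow> model_law \<pi> (site r (c, 0)) = distr (measure_pmf (poisson_pmf 1)) borel real"
  "r \<noteq> 3 \<Longrightarrow> model_law \<pi> (site r (c, Suc i)) = unit_law (corner r c)"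
  by (simp_all add: model_law_def site_def split: prod.split)

locale reset_model =
  fixes \<pi> :: "nat pmf" and \<beta> :: real
  assumes rate: "0 < \<beta>"
begin

sublocale independent_coordinates "model_law \<pi>"
proof (rule independent_coordinates.intro)
  fix n
  obtain r c i where n: "n = site r (c, i)"
    unfolding site_def by (metis prod_encode_inverse prod_decode_inverse surj_pair)
  show "prob_space (model_law \<pi> n)"
    unfolding n by (cases "r = 3"; cases i)
      (auto simp: model_law_site prob_space_unit_law intro!: measure_pmf.prob_space_distr)
  show "sets (model_law \<pi> n) = sets borel"
    unfolding n by (cases "r = 3"; cases i) (auto simp: model_law_site sets_unit_law)
qed

text \<open>
  Rounding down undoes the embedding into the reals.
\<close>

lemma discrete_law:
  assumes "model_law \<pi> n = distr (measure_pmf p) borel real"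
  shows "distr M (count_space UNIV) (\<lambda>\<omega>. nat \<lfloor>\<omega> n\<rfloor>) = measure_pmf p"
proof -
  have "distr M (count_space UNIV) (\<lambda>\<omega>. nat \<lfloor>\<omega> n\<rfloor>) =
      distr (distr M borel (\<lambda>\<omega>. \<omega> n)) (count_space UNIV) (\<lambda>x. nat \<lfloor>x\<rfloor>)"
    by (subst distr_distr) (auto simp: comp_def)
  also have "\<dots> = distr (measure_pmf p) (count_space UNIV) (\<lambda>k. nat \<lfloor>real k\<rfloor>)"
    unfolding coordinate_law assms by (subst distr_distr) (auto simp: comp_def)
  also have "\<dots> = measure_pmf p"
    by (simp add: distr_id2)
  finally show ?thesis .
qed

definition plane :: "nat \<times> nat \<Rightarrow> (nat \<Rightarrow> real) \<Rightarrow> real \<times> real" where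
  "plane e \<omega> = (\<omega> (site 0 e), \<omega> (site 1 e))"

definition line :: "nat \<times> nat \<Rightarrow> (nat \<Rightarrow> real) \<Rightarrow> real" where
  "line e \<omega> = \<omega> (site 2 e)"

definition square :: "nat \<Rightarrow> (real \<times> real) set" where
  "square c = {corner 0 c..<corner 0 c + 1} \<times> {corner 1 c..<corner 1 c + 1}"

sublocale plane: poisson_sample M plane "\<lambda>p. nat \<lfloor>fst p\<rfloor>" "\<lambda>c. density lborel (indicator (square c))" quarter_plane
proof
  have "indep_vars (\<lambda>e. PiM {site 0 e, site 1 e} (\<lambda>_. borel))
      (\<lambda>e \<omega>. restrict (\<lambda>n. \<omega> n) {site 0 e, site 1 e}) UNIV"
    by (rule indep_vars_restrict[OF coordinates_independent]) (auto simp: disjoint_family_on_def)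
  then have "indep_vars (\<lambda>_. borel) (\<lambda>e \<omega>. (\<lambda>y. (y (site 0 e), y (site 1 e)))
      (restrict (\<lambda>n. \<omega> n) {site 0 e, site 1 e})) UNIV"
  proof (rule indep_vars_compose2)
    fix e :: "nat \<times> nat"
    show "(\<lambda>y. (y (site 0 e), y (site 1 e))) \<in> borel_measurable (PiM {site 0 e, site 1 e} (\<lambda>_. borel :: real measure))"
      unfolding borel_prod[symmetric] by (intro measurable_Pair measurable_component_singleton) auto
  qed
  then show "indep_vars (\<lambda>_. borel) plane UNIV"
    by (simp add: plane_def[abs_def])
  show "(\<lambda>p :: real \<times> real. nat \<lfloor>fst p\<rfloor>) \<in> measurable borel (count_space UNIV)"
    unfolding borel_prod[symmetric] by measurable
  show "distr M (count_space UNIV) (\<lambda>\<omega>. nat \<lfloor>fst (plane (c, 0) \<omega>)\<rfloor>) = measure_pmf (poisson_pmf 1)" for c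
    unfolding plane_def fst_conv by (rule discrete_law) (simp add: model_law_site)
  show "distr M borel (plane (c, Suc i)) = density lborel (indicator (square c))" for c i
  proof -
    have "indep_var borel (\<lambda>\<omega>. \<omega> (site 0 (c, Suc i))) borel (\<lambda>\<omega>. \<omega> (site 1 (c, Suc i)))"
      by (rule coordinate_pair_independent) simp
    then show ?thesis
      unfolding plane_def[abs_def] borel_prod[symmetric]
      by (simp add: indep_var_distribution_eq coordinate_law model_law_site unit_law_pair square_def)
  qed
  show "AE \<omega> in M. plane (c, Suc i) \<omega> \<noteq> plane (c', Suc i') \<omega>" if "(c, i) \<noteq> (c', i')" for c i c' i'
  proof -
    have "AE \<omega> in M. \<omega> (site 0 (c, Suc i)) \<noteq> \<omega> (site 0 (c', Suc i'))"
      using that by (intro coordinates_distinct) (auto simp: model_law_site unit_law_singleton)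
    then show ?thesis by eventually_elim (simp add: plane_def)
  qed
  fix A assume A: "A \<in> sets quarter_plane"
  then show Ab: "A \<in> sets borel" by (simp add: sets_quarter_plane)
  have "emeasure lborel A = (\<Sum>c. emeasure (density lborel (indicator (square c))) A)"
  proof (rule emeasure_partition)
    show "square c \<in> sets lborel" for c
      unfolding square_def by (simp add: borel_prod[symmetric])
    have corner_floor: "(x, y) \<in> square c \<longleftrightarrow> 0 \<le> x \<and> 0 \<le> y \<and> prod_decode c = (nat \<lfloor>x\<rfloor>, nat \<lfloor>y\<rfloor>)" for x y c
      by (cases "prod_decode c") (auto simp: square_def corner_def floor_eq_iff nat_eq_iff; linarith)
    show "disjoint_family square"
    proof (intro disjoint_familyI_eq)
      fix c d p
      assume p: "p \<in> square c" "p \<in> square d"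
      obtain x y where xy: "p = (x, y)" by (cases p)
      have "prod_decode c = prod_decode d"
        using corner_floor[THEN iffD1, OF p(1)[unfolded xy]] corner_floor[THEN iffD1, OF p(2)[unfolded xy]]
        by (elim conjE) simp
      then show "c = d" by (simp add: prod_decode_eq)
    qed
    show "A \<in> sets lborel" using Ab by simp
    show "A \<subseteq> (\<Union>c. square c)"
    proof
      fix p assume "p \<in> A"
      then have "0 \<le> fst p" "0 \<le> snd p" using A by (auto simp: sets_quarter_plane)
      then have "p \<in> square (prod_encode (nat \<lfloor>fst p\<rfloor>, nat \<lfloor>snd p\<rfloor>))"
        using corner_floor[of "fst p" "snd p"] by simp
      then show "p \<in> (\<Union>c. square c)" by blast
    qed
  qed
  then show "emeasure quarter_plane A = (\<Sum>c. emeasure (density lborel (indicator (square c))) A)"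
    by (simp add: emeasure_quarter_plane[OF A])
qed

sublocale line: poisson_sample M line "\<lambda>x. nat \<lfloor>x\<rfloor>" "\<lambda>c. unit_law (real c)" half_line
proof
  have "indep_vars (\<lambda>e. PiM {site 2 e} (\<lambda>_. borel)) (\<lambda>e \<omega>. restrict (\<lambda>n. \<omega> n) {site 2 e}) UNIV"
    by (rule indep_vars_restrict[OF coordinates_independent]) (auto simp: disjoint_family_on_def)
  then have "indep_vars (\<lambda>_. borel) (\<lambda>e \<omega>. (\<lambda>y. y (site 2 e)) (restrict (\<lambda>n. \<omega> n) {site 2 e})) UNIV"
    by (rule indep_vars_compose2) (rule measurable_component_singleton, simp)
  then show "indep_vars (\<lambda>_. borel) line UNIV"
    by (simp add: line_def[abs_def])
  show "(\<lambda>x :: real. nat \<lfloor>x\<rfloor>) \<in> measurable borel (count_space UNIV)" by measurable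
  show "distr M (count_space UNIV) (\<lambda>\<omega>. nat \<lfloor>line (c, 0) \<omega>\<rfloor>) = measure_pmf (poisson_pmf 1)" for c
    unfolding line_def by (rule discrete_law) (simp add: model_law_site)
  show "distr M borel (line (c, Suc i)) = unit_law (real c)" for c i
    unfolding line_def[abs_def] by (simp add: coordinate_law model_law_site corner_def)
  show "AE \<omega> in M. line (c, Suc i) \<omega> \<noteq> line (c', Suc i') \<omega>" if "(c, i) \<noteq> (c', i')" for c i c' i'
    unfolding line_def using that by (intro coordinates_distinct) (auto simp: model_law_site unit_law_singleton)
  fix A assume A: "A \<in> sets half_line"
  then show Ab: "A \<in> sets borel" by (simp add: sets_half_line)
  have "emeasure lborel A = (\<Sum>c. emeasure (unit_law (real c)) A)"
    unfolding unit_law_def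
  proof (rule emeasure_partition)
    have cell: "x \<in> {real c..<real c + 1} \<longleftrightarrow> 0 \<le> x \<and> c = nat \<lfloor>x\<rfloor>" for x c
      by (auto simp: floor_eq_iff nat_eq_iff; linarith)
    show "disjoint_family (\<lambda>c. {real c..<real c + 1})"
    proof (intro disjoint_familyI_eq)
      fix m n x
      assume x: "x \<in> {real m..<real m + 1}" "x \<in> {real n..<real n + 1}"
      show "m = n"
        using cell[THEN iffD1, OF x(1)] cell[THEN iffD1, OF x(2)] by (elim conjE) simp
    qed
    show "A \<subseteq> (\<Union>c. {real c..<real c + 1})"
    proof
      fix x assume "x \<in> A"
      then have "0 \<le> x" using A unfolding sets_half_line by auto
      then have "x \<in> {real (nat \<lfloor>x\<rfloor>)..<real (nat \<lfloor>x\<rfloor>) + 1}" by (intro cell[THEN iffD2]) simp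
      then show "x \<in> (\<Union>c. {real c..<real c + 1})" by (rule UN_I[OF UNIV_I])
    qed
  qed (use Ab in auto)
  then show "emeasure half_line A = (\<Sum>c. emeasure (unit_law (real c)) A)"
    by (simp add: emeasure_half_line[OF A])
qed

definition initial :: "(nat \<Rightarrow> real) \<Rightarrow> nat" where
  "initial \<omega> = nat \<lfloor>\<omega> (site 3 (0, 0))\<rfloor>"

definition queue :: "real \<Rightarrow> (nat \<Rightarrow> real) \<Rightarrow> nat" where
  "queue t \<omega> = reset_path \<beta> (initial \<omega>) (plane.points \<omega>) (line.points \<omega>) t"

lemma measurable_initial: "initial \<in> measurable M (count_space UNIV)"
  unfolding initial_def by measurable

lemma no_reset_iff:
  assumes "0 \<le> s"
  shows "line.points \<omega> \<inter> {s<..t} = {} \<longleftrightarrow>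
    (\<forall>e. snd e < nat \<lfloor>line (fst e, 0) \<omega>\<rfloor> \<longrightarrow>
      \<not> (s < line (fst e, Suc (snd e)) \<omega> \<and> line (fst e, Suc (snd e)) \<omega> \<le> t))"
proof -
  have "{s<..t} \<subseteq> space half_line" using assms by (auto simp: space_half_line)
  from line.points_Int[OF this] show ?thesis by auto
qed

text \<open>
  An arrival is counted by a criterion that depends on the second process, and not by its position in a
  fixed region; \<open>act\<close> expresses the criterion in terms of the samples of both processes.
\<close>

lemma measurable_queue: "queue t \<in> measurable M (count_space UNIV)"
proof -
  let ?V = "\<lambda>e. plane (fst e, Suc (snd e))"
  let ?no_reset = "\<lambda>s \<omega>. \<forall>e. snd e < nat \<lfloor>line (fst e, 0) \<omega>\<rfloor> \<longrightarrow>
      \<not> (s < line (fst e, Suc (snd e)) \<omega> \<and> line (fst e, Suc (snd e)) \<omega> \<le> t)"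
  define act where "act e \<omega> \<longleftrightarrow> snd e < nat \<lfloor>fst (plane (fst e, 0) \<omega>)\<rfloor> \<and>
      0 < fst (?V e \<omega>) \<and> fst (?V e \<omega>) \<le> t \<and> 0 \<le> snd (?V e \<omega>) \<and> snd (?V e \<omega>) \<le> \<beta> \<and>
      ?no_reset (fst (?V e \<omega>)) \<omega>" for e \<omega>
  have [measurable]: "(\<lambda>\<omega>. fst (plane e \<omega>)) \<in> borel_measurable M" "(\<lambda>\<omega>. snd (plane e \<omega>)) \<in> borel_measurable M"
    for e by (simp_all add: plane_def)
  have [measurable]: "(\<lambda>\<omega>. nat \<lfloor>fst (plane e \<omega>)\<rfloor>) \<in> measurable M (count_space UNIV)"
    "(\<lambda>\<omega>. nat \<lfloor>line e \<omega>\<rfloor>) \<in> measurable M (count_space UNIV)" for e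
    by measurable
  have act: "Measurable.pred M (act e)" for e
    unfolding act_def by measurable
  have no_reset: "Measurable.pred M (?no_reset 0)"
    by measurable
  have "(\<lambda>\<omega>. card {?V e \<omega> |e. act e \<omega>}) \<in> measurable M (count_space UNIV)"
    by (rule measurable_card_points[OF plane.measurable_Y act])
  moreover have "{?V e \<omega> |e. act e \<omega>} = {(s, u) \<in> plane.points \<omega>.
      0 < s \<and> s \<le> t \<and> 0 \<le> u \<and> u \<le> \<beta> \<and> line.points \<omega> \<inter> {s<..t} = {}}" for \<omega>
  proof (intro set_eqI iffI)
    fix p assume "p \<in> {?V e \<omega> |e. act e \<omega>}"
    then obtain c i where e: "p = plane (c, Suc i) \<omega>" "act (c, i) \<omega>" by auto
    obtain s u where p: "p = (s, u)" by (cases p)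
    have *: "i < nat \<lfloor>fst (plane (c, 0) \<omega>)\<rfloor>" "0 < s" "s \<le> t" "0 \<le> u" "u \<le> \<beta>" "?no_reset s \<omega>"
      using e(2) unfolding act_def fst_conv snd_conv e(1)[symmetric] p by blast+
    have "(s, u) \<in> space quarter_plane" using *(2,4) by (simp add: space_quarter_plane)
    then have "(s, u) \<in> plane.points \<omega>"
      using e(1) *(1) unfolding p plane.points_def by blast
    then show "p \<in> {(s, u) \<in> plane.points \<omega>.
      0 < s \<and> s \<le> t \<and> 0 \<le> u \<and> u \<le> \<beta> \<and> line.points \<omega> \<inter> {s<..t} = {}}"
      using * no_reset_iff[of s \<omega> t] p by simp
  next
    fix p assume "p \<in> {(s, u) \<in> plane.points \<omega>.
      0 < s \<and> s \<le> t \<and> 0 \<le> u \<and> u \<le> \<beta> \<and> line.points \<omega> \<inter> {s<..t} = {}}"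
    then obtain s u where p: "p = (s, u)" "(s, u) \<in> plane.points \<omega>"
        "0 < s" "s \<le> t" "0 \<le> u" "u \<le> \<beta>" "line.points \<omega> \<inter> {s<..t} = {}"
      by auto
    from p(2) obtain c i where e: "(s, u) = plane (c, Suc i) \<omega>" "i < nat \<lfloor>fst (plane (c, 0) \<omega>)\<rfloor>"
      unfolding plane.points_def by auto
    have "act (c, i) \<omega>"
      using p(3-7) e(2) no_reset_iff[of s \<omega> t] unfolding act_def fst_conv snd_conv e(1)[symmetric] by simp
    then show "p \<in> {?V e \<omega> |e. act e \<omega>}"
      using p(1) e(1) by (intro CollectI exI[of _ "(c, i)"]) simp
  qed
  moreover have "(\<lambda>\<omega>. if ?no_reset 0 \<omega> then initial \<omega> else 0) \<in> measurable M (count_space UNIV)"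
    using no_reset measurable_initial by measurable
  moreover have "(if ?no_reset 0 \<omega> then initial \<omega> else 0) = (if line.points \<omega> \<inter> {0<..t} = {} then initial \<omega> else 0)" for \<omega>
    using no_reset_iff[of 0 \<omega> t] by simp
  ultimately show ?thesis
    unfolding queue_def[abs_def] reset_path_def by simp
qed

text \<open>
  Almost surely for all integer times at once, hence for all times.
\<close>

lemma driving_points_finite: "AE \<omega> in M. reset_points \<beta> (plane.points \<omega>) (line.points \<omega>)"
proof -
  have "AE \<omega> in M. \<forall>n::nat. finite (plane.points \<omega> \<inter> ({0<..real n} \<times> {0..\<beta>}))"
    unfolding AE_all_countable
  proof
    fix n :: nat
    show "AE \<omega> in M. finite (plane.points \<omega> \<inter> ({0<..real n} \<times> {0..\<beta>}))"
      using plane.points_count[of "{0<..real n} \<times> {0..\<beta>}"] arrival_cell[of 0 "real n" \<beta>] rate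
      by simp
  qed
  moreover have "AE \<omega> in M. \<forall>n::nat. finite (line.points \<omega> \<inter> {0<..real n})"
    unfolding AE_all_countable
  proof
    fix n :: nat
    show "AE \<omega> in M. finite (line.points \<omega> \<inter> {0<..real n})"
      using line.points_count[of "{0<..real n}"] reset_cell[of 0 "real n"] by simp
  qed
  ultimately show ?thesis
  proof eventually_elim
    case (elim \<omega>)
    show ?case
    proof
      fix t
      obtain n where n: "t \<le> real n" using real_arch_simple by blast
      show "finite (plane.points \<omega> \<inter> ({0<..t} \<times> {0..\<beta>}))"
        by (rule finite_subset[OF _ elim(1)[THEN spec, of n]]) (use n in auto)
      show "finite (line.points \<omega> \<inter> {0<..t})"
        by (rule finite_subset[OF _ elim(2)[THEN spec, of n]]) (use n in auto)
    qed
  qed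
qed

lemma queue_0: "queue 0 = initial"
proof
  fix \<omega>
  have "{(s, u) \<in> plane.points \<omega>. 0 < s \<and> s \<le> 0 \<and> 0 \<le> u \<and> u \<le> \<beta> \<and> line.points \<omega> \<inter> {s<..0} = {}} = {}"
    by auto
  then show "queue 0 \<omega> = initial \<omega>"
    unfolding queue_def by (simp only: reset_path_def) simp
qed

text \<open>
  The initial state and the two driving processes use disjoint sets of coordinates, which gives both
  independence requirements; the equation holds path by path.
\<close>

lemma mckean_vlasov_queue: "mckean_vlasov_process random_algorithm \<beta> M plane.points line.points queue"
  unfolding mckean_vlasov_process_def
proof (intro conjI)
  define I where "I r = range (site r)" for r
  have plane_events: "point_process_events M quarter_plane plane.points \<subseteq> sets (block (I 0 \<union> I 1))"
  proof (rule plane.point_process_events_subset[OF space_block])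
    fix e
    show "plane e \<in> borel_measurable (block (I 0 \<union> I 1))"
      unfolding plane_def[abs_def] borel_prod[symmetric]
      by (intro measurable_Pair measurable_block) (auto simp: I_def)
  qed
  have line_events: "point_process_events M half_line line.points \<subseteq> sets (block (I 2))"
  proof (rule line.point_process_events_subset[OF space_block])
    fix e
    show "line e \<in> borel_measurable (block (I 2))"
      unfolding line_def[abs_def] by (intro measurable_block) (auto simp: I_def)
  qed
  have init_events: "initial_events M (queue 0) \<subseteq> sets (block (I 3))"
  proof
    fix E assume "E \<in> initial_events M (queue 0)"
    then obtain B where E: "E = initial -` B \<inter> space M"
      unfolding initial_events_def queue_0 by blast
    have "(\<lambda>\<omega>. \<omega> (site 3 (0, 0))) \<in> borel_measurable (block (I 3))"
      by (rule measurable_block) (simp add: I_def)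
    then have "initial \<in> measurable (block (I 3)) (count_space UNIV)"
      unfolding initial_def[abs_def] by measurable
    from measurable_sets[OF this, of B] show "E \<in> sets (block (I 3))"
      by (simp add: E space_block)
  qed
  show "prob_space M" by (rule prob_space_axioms)
  show "poisson_point_process M quarter_plane plane.points" by (rule plane.poisson_point_process_points)
  show "poisson_point_process M half_line line.points" by (rule line.poisson_point_process_points)
  show "indep_set (point_process_events M quarter_plane plane.points) (point_process_events M half_line line.points)"
    by (rule blocks_independent[OF _ plane_events line_events]) (auto simp: I_def)
  show "indep_set (initial_events M (queue 0)) (sigma_sets (space M)
      (point_process_events M quarter_plane plane.points \<union> point_process_events M half_line line.points))"
  proof (rule blocks_independent[OF _ init_events])
    have "sets (block (I 0 \<union> I 1)) \<subseteq> sets (block (I 0 \<union> I 1 \<union> I 2))"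
      "sets (block (I 2)) \<subseteq> sets (block (I 0 \<union> I 1 \<union> I 2))"
      by (intro sets_block_mono; blast)+
    then show "sigma_sets (space M) (point_process_events M quarter_plane plane.points \<union>
        point_process_events M half_line line.points) \<subseteq> sets (block (I 0 \<union> I 1 \<union> I 2))"
      unfolding space_block[of "I 0 \<union> I 1 \<union> I 2", symmetric]
      using plane_events line_events by (intro sets.sigma_sets_subset) blast
  qed (auto simp: I_def)
  show "\<forall>t\<ge>0. queue t \<in> measurable M (count_space UNIV)"
    using measurable_queue by blast
  have "\<exists>q. distr M (count_space UNIV) (queue t) = measure_pmf q" for t
    by (intro pmf_of_nat_measure prob_space_distr measurable_queue) simp
  then obtain p where p: "\<And>t. distr M (count_space UNIV) (queue t) = measure_pmf (p t)"
    by metis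
  show "\<exists>p :: real \<Rightarrow> nat pmf.
      (\<forall>t\<ge>0. distr M (count_space UNIV) (queue t) = measure_pmf (p t)) \<and>
      (AE \<omega> in M. cadlag (\<lambda>t. queue t \<omega>) \<and>
         (\<forall>t\<ge>0. finite (arrivals random_algorithm \<beta> p (plane.points \<omega>) (\<lambda>s. queue s \<omega>) t) \<and>
            finite (line.points \<omega> \<inter> {0<..t}) \<and>
            int (queue t \<omega>) = int (queue 0 \<omega>) +
              int (card (arrivals random_algorithm \<beta> p (plane.points \<omega>) (\<lambda>s. queue s \<omega>) t)) -
              (\<Sum>s\<in>line.points \<omega> \<inter> {0<..t}. int (left_limit (\<lambda>r. queue r \<omega>) s))))"
    (is "\<exists>p. _ p \<and> (AE \<omega> in M. ?sde p \<omega>)")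
  proof (intro exI[of _ p] conjI allI impI p)
    show "AE \<omega> in M. ?sde p \<omega>"
      using driving_points_finite
    proof (rule AE_mp, intro AE_I2 impI)
      fix \<omega> assume "reset_points \<beta> (plane.points \<omega>) (line.points \<omega>)"
      then interpret R: reset_points \<beta> "initial \<omega>" "plane.points \<omega>" "line.points \<omega>" .
      show "?sde p \<omega>"
        unfolding random_algorithm_arrivals queue_def
        using R.cadlag_reset_path R.finite_arrivals R.finite_resets R.reset_path_equation
        unfolding R.reset_path_0 by blast
    qed
  qed
qed

lemma queue_0_law: "distr M (count_space UNIV) (queue 0) = measure_pmf \<pi>"
  unfolding queue_0 initial_def[abs_def] by (rule discrete_law) (rule model_law_site)

end

theorem proposition8:
  shows
    "(\<forall>\<beta>>0. invariant_distribution TYPE('w) random_algorithm \<beta> (geometric_law (\<beta> / (1 + \<beta>)))) \<and>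
     (\<forall>\<beta>>0. \<forall>\<pi>. invariant_distribution TYPE(nat \<Rightarrow> real) random_algorithm \<beta> \<pi> \<longleftrightarrow>
        \<pi> = geometric_law (\<beta> / (1 + \<beta>))) \<and>
     (\<forall>(\<Omega> :: real \<Rightarrow> 'y measure) (Y :: real \<Rightarrow> 'y \<Rightarrow> nat) (N :: 'e measure) (E :: 'e \<Rightarrow> real).
        (\<forall>\<beta>>0. prob_space (\<Omega> \<beta>) \<and>
           Y \<beta> \<in> measurable (\<Omega> \<beta>) (count_space UNIV) \<and>
           distr (\<Omega> \<beta>) (count_space UNIV) (Y \<beta>) =
             measure_pmf (geometric_law (\<beta> / (1 + \<beta>)))) \<and>
        prob_space N \<and> distributed N lborel E (exponential_density 1) \<longrightarrow>
        weak_conv_along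
          (\<lambda>\<beta>. distr (\<Omega> \<beta>) borel (\<lambda>\<omega>. real (Y \<beta> \<omega>) / \<beta>)) (distr N borel E) at_top)"
proof (intro conjI allI impI iffI)
  show "invariant_distribution TYPE('w) random_algorithm \<beta> (geometric_law (\<beta> / (1 + \<beta>)))" if "0 < \<beta>" for \<beta>
    by (rule geometric_law_invariant[OF that])
next
  fix \<beta> :: real and \<pi> :: "nat pmf"
  assume \<beta>: "0 < \<beta>" and inv: "invariant_distribution TYPE(nat \<Rightarrow> real) random_algorithm \<beta> \<pi>"
  interpret reset_model \<pi> \<beta> by unfold_locales (rule \<beta>)
  show "\<pi> = geometric_law (\<beta> / (1 + \<beta>))"
    by (rule invariant_imp_geometric[OF \<beta> inv mckean_vlasov_queue queue_0_law])
next
  fix \<beta> :: real and \<pi> :: "nat pmf"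
  assume "0 < \<beta>" "\<pi> = geometric_law (\<beta> / (1 + \<beta>))"
  then show "invariant_distribution TYPE(nat \<Rightarrow> real) random_algorithm \<beta> \<pi>"
    using geometric_law_invariant by simp
next
  fix \<Omega> :: "real \<Rightarrow> 'y measure" and Y :: "real \<Rightarrow> 'y \<Rightarrow> nat" and N :: "'e measure" and E :: "'e \<Rightarrow> real"
  assume "(\<forall>\<beta>>0. prob_space (\<Omega> \<beta>) \<and>
           Y \<beta> \<in> measurable (\<Omega> \<beta>) (count_space UNIV) \<and>
           distr (\<Omega> \<beta>) (count_space UNIV) (Y \<beta>) =
             measure_pmf (geometric_law (\<beta> / (1 + \<beta>)))) \<and>
        prob_space N \<and> distributed N lborel E (exponential_density 1)"
  then show "weak_conv_along
      (\<lambda>\<beta>. distr (\<Omega> \<beta>) borel (\<lambda>\<omega>. real (Y \<beta> \<omega>) / \<beta>)) (distr N borel E) at_top"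
    by (intro geometric_scaling_limit) auto
qed

end
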